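(* Let $F$ be a $d$-dimensional inner product distribution and suppose $(\{\mathbf{A}^{(g)}\}_{g=1}^m,\mathbf{X})\sim \mathrm{ESRDPG}(F,n,\{\mathbf{C}^{(g)}\}_{g=1}^m)$. Let $\hat{\mathbf{L}}=\mathrm{Omni}(\{\mathbf{A}^{(g)}\}_{g=1}^m,d)\in\mathbb{R}^{nm\times d}$ and let $\mathbf{L}\in\mathbb{R}^{nm\times d}$ be the block matrix whose $g$-th $n\times d$ block is $\mathbf{X}\sqrt{\mathbf{C}^{(g)}}$. Then there exists a sequence of (random) $d\times d$ orthogonal matrices $\{\tilde{\mathbf{W}}_n\}_{n\ge1}$, depending on $\tilde{\mathbf{A}}$ and $\tilde{\mathbf{P}}$, such that for every $h=n(g-1)+i$ with $g\in[m]$, $i\in[n]$, $$(\hat{\mathbf{L}}\tilde{\mathbf{W}}_n-\mathbf{L})_h=\big(\mathbf{S}^{(g)}-\sqrt{\mathbf{C}^{(g)}}\big)\mathbf{X}_i+\mathbf{R}_h,$$ where $\mathbf{S}^{(g)}=\tfrac12\big[\mathbf{C}^{(g)}\mathbf{C}_m^{-1/4}+\mathbf{C}_m^{1/4}\big]$, $\mathbf{C}_m=m^{-1}\sum_{g=1}^m(\mathbf{C}^{(g)})^2$, and the residual satisfies, with high probability, $$\max_{h\in[nm]}\|\mathbf{R}_h\|_2\le C\,m^{3/2}\,\frac{\log nm}{\sqrt n}$$ for a constant $C>0$ not depending on $n$.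
   Context: Conventions. $[k]=\{1,\dots,k\}$. For a matrix $\mathbf{M}$, $\mathbf{M}_i$ denotes its $i$-th row written as a column vector. $m$, $d$, $F$ and the $\mathbf{C}^{(g)}$ are fixed while $n$ varies. Events $E_n$ occur with high probability if $\mathbb{P}(E_n^c)\le (nm)^{-2}$ (for all sufficiently large $n$). Inner product distribution. A distribution $F$ on $\mathbb{R}^d$ is a $d$-dimensional inner product distribution if $\mathbf{x}^T\mathbf{y}\in[0,1]$ for all $\mathbf{x},\mathbf{y}\in\mathrm{supp}(F)$. Its diagonal weighting space $\mathcal{C}_F$ is the set of diagonal $d\times d$ matrices $\mathbf{C}$ with nonnegative entries such that $\mathbf{x}^T\mathbf{C}\mathbf{y}\in[0,1]$ for all $\mathbf{x},\mathbf{y}\in\mathrm{supp}(F)$. ESRDPG. Let $F$ be a $d$-dimensional inner product distribution whose second moment matrix $\Delta=\mathbb{E}[\mathbf{y}\mathbf{y}^T]$ ($\mathbf{y}\sim F$) is diagonal and full rank. Let $\mathbf{X}_1,\dots,\mathbf{X}_n$ be i.i.d. from $F$, forming the rows of $\mathbf{X}\in\mathbb{R}^{n\times d}$, and let $\mathbf{C}^{(1)},\dots,\mathbf{C}^{(m)}\in\mathcal{C}_F$ satisfy $\min_{i\in[d]}\max_{g\in[m]}\mathbf{C}^{(g)}_{ii}>0$. Then $(\{\mathbf{A}^{(g)}\}_{g=1}^m,\mathbf{X})\sim\mathrm{ESRDPG}(F,n,\{\mathbf{C}^{(g)}\}_{g=1}^m)$ means that each $\mathbf{A}^{(g)}$ is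 a symmetric $n\times n$ adjacency matrix with zero diagonal and, conditionally on $\mathbf{X}$, the entries $\mathbf{A}^{(g)}_{ij}$, $i<j$, $g\in[m]$, are independent with $\mathbf{A}^{(g)}_{ij}\sim\mathrm{Bernoulli}(\mathbf{X}_i^T\mathbf{C}^{(g)}\mathbf{X}_j)$. Write $\mathbf{P}^{(g)}=\mathbf{X}\mathbf{C}^{(g)}\mathbf{X}^T$. Omnibus embedding. The omnibus matrix of $n\times n$ symmetric matrices $\{\mathbf{B}^{(g)}\}_{g=1}^m$ is the $nm\times nm$ block matrix whose $(g,k)$ block is $\frac12(\mathbf{B}^{(g)}+\mathbf{B}^{(k)})$; $\tilde{\mathbf{A}}$ and $\tilde{\mathbf{P}}$ are the omnibus matrices of $\{\mathbf{A}^{(g)}\}$ and $\{\mathbf{P}^{(g)}\}$. $\mathrm{Omni}(\{\mathbf{B}^{(g)}\},d)=\mathbf{U}\mathbf{\Lambda}^{1/2}\in\mathbb{R}^{nm\times d}$, where $\mathbf{\Lambda}$ is the diagonal matrix of the $d$ largest positive eigenvalues of the omnibus matrix in non-increasing order and the columns of $\mathbf{U}$ are corresponding orthonormal eigenvectors (defined arbitrarily if there are fewer than $d$ positive eigenvalues).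
   Formalization: The orthogonal matrices may depend on the latent positions X as well as on Ã and P̃; dependence on Ã and P̃ alone is impossible in general, since P̃ does not determine X (e.g. F uniform on (.7,.5),(.7,-.5) with m=1, C=I). *)

theory Defs
  imports "HOL-Probability.Probability" "Jordan_Normal_Form.Char_Poly"
begin

no_notation vec_index (infixl "$" 100)
no_notation scalar_prod (infix "\<bullet>" 70)

section \<open>Inner product distributions\<close>

definition support :: "'a::topological_space measure \<Rightarrow> 'a set" where
  "support F = {x. \<forall>V. open V \<longrightarrow> x \<in> V \<longrightarrow> emeasure F V > 0}"

definition inner_product_distribution :: "(real ^ 'd) measure \<Rightarrow> bool" where
  "inner_product_distribution F \<longleftrightarrow>
     prob_space F \<and> sets F = sets borel \<and>
     (\<forall>x\<in>support F. \<forall>y\<in>support F. x \<bullet> y \<in> {0..1})"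

definition diagonal_matrix :: "real ^ 'd ^ 'd \<Rightarrow> bool" where
  "diagonal_matrix D \<longleftrightarrow> (\<forall>i j. i \<noteq> j \<longrightarrow> D $ i $ j = 0)"

definition diagonal_weighting_space :: "(real ^ 'd) measure \<Rightarrow> (real ^ 'd ^ 'd) set" where
  "diagonal_weighting_space F =
     {D. diagonal_matrix D \<and> (\<forall>i. D $ i $ i \<ge> 0) \<and>
         (\<forall>x\<in>support F. \<forall>y\<in>support F. x \<bullet> (D *v y) \<in> {0..1})}"

definition second_moment_matrix :: "(real ^ 'd) measure \<Rightarrow> real ^ 'd ^ 'd" where
  "second_moment_matrix F = (\<chi> i j. \<integral>y. y $ i * y $ j \<partial>F)"

text \<open>Real powers of diagonal matrices with nonnegative entries, taken on the diagonal;
  since \<open>0 powr a = 0\<close>, the exponent \<open>1/2\<close> gives the square root also at zero entries.\<close>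

definition diag_powr :: "real ^ 'd ^ 'd \<Rightarrow> real \<Rightarrow> real ^ 'd ^ 'd" where
  "diag_powr D a = (\<chi> i j. if i = j then (D $ i $ i) powr a else 0)"

section \<open>The ESRDPG model\<close>

text \<open>Graphs \<open>g \<in> [m]\<close>, vertices \<open>i \<in> [n]\<close> and rows \<open>h \<in> [nm]\<close> are counted from \<open>0\<close>,
  so that \<open>h = n * g + i\<close> with \<open>g < m\<close> and \<open>i < n\<close>. A matrix with \<open>n\<close> (or \<open>nm\<close>) rows and \<open>d\<close>
  columns is given by its rows, as a function \<open>nat \<Rightarrow> real ^ 'd\<close>.\<close>

definition adjacency_matrix :: "nat \<Rightarrow> real mat \<Rightarrow> bool" where
  "adjacency_matrix n B \<longleftrightarrow>
     B \<in> carrier_mat n n \<and> transpose_mat B = B \<and>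
     (\<forall>i<n. \<forall>j<n. B $$ (i, j) \<in> {0, 1}) \<and> (\<forall>i<n. B $$ (i, i) = 0)"

text \<open>The \<sigma>-algebra generated by the rows \<open>X 0, \<dots>, X (n - 1)\<close>.\<close>

definition latent_algebra :: "'w measure \<Rightarrow> nat \<Rightarrow> (nat \<Rightarrow> 'w \<Rightarrow> real ^ 'd) \<Rightarrow> 'w measure" where
  "latent_algebra M n X =
     vimage_algebra (space M) (\<lambda>\<omega>. \<lambda>i\<in>{..<n}. X i \<omega>) (\<Pi>\<^sub>M i\<in>{..<n}. borel)"

definition edge_indices :: "nat \<Rightarrow> nat \<Rightarrow> (nat \<times> nat \<times> nat) set" where
  "edge_indices m n = {(g, i, j). g < m \<and> i < j \<and> j < n}"

text \<open>The last clause of the following definition gives the conditional joint probability mass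
  function, given the latent positions, of the entries above the diagonals: it is the product of
  the Bernoulli mass functions. Summing over the remaining entries yields the conditional
  marginals.\<close>

definition ESRDPG ::
  "(real ^ 'd) measure \<Rightarrow> nat \<Rightarrow> nat \<Rightarrow> (nat \<Rightarrow> real ^ 'd ^ 'd) \<Rightarrow> 'w measure \<Rightarrow>
   (nat \<Rightarrow> 'w \<Rightarrow> real mat) \<Rightarrow> (nat \<Rightarrow> 'w \<Rightarrow> real ^ 'd) \<Rightarrow> bool" where
  "ESRDPG F n m C M A X \<longleftrightarrow>
     inner_product_distribution F \<and>
     diagonal_matrix (second_moment_matrix F) \<and>
     rank (second_moment_matrix F) = CARD('d) \<and>
     m \<ge> 1 \<and>
     (\<forall>g<m. C g \<in> diagonal_weighting_space F) \<and>
     (MIN i. MAX g\<in>{..<m}. C g $ i $ i) > 0 \<and>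
     prob_space M \<and>
     (\<forall>i<n. X i \<in> borel_measurable M \<and> distr M borel (X i) = F) \<and>
     prob_space.indep_vars M (\<lambda>_. borel) X {..<n} \<and>
     (\<forall>g<m. \<forall>\<omega>\<in>space M. adjacency_matrix n (A g \<omega>)) \<and>
     (\<forall>g<m. \<forall>i<n. \<forall>j<n. (\<lambda>\<omega>. A g \<omega> $$ (i, j)) \<in> borel_measurable M) \<and>
     (\<forall>a :: nat \<times> nat \<times> nat \<Rightarrow> bool.
        AE \<omega> in M.
          real_cond_exp M (latent_algebra M n X)
            (indicator {\<omega>'\<in>space M. \<forall>(g, i, j)\<in>edge_indices m n.
               A g \<omega>' $$ (i, j) = of_bool (a (g, i, j))}) \<omega>
          = (\<Prod>(g, i, j)\<in>edge_indices m n.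
               pmf (bernoulli_pmf (X i \<omega> \<bullet> (C g *v X j \<omega>))) (a (g, i, j))))"

definition edge_probability_matrix ::
  "nat \<Rightarrow> real ^ 'd ^ 'd \<Rightarrow> (nat \<Rightarrow> real ^ 'd) \<Rightarrow> real mat" where
  "edge_probability_matrix n D x = mat n n (\<lambda>(i, j). x i \<bullet> (D *v x j))"

section \<open>The omnibus embedding\<close>

definition omnibus_matrix :: "nat \<Rightarrow> real mat list \<Rightarrow> real mat" where
  "omnibus_matrix n Bs =
     mat (n * length Bs) (n * length Bs) (\<lambda>(h, h').
       (Bs ! (h div n) $$ (h mod n, h' mod n) + Bs ! (h' div n) $$ (h mod n, h' mod n)) / 2)"

text \<open>Real eigenvalues with multiplicity, in non-increasing order.\<close>

definition eigenvalues_desc :: "real mat \<Rightarrow> real list" where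
  "eigenvalues_desc B = rev (sorted_list_of_multiset (proots (char_poly B)))"

text \<open>The eigenvalue belonging to column \<open>k\<close>; the columns are indexed by the linearly ordered
  type \<open>'d\<close>, and \<open>card {..<k}\<close> is the position of \<open>k\<close> in it.\<close>

definition top_eigenvalue :: "real mat \<Rightarrow> 'd::{finite,linorder} \<Rightarrow> real" where
  "top_eigenvalue B k = eigenvalues_desc B ! card {..<k}"

text \<open>\<open>is_omni n Bs L\<close>: the matrix with rows \<open>L h\<close> is a value of \<open>Omni(Bs, d)\<close>.
  Eigenvectors are not unique, hence a relation. It imposes nothing on \<open>L\<close> if there are fewer
  than \<open>d\<close> positive eigenvalues.\<close>

definition is_omni :: "nat \<Rightarrow> real mat list \<Rightarrow> (nat \<Rightarrow> real ^ 'd::{finite,linorder}) \<Rightarrow> bool" where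
  "is_omni n Bs L \<longleftrightarrow>
     (let B = omnibus_matrix n Bs in
        length (filter (\<lambda>e. e > 0) (eigenvalues_desc B)) \<ge> CARD('d) \<longrightarrow>
        (\<exists>U :: 'd \<Rightarrow> real vec.
           (\<forall>k. eigenvector B (U k) (top_eigenvalue B k)) \<and>
           (\<forall>k l. scalar_prod (U k) (U l) = (if k = l then 1 else 0)) \<and>
           (\<forall>h < n * length Bs. L h = (\<chi> k. vec_index (U k) h * sqrt (top_eigenvalue B k)))))"

text \<open>A choice of the embedding for all inputs. Being a function of the matrices only, it makes
  no use of the latent positions or of further randomness.\<close>

definition omni_choice :: "(nat \<Rightarrow> real mat list \<Rightarrow> nat \<Rightarrow> real ^ 'd::{finite,linorder}) \<Rightarrow> bool" where
  "omni_choice Omni \<longleftrightarrow>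
     (\<forall>n Bs. (\<forall>B\<in>set Bs. B \<in> carrier_mat n n \<and> transpose_mat B = B) \<longrightarrow>
        is_omni n Bs (Omni n Bs))"

section \<open>Limits and bias\<close>

definition mean_square_weight :: "nat \<Rightarrow> (nat \<Rightarrow> real ^ 'd ^ 'd) \<Rightarrow> real ^ 'd ^ 'd" where
  "mean_square_weight m C = (1 / real m) *\<^sub>R (\<Sum>g<m. C g ** C g)"

definition omni_weight :: "nat \<Rightarrow> (nat \<Rightarrow> real ^ 'd ^ 'd) \<Rightarrow> nat \<Rightarrow> real ^ 'd ^ 'd" where
  "omni_weight m C g =
     (1 / 2) *\<^sub>R (C g ** diag_powr (mean_square_weight m C) (- 1 / 4) +
                diag_powr (mean_square_weight m C) (1 / 4))"

definition scaled_latent_positions ::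
  "nat \<Rightarrow> (nat \<Rightarrow> real ^ 'd ^ 'd) \<Rightarrow> (nat \<Rightarrow> real ^ 'd) \<Rightarrow> nat \<Rightarrow> real ^ 'd" where
  "scaled_latent_positions n C x h = x (h mod n) v* diag_powr (C (h div n)) (1 / 2)"

definition with_high_probability ::
  "nat \<Rightarrow> (nat \<Rightarrow> 'w measure) \<Rightarrow> (nat \<Rightarrow> 'w \<Rightarrow> bool) \<Rightarrow> bool" where
  "with_high_probability m M E \<longleftrightarrow>
     (\<forall>\<^sub>F n in sequentially.
        {\<omega>\<in>space (M n). \<not> E n \<omega>} \<in> sets (M n) \<and>
        measure (M n) {\<omega>\<in>space (M n). \<not> E n \<omega>} \<le> 1 / (real (n * m))\<^sup>2)"

end

theory Submission
  imports Defs "Jordan_Normal_Form.Spectral_Radius" "HOL-Real_Asymp.Real_Asymp"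
begin

text \<open>Write the expected omnibus matrix as \<open>Z Z\<^sup>T - Y Y\<^sup>T\<close>, where the rows of \<open>Z\<close> are the claimed
  limits \<open>S\<^sup>g X\<^sub>i\<close> and those of \<open>Y\<close> are \<open>(C\<^sup>g C\<^sub>m\<^sup>-\<^sup>1\<^sup>/\<^sup>4 - C\<^sub>m\<^sup>1\<^sup>/\<^sup>4) X\<^sub>i / 2\<close>. Up to the fluctuations of the Gram
  matrix of \<open>X\<close>, which are of order \<open>\<tau> = sqrt n * ln (n m)\<close>, the columns of \<open>Y\<close> are orthogonal to those
  of \<open>Z\<close>; the noise \<open>E = A - P\<close> has norm of order \<open>\<tau>\<close>, too. For orthonormal eigenvectors \<open>U\<close> with
  eigenvalues \<open>\<Lambda>\<close> of order \<open>n\<close>, the equation \<open>U \<Lambda> = Z (Z\<^sup>T U) - Y (Y\<^sup>T U) + E U\<close> multiplied by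
  \<open>Y\<^sup>T\<close> shows that \<open>Y\<^sup>T U\<close> is small, because \<open>\<Lambda> + Y\<^sup>T Y\<close> is bounded below by \<open>\<Lambda>\<close>. Hence
  \<open>U \<Lambda>\<^sup>1\<^sup>/\<^sup>2\<close> is close to \<open>Z M\<close> with \<open>M = Z\<^sup>T U \<Lambda>\<^sup>-\<^sup>1\<^sup>/\<^sup>2\<close> almost orthogonal. A single row of \<open>E U\<close> is
  estimated by substituting the equation for \<open>U\<close> once more: the rows of \<open>E Z\<close> are sums of independent
  terms, and the rows of \<open>E\<close> have norm at most \<open>sqrt (n m)\<close>.\<close>

text \<open>The obstacle is that the error is wanted in every single row. The norm bound on E alone
  controls a row of E U only by order \<open>\<tau>\<close>; divided by the square root of an
  eigenvalue this leaves ln (n m), no decay at all. Nor does a concentration inequality apply to a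
  row of E U directly, since U depends on E. Substituting the eigenvector equation replaces U by Z,
  which is fixed once X is given, and gains the missing factor sqrt n. Z and Y come from a single
  coordinate: the m by m matrix with entries (c_g + c_k) / 2 has rank at most two, with one positive
  and one negative direction. Coinciding eigenvalues do no harm, because every orthonormal choice of
  eigenvectors satisfies the same equation and M absorbs the ambiguity. All errors are measured by
  one parameter \<sigma> = 8 ln (n m) / sqrt n, relative to n, and the final bound is linear in it.
  The perturbation argument is deterministic for a fixed sample. The logarithm in \<tau> makes the
  tail bounds exponentials of minus a multiple of ln (n m) squared, hence smaller than any power of
  n m.\<close>

no_notation vec_index (infixl "$" 100)
no_notation scalar_prod (infix "\<bullet>" 70)

section \<open>Spectral theorem for real symmetric matrices\<close>

text \<open>A complex eigenvector a + i b exists because the spectrum is nonempty. Symmetry equates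
  the inner products of A a with b and of a with A b, which gives Im e (|a|^2 + |b|^2) = 0. So e is
  real, and whichever of a and b is nonzero is a real eigenvector.\<close>

lemma real_symmetric_eigenvector_exists:
  fixes A :: "real mat"
  assumes A: "A \<in> carrier_mat n n" and n: "n \<noteq> 0" and sym: "transpose_mat A = A"
  obtains e v where "v \<in> carrier_vec n" "scalar_prod v v = 1" "A *\<^sub>v v = e \<cdot>\<^sub>v v"
proof -
  define B where "B = map_mat complex_of_real A"
  have B: "B \<in> carrier_mat n n" using A by (simp add: B_def)
  obtain e where "eigenvalue B e"
    using spectrum_non_empty[OF B] n unfolding spectrum_def by auto
  then obtain w where w: "w \<in> carrier_vec n" "w \<noteq> 0\<^sub>v n" "B *\<^sub>v w = e \<cdot>\<^sub>v w"
    using B by (auto simp: eigenvalue_def eigenvector_def)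
  define a b where "a = map_vec Re w" and "b = map_vec Im w"
  have ab: "a \<in> carrier_vec n" "b \<in> carrier_vec n" using w by (auto simp: a_def b_def)
  have Aw: "(\<Sum>j<n. A $$ (i,j) * (vec_index w j)) = e * vec_index w i" if i: "i < n" for i
  proof -
    have "vec_index (B *\<^sub>v w) i = (\<Sum>j<n. A $$ (i,j) * (vec_index w j))"
      using i w(1) A by (simp add: B_def scalar_prod_def lessThan_atLeast0)
    thus ?thesis using w i by simp
  qed
  have Aa: "A *\<^sub>v a = Re e \<cdot>\<^sub>v a + (- Im e) \<cdot>\<^sub>v b"
  proof (rule eq_vecI)
    fix i assume "i < dim_vec (Re e \<cdot>\<^sub>v a + (- Im e) \<cdot>\<^sub>v b)"
    hence i: "i < n" using ab by simp
    show "vec_index (A *\<^sub>v a) i = vec_index (Re e \<cdot>\<^sub>v a + (- Im e) \<cdot>\<^sub>v b) i"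
      using arg_cong[OF Aw[OF i], of Re] i w(1) A
      by (simp add: a_def b_def scalar_prod_def lessThan_atLeast0)
  qed (use A ab in auto)
  have Ab: "A *\<^sub>v b = Im e \<cdot>\<^sub>v a + Re e \<cdot>\<^sub>v b"
  proof (rule eq_vecI)
    fix i assume "i < dim_vec (Im e \<cdot>\<^sub>v a + Re e \<cdot>\<^sub>v b)"
    hence i: "i < n" using ab by simp
    show "vec_index (A *\<^sub>v b) i = vec_index (Im e \<cdot>\<^sub>v a + Re e \<cdot>\<^sub>v b) i"
      using arg_cong[OF Aw[OF i], of Im] i w(1) A
      by (simp add: a_def b_def scalar_prod_def lessThan_atLeast0)
  qed (use A ab in auto)
  have "scalar_prod (A *\<^sub>v a) b = scalar_prod a (A *\<^sub>v b)"
    using A ab sym transpose_vec_mult_scalar[OF A ab(2,1)] comm_scalar_prod[of _ n]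
    by (metis mult_mat_vec_carrier)
  hence "Im e * (scalar_prod a a + scalar_prod b b) = 0"
    using ab unfolding Aa Ab
    by (simp add: add_scalar_prod_distrib[of _ n] scalar_prod_add_distrib[of _ n]
        comm_scalar_prod[of b n a] algebra_simps)
  moreover have pos: "scalar_prod x x > 0" if "x \<in> carrier_vec n" "x \<noteq> 0\<^sub>v n" for x :: "real vec"
    using conjugate_square_greater_0_vec[OF that(1)] that(2) by simp
  moreover have nn: "scalar_prod x x \<ge> 0" if "x \<in> carrier_vec n" for x :: "real vec"
    using conjugate_square_ge_0_vec[of x] by simp
  moreover have ne: "a \<noteq> 0\<^sub>v n \<or> b \<noteq> 0\<^sub>v n"
  proof (rule ccontr)
    assume "\<not> ?thesis"
    hence z: "a = 0\<^sub>v n" "b = 0\<^sub>v n" by auto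
    have "w = 0\<^sub>v n"
    proof (rule eq_vecI)
      fix i assume "i < dim_vec (0\<^sub>v n :: complex vec)"
      hence i: "i < n" by simp
      show "vec_index w i = vec_index (0\<^sub>v n) i"
        using arg_cong[OF z(1), of "\<lambda>v. vec_index v i"] arg_cong[OF z(2), of "\<lambda>v. vec_index v i"] i w(1)
        by (simp add: a_def b_def complex_eq_iff)
    qed (use w in auto)
    thus False using w by simp
  qed
  ultimately have im: "Im e = 0"
    using ab by (metis add_pos_nonneg add_nonneg_pos less_irrefl mult_eq_0_iff)
  obtain x where x: "x \<in> carrier_vec n" "x \<noteq> 0\<^sub>v n" "A *\<^sub>v x = Re e \<cdot>\<^sub>v x"
  proof (cases "a = 0\<^sub>v n")
    case False
    moreover have "Re e \<cdot>\<^sub>v a + (- Im e) \<cdot>\<^sub>v b = Re e \<cdot>\<^sub>v a" using ab im by (intro eq_vecI) auto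
    ultimately show ?thesis using that[of a] Aa ab by auto
  next
    case True
    moreover have "Im e \<cdot>\<^sub>v a + Re e \<cdot>\<^sub>v b = Re e \<cdot>\<^sub>v b" using ab im by (intro eq_vecI) auto
    ultimately show ?thesis using that[of b] Ab ab ne by auto
  qed
  define s where "s = sqrt (scalar_prod x x)"
  have s: "s > 0" "s * s = scalar_prod x x" using pos[OF x(1,2)] by (auto simp: s_def)
  show ?thesis
  proof (rule that[of "(1/s) \<cdot>\<^sub>v x" "Re e"])
    show "scalar_prod ((1 / s) \<cdot>\<^sub>v x) ((1 / s) \<cdot>\<^sub>v x) = 1"
      using x s by simp (simp add: s(2)[symmetric])
    show "A *\<^sub>v ((1 / s) \<cdot>\<^sub>v x) = Re e \<cdot>\<^sub>v ((1 / s) \<cdot>\<^sub>v x)"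
      using x A by (simp add: mult_mat_vec smult_smult_assoc mult.commute)
  qed (use x in auto)
qed

text \<open>If \<open>v\<close> is the first basis vector already, \<open>2 / 0 = 0\<close> makes the reflection the identity.\<close>

lemma householder:
  fixes v :: "real vec"
  assumes v: "v \<in> carrier_vec n" "scalar_prod v v = 1" and n: "n > 0"
  obtains H where "H \<in> carrier_mat n n" "transpose_mat H = H" "H * H = 1\<^sub>m n"
    "H *\<^sub>v v = unit_vec n 0" "H *\<^sub>v unit_vec n 0 = v"
proof -
  define w where "w = (\<lambda>i. vec_index v i - (if i = 0 then 1 else 0))"
  define S where "S = (\<Sum>i<n. w i * w i)"
  define c where "c = 2 / S"
  define H where "H = mat n n (\<lambda>(i, j). (if i = j then 1 else 0) - c * w i * w j)"
  have H: "H \<in> carrier_mat n n" by (simp add: H_def)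
  have v1: "(\<Sum>i<n. vec_index v i * vec_index v i) = 1"
    using v by (simp add: scalar_prod_def lessThan_atLeast0)
  have S: "S = 2 - 2 * vec_index v 0"
  proof -
    have "S = (\<Sum>i<n. vec_index v i * vec_index v i - (if i = 0 then 2 * vec_index v 0 - 1 else 0))"
      unfolding S_def w_def by (rule sum.cong) (auto simp: algebra_simps)
    thus ?thesis using n by (simp add: sum_subtractf v1)
  qed
  have wv: "(\<Sum>i<n. w i * vec_index v i) = 1 - vec_index v 0"
  proof -
    have "(\<Sum>i<n. w i * vec_index v i) =
        (\<Sum>i<n. vec_index v i * vec_index v i - (if i = 0 then vec_index v 0 else 0))"
      unfolding w_def by (rule sum.cong) (auto simp: algebra_simps)
    thus ?thesis using n by (simp add: sum_subtractf v1)
  qed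
  have w0: "w i = 0" if "S = 0" "i < n" for i
    using that unfolding S_def by (simp add: sum_nonneg_eq_0_iff)
  have HH: "H * H = 1\<^sub>m n"
  proof (rule eq_matI)
    fix i j assume "i < dim_row (1\<^sub>m n :: real mat)" "j < dim_col (1\<^sub>m n :: real mat)"
    hence ij: "i < n" "j < n" by auto
    have "(H * H) $$ (i, j) = (\<Sum>k<n. ((if i = k then 1 else 0) - c * w i * w k) *
                                  ((if k = j then 1 else 0) - c * w k * w j))"
      using ij by (simp add: H_def times_mat_def scalar_prod_def lessThan_atLeast0)
    also have "\<dots> = (\<Sum>k<n. (if k = i then (if i = j then 1 else 0) - c * w i * w j else 0)
        - (if k = j then c * w i * w j else 0) + c * c * w i * w j * (w k * w k))"
      by (rule sum.cong) (auto simp: algebra_simps)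
    also have "\<dots> = (if i = j then 1 else 0) - 2 * c * w i * w j + c * c * w i * w j * S"
      using ij by (simp add: sum.distrib sum_subtractf S_def sum_distrib_left)
    also have "\<dots> = (if i = j then 1 else 0)"
      by (cases "S = 0") (auto simp: c_def)
    finally show "(H * H) $$ (i, j) = 1\<^sub>m n $$ (i, j)" using ij by simp
  qed (auto simp: H_def)
  have Hv: "H *\<^sub>v v = unit_vec n 0"
  proof (rule eq_vecI)
    fix i assume "i < dim_vec (unit_vec n 0 :: real vec)"
    hence i: "i < n" by simp
    have "vec_index (H *\<^sub>v v) i = (\<Sum>k<n. ((if i = k then 1 else 0) - c * w i * w k) * vec_index v k)"
      using i v by (simp add: H_def mult_mat_vec_def scalar_prod_def lessThan_atLeast0)
    also have "\<dots> = (\<Sum>k<n. (if k = i then vec_index v i else 0) - c * w i * (w k * vec_index v k))"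
      by (rule sum.cong) (auto simp: algebra_simps)
    also have "\<dots> = vec_index v i - c * w i * (1 - vec_index v 0)"
      using i by (simp add: sum_subtractf wv flip: sum_distrib_left)
    also have "\<dots> = vec_index v i - w i"
    proof (cases "S = 0")
      case False
      have "vec_index v 0 = 1 - S / 2" using S by (simp add: field_simps)
      thus ?thesis using False by (simp add: c_def)
    qed (use w0[OF _ i] in simp)
    finally show "vec_index (H *\<^sub>v v) i = vec_index (unit_vec n 0) i"
      using i n by (simp add: w_def unit_vec_def)
  qed (auto simp: H_def)
  show ?thesis
  proof (rule that[OF H _ HH Hv])
    show "transpose_mat H = H" by (rule eq_matI) (auto simp: H_def)
    show "H *\<^sub>v unit_vec n 0 = v"
      unfolding Hv[symmetric] using assoc_mult_mat_vec[OF H H v(1)] HH v by simp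
  qed
qed

text \<open>Deflation: the reflection \<open>H\<close> carries a unit eigenvector to the first basis
  vector, so \<open>H * A * H\<close> is block diagonal with the eigenvalue in the corner, and the
  induction hypothesis applies to the remaining block.\<close>

theorem real_symmetric_diagonalization:
  fixes A :: "real mat"
  assumes "A \<in> carrier_mat n n" "transpose_mat A = A"
  obtains Q D where "Q \<in> carrier_mat n n" "D \<in> carrier_mat n n" "diagonal_mat D"
    "transpose_mat Q * Q = 1\<^sub>m n" "Q * transpose_mat Q = 1\<^sub>m n" "A = Q * D * transpose_mat Q"
  using assms
proof (induction n arbitrary: A thesis)
  case 0
  show ?case
    by (rule 0(1)[of "1\<^sub>m 0" "1\<^sub>m 0"]) (use 0 in \<open>auto simp: diagonal_mat_def\<close>)
next
  case (Suc n)
  note A = Suc.prems(2) and sym = Suc.prems(3)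
  obtain e v where v: "v \<in> carrier_vec (Suc n)" "scalar_prod v v = 1" "A *\<^sub>v v = e \<cdot>\<^sub>v v"
    by (rule real_symmetric_eigenvector_exists[OF A Suc_not_Zero sym])
  obtain H where H: "H \<in> carrier_mat (Suc n) (Suc n)" "transpose_mat H = H" "H * H = 1\<^sub>m (Suc n)"
    "H *\<^sub>v v = unit_vec (Suc n) 0" "H *\<^sub>v unit_vec (Suc n) 0 = v"
    using householder[OF v(1,2)] by auto
  define B where "B = H * A * H"
  have B: "B \<in> carrier_mat (Suc n) (Suc n)" using H A by (auto simp: B_def)
  have symB: "transpose_mat B = B"
    unfolding B_def using H A sym by (simp add: transpose_mult[of _ "Suc n" "Suc n" _ "Suc n"] assoc_mult_mat[of _ "Suc n" "Suc n" _ "Suc n" _ "Suc n"])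
  have "B *\<^sub>v unit_vec (Suc n) 0 = e \<cdot>\<^sub>v unit_vec (Suc n) 0"
  proof -
    have "B *\<^sub>v unit_vec (Suc n) 0 = H *\<^sub>v (A *\<^sub>v (H *\<^sub>v unit_vec (Suc n) 0))"
      unfolding B_def using H(1) A
      by (simp add: assoc_mult_mat_vec[of _ "Suc n" "Suc n" _ "Suc n"])
    also have "\<dots> = e \<cdot>\<^sub>v unit_vec (Suc n) 0"
      using H v by (simp add: mult_mat_vec[OF H(1) v(1)])
    finally show ?thesis .
  qed
  hence col0: "B $$ (i, 0) = (if i = 0 then e else 0)" if "i < Suc n" for i
  proof -
    have "vec_index (B *\<^sub>v unit_vec (Suc n) 0) i = B $$ (i, 0)"
      using that B by (simp add: scalar_prod_right_unit)
    thus ?thesis using \<open>B *\<^sub>v unit_vec (Suc n) 0 = _\<close> that by (auto split: if_splits)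
  qed
  have row0: "B $$ (0, i) = (if i = 0 then e else 0)" if "i < Suc n" for i
    using col0[OF that] symB B that by (metis index_transpose_mat(1) carrier_matD zero_less_Suc)
  define B' where "B' = mat n n (\<lambda>(i, j). B $$ (Suc i, Suc j))"
  have B': "B' \<in> carrier_mat n n" by (simp add: B'_def)
  have symB': "transpose_mat B' = B'"
  proof (rule eq_matI)
    fix i j assume "i < dim_row B'" "j < dim_col B'"
    hence ij: "Suc i < Suc n" "Suc j < Suc n" by (auto simp: B'_def)
    show "transpose_mat B' $$ (i, j) = B' $$ (i, j)"
      using arg_cong[OF symB, of "\<lambda>M. M $$ (Suc i, Suc j)"] ij B by (simp add: B'_def)
  qed (auto simp: B'_def)
  obtain Q' D' where Q': "Q' \<in> carrier_mat n n" "D' \<in> carrier_mat n n" "diagonal_mat D'"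
    "transpose_mat Q' * Q' = 1\<^sub>m n" "Q' * transpose_mat Q' = 1\<^sub>m n" "B' = Q' * D' * transpose_mat Q'"
    using Suc.IH[OF _ B' symB'] by metis
  define E where "E = (mat 1 1 (\<lambda>_. e))"
  have E: "E \<in> carrier_mat 1 1" by (simp add: E_def)
  have Bb: "B = four_block_mat E (0\<^sub>m 1 n) (0\<^sub>m n 1) B'"
  proof (rule eq_matI)
    fix i j
    assume "i < dim_row (four_block_mat E (0\<^sub>m 1 n) (0\<^sub>m n 1) B')"
      "j < dim_col (four_block_mat E (0\<^sub>m 1 n) (0\<^sub>m n 1) B')"
    hence "i < Suc n" "j < Suc n" by (auto simp: E_def B'_def)
    thus "B $$ (i, j) = four_block_mat E (0\<^sub>m 1 n) (0\<^sub>m n 1) B' $$ (i, j)"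
      using col0[of i] row0[of j] by (cases i; cases j) (auto simp: E_def B'_def)
  qed (use B in \<open>auto simp: E_def B'_def\<close>)
  define Q1 where "Q1 = four_block_mat (1\<^sub>m 1) (0\<^sub>m 1 n) (0\<^sub>m n 1) Q'"
  define D where "D = four_block_mat E (0\<^sub>m 1 n) (0\<^sub>m n 1) D'"
  have Q1: "Q1 \<in> carrier_mat (Suc n) (Suc n)" and D: "D \<in> carrier_mat (Suc n) (Suc n)"
    using Q' E by (auto simp: Q1_def D_def)
  have Q1t: "transpose_mat Q1 = four_block_mat (1\<^sub>m 1) (0\<^sub>m 1 n) (0\<^sub>m n 1) (transpose_mat Q')"
    unfolding Q1_def by (subst transpose_four_block_mat) (use Q' in auto)
  note mfb = mult_four_block_mat[where ?n1.0 = 1 and ?n2.0 = n and ?nr1.0 = 1 and ?nr2.0 = n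
      and ?nc1.0 = 1 and ?nc2.0 = n]
  have one: "four_block_mat (1\<^sub>m 1) (0\<^sub>m 1 n) (0\<^sub>m n 1) (1\<^sub>m n) = (1\<^sub>m (Suc n) :: real mat)"
    by (rule eq_matI) auto
  have Q1o: "transpose_mat Q1 * Q1 = 1\<^sub>m (Suc n)" "Q1 * transpose_mat Q1 = 1\<^sub>m (Suc n)"
    unfolding Q1t unfolding Q1_def using Q' by (auto simp: mfb one)
  have BQ: "B = Q1 * D * transpose_mat Q1"
    unfolding Q1t Bb unfolding Q1_def D_def using Q' E by (simp add: mfb)
  have diag: "diagonal_mat D"
    using Q'(2,3) E unfolding diagonal_mat_def D_def by auto
  note assoc = assoc_mult_mat[of _ "Suc n" "Suc n" _ "Suc n" _ "Suc n"]
  define Q where "Q = H * Q1"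
  have Q: "Q \<in> carrier_mat (Suc n) (Suc n)" using H Q1 by (auto simp: Q_def)
  have Qt: "transpose_mat Q = transpose_mat Q1 * H"
    unfolding Q_def using H Q1 by (simp add: transpose_mult[of _ "Suc n" "Suc n" _ "Suc n"])
  have T: "transpose_mat Q1 \<in> carrier_mat (Suc n) (Suc n)" using Q1 by simp
  have canc: "H * (H * Y) = Y" if "Y \<in> carrier_mat (Suc n) (Suc n)" for Y
    using assoc[OF H(1) H(1) that] H(3) that by simp
  have canc1: "transpose_mat Q1 * (Q1 * Y) = Y" "Q1 * (transpose_mat Q1 * Y) = Y"
    if "Y \<in> carrier_mat (Suc n) (Suc n)" for Y
    using assoc[OF T Q1 that] assoc[OF Q1 T that] Q1o that by simp_all
  show ?case
  proof (rule Suc.prems(1)[OF Q D diag])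
    show "transpose_mat Q * Q = 1\<^sub>m (Suc n)" "Q * transpose_mat Q = 1\<^sub>m (Suc n)"
      unfolding Qt unfolding Q_def using H Q1 T Q1o by (simp_all add: assoc canc canc1)
    have "Q * D * transpose_mat Q = H * B * H"
      unfolding Qt unfolding Q_def BQ using H Q1 T D by (simp add: assoc)
    also have "\<dots> = A" unfolding B_def using H A by (simp add: assoc canc)
    finally show "A = Q * D * transpose_mat Q" by simp
  qed
qed

section \<open>From the diagonalization to lower bounds on the leading eigenvalues\<close>

text \<open>\<open>eigenvalues_desc\<close> refers to roots of the characteristic polynomial.
  Similarity to the triangular matrix \<open>D\<close> lets these roots, with multiplicity, be read
  off the diagonal.\<close>

lemma mset_eigenvalues_desc_diagonalization:
  fixes B Q D :: "real mat"
  assumes "Q \<in> carrier_mat n n" "D \<in> carrier_mat n n" "diagonal_mat D"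
    "transpose_mat Q * Q = 1\<^sub>m n" "Q * transpose_mat Q = 1\<^sub>m n" "B = Q * D * transpose_mat Q"
  shows "mset (eigenvalues_desc B) = mset (diag_mat D)"
proof -
  have "similar_mat B D"
    unfolding similar_mat_def similar_mat_wit_def Let_def
    using assms by (intro exI[of _ Q] exI[of _ "transpose_mat Q"]) auto
  hence "char_poly B = char_poly D" by (rule char_poly_similar)
  also have "upper_triangular D"
    using assms(2,3) unfolding upper_triangular_def diagonal_mat_def by auto
  hence "char_poly D = (\<Prod>a\<leftarrow>diag_mat D. [:- a, 1:])"
    by (rule char_poly_upper_triangular[OF assms(2)])
  finally have c: "char_poly B = (\<Prod>a\<leftarrow>diag_mat D. [:- a, 1:])" .
  have "proots (\<Prod>a\<leftarrow>xs. [:- a, 1:]) = mset xs" for xs :: "real list"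
  proof (induction xs)
    case (Cons x xs)
    have "(\<Prod>a\<leftarrow>xs. [:- a, 1:]) \<noteq> 0" by (auto simp: prod_list_zero_iff)
    thus ?case using Cons by (simp add: proots_mult del: mult_pCons_left)
  qed simp
  thus ?thesis unfolding eigenvalues_desc_def c by simp
qed

text \<open>One half of the min-max principle. If fewer than d eigenvalues were at least
  \<open>b\<close>, some \<alpha> \<noteq> 0 would make the vector Z \<alpha> orthogonal to all
  their eigenvectors, and there the quadratic form is strictly below \<open>b\<close> times the
  squared norm. By \<open>pos\<close> this vector is nonzero.\<close>

lemma count_large_eigenvalues:
  fixes B :: "real mat" and Z :: "nat \<Rightarrow> 'a::euclidean_space"
  assumes B: "B \<in> carrier_mat n n" "transpose_mat B = B"
    and pos: "\<And>\<alpha>. \<alpha> \<noteq> 0 \<Longrightarrow> (\<Sum>h<n. (Z h \<bullet> \<alpha>)\<^sup>2) > 0"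
    and ge: "\<And>\<alpha>. \<alpha> \<noteq> 0 \<Longrightarrow> b * (\<Sum>h<n. (Z h \<bullet> \<alpha>)\<^sup>2)
      \<le> (\<Sum>h<n. (Z h \<bullet> \<alpha>) * (\<Sum>h'<n. B $$ (h, h') * (Z h' \<bullet> \<alpha>)))"
  shows "DIM('a) \<le> length (filter (\<lambda>e. b \<le> e) (eigenvalues_desc B))"
proof -
  obtain Q D where QD: "Q \<in> carrier_mat n n" "D \<in> carrier_mat n n" "diagonal_mat D"
    "transpose_mat Q * Q = 1\<^sub>m n" "Q * transpose_mat Q = 1\<^sub>m n" "B = Q * D * transpose_mat Q"
    using real_symmetric_diagonalization[OF B] by metis
  define I where "I = {i. i < n \<and> b \<le> D $$ (i, i)}"
  have "length (filter (\<lambda>e. b \<le> e) (eigenvalues_desc B))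
      = size (filter_mset (\<lambda>e. b \<le> e) (mset (eigenvalues_desc B)))"
    by (simp flip: mset_filter)
  also have "\<dots> = length (filter (\<lambda>e. b \<le> e) (diag_mat D))"
    unfolding mset_eigenvalues_desc_diagonalization[OF QD] by (simp flip: mset_filter)
  also have "\<dots> = card I"
    unfolding length_filter_conv_card I_def using QD(2)
    by (intro arg_cong[of _ _ card]) (auto simp: diag_mat_def)
  finally have len: "length (filter (\<lambda>e. b \<le> e) (eigenvalues_desc B)) = card I" .
  show ?thesis
  proof (rule ccontr)
    assume "\<not> ?thesis"
    hence cI: "card I < DIM('a)" using len by simp
    \<comment> \<open>\<open>\<zeta> i\<close> is the transpose of Z applied to the i-th
      eigenvector, so \<open>\<zeta> i \<bullet> \<alpha>\<close> is the i-th coordinate of Z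
      \<alpha> in the eigenbasis. Fewer than d such vectors leave a common orthogonal
      direction.\<close>
    define \<zeta> where "\<zeta> = (\<lambda>i. \<Sum>h<n. Q $$ (h, i) *\<^sub>R Z h)"
    have "finite I" by (simp add: I_def)
    hence "dim (\<zeta> ` I) < DIM('a)"
      using cI dim_le_card'[of "\<zeta> ` I"] card_image_le[of I \<zeta>] by simp
    then obtain \<alpha> where \<alpha>: "\<alpha> \<noteq> 0" "\<And>y. y \<in> span (\<zeta> ` I) \<Longrightarrow> Linear_Algebra.orthogonal \<alpha> y"
      using orthogonal_to_subspace_exists[of "\<zeta> ` I"] by metis
    define x where "x = Matrix.vec n (\<lambda>h. Z h \<bullet> \<alpha>)"
    define y where "y = transpose_mat Q *\<^sub>v x"
    have xy: "x \<in> carrier_vec n" "y \<in> carrier_vec n" using QD by (auto simp: x_def y_def)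
    have yi: "vec_index y i = \<zeta> i \<bullet> \<alpha>" if "i < n" for i
      using QD(1) that
      by (simp add: y_def x_def \<zeta>_def scalar_prod_def lessThan_atLeast0 inner_sum_left)
    have y0: "vec_index y i = 0" if "i \<in> I" for i
      using that \<alpha>(2)[of "\<zeta> i"] yi[of i]
      by (simp add: I_def Linear_Algebra.orthogonal_def inner_commute span_base)
    have "scalar_prod y y = scalar_prod x (Q *\<^sub>v y)"
      using transpose_vec_mult_scalar[OF QD(1) xy(2,1)] by (simp add: y_def)
    also have "Q *\<^sub>v y = x"
      using QD(1,5) xy by (simp add: y_def flip: assoc_mult_mat_vec[of _ n n _ n])
    finally have "scalar_prod y y = scalar_prod x x" .
    hence yy: "(\<Sum>i<n. (vec_index y i)\<^sup>2) = (\<Sum>h<n. (Z h \<bullet> \<alpha>)\<^sup>2)"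
      using xy by (simp add: scalar_prod_def lessThan_atLeast0 power2_eq_square x_def)
    have "(\<Sum>h<n. (Z h \<bullet> \<alpha>) * (\<Sum>h'<n. B $$ (h, h') * (Z h' \<bullet> \<alpha>))) = scalar_prod x (B *\<^sub>v x)"
      using B(1) by (simp add: x_def scalar_prod_def lessThan_atLeast0)
    also have "\<dots> = scalar_prod x (Q *\<^sub>v (D *\<^sub>v y))"
      unfolding QD(6) y_def using QD(1,2) xy by (simp add: assoc_mult_mat_vec[of _ n n _ n])
    also have "\<dots> = scalar_prod y (D *\<^sub>v y)"
      using transpose_vec_mult_scalar[OF QD(1) _ xy(1), of "D *\<^sub>v y"] QD(2) xy by (simp add: y_def)
    also have "\<dots> = (\<Sum>i<n. D $$ (i, i) * (vec_index y i)\<^sup>2)"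
    proof -
      have "vec_index (D *\<^sub>v y) i = D $$ (i, i) * vec_index y i" if "i < n" for i
      proof -
        have "vec_index (D *\<^sub>v y) i = (\<Sum>j<n. D $$ (i, j) * vec_index y j)"
          using that QD(2) xy by (simp add: scalar_prod_def lessThan_atLeast0)
        also have "\<dots> = (\<Sum>j<n. if j = i then D $$ (i, i) * vec_index y i else 0)"
          using that QD(2,3) unfolding diagonal_mat_def by (intro sum.cong) auto
        finally show ?thesis using that by simp
      qed
      thus ?thesis using xy QD(2)
        by (auto simp: scalar_prod_def lessThan_atLeast0 power2_eq_square intro!: sum.cong)
    qed
    also have "\<dots> < (\<Sum>i<n. b * (vec_index y i)\<^sup>2)"
    proof -
      have "\<exists>i<n. vec_index y i \<noteq> 0"
      proof (rule ccontr)
        assume "\<not> ?thesis"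
        hence "(\<Sum>i<n. (vec_index y i)\<^sup>2) = 0" by (intro sum.neutral) auto
        thus False using pos[OF \<alpha>(1)] yy by simp
      qed
      then obtain i where i: "i < n" "vec_index y i \<noteq> 0" by auto
      show ?thesis
      proof (rule sum_strict_mono_ex1)
        show "\<forall>i\<in>{..<n}. D $$ (i, i) * (vec_index y i)\<^sup>2 \<le> b * (vec_index y i)\<^sup>2"
        proof
          fix j assume j: "j \<in> {..<n}"
          show "D $$ (j, j) * (vec_index y j)\<^sup>2 \<le> b * (vec_index y j)\<^sup>2"
            using y0[of j] j by (cases "j \<in> I") (auto simp: I_def intro!: mult_right_mono)
        qed
        show "\<exists>i\<in>{..<n}. D $$ (i, i) * (vec_index y i)\<^sup>2 < b * (vec_index y i)\<^sup>2"
        proof (intro bexI[of _ i])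
          have "D $$ (i, i) < b" using i y0[of i] unfolding I_def by force
          thus "D $$ (i, i) * (vec_index y i)\<^sup>2 < b * (vec_index y i)\<^sup>2" using i by simp
        qed (use i in simp)
      qed simp
    qed
    also have "\<dots> = b * (\<Sum>h<n. (Z h \<bullet> \<alpha>)\<^sup>2)" by (simp add: yy flip: sum_distrib_left)
    finally show False using ge[OF \<alpha>(1)] by simp
  qed
qed

text \<open>In a non-increasing list the entries that are at least \<open>b\<close> form an initial
  segment, and the position \<open>card {..<k}\<close> lies inside it because it is less than
  \<open>CARD('d)\<close>.\<close>

lemma top_eigenvalue_ge:
  assumes "CARD('d::{finite,linorder}) \<le> length (filter (\<lambda>e. b \<le> e) (eigenvalues_desc B))"
  shows "b \<le> top_eigenvalue B (k :: 'd)"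
proof (rule ccontr)
  define l where "l = eigenvalues_desc B"
  define j where "j = card {..<k}"
  assume "\<not> ?thesis"
  hence lt: "l ! j < b" by (simp add: top_eigenvalue_def l_def j_def)
  have "j < card (UNIV :: 'd set)"
    unfolding j_def by (intro psubset_card_mono) auto
  have s: "sorted (rev l)" by (simp add: l_def eigenvalues_desc_def)
  have "{i. i < length l \<and> b \<le> l ! i} \<subseteq> {..<j}"
  proof
    fix i assume i: "i \<in> {i. i < length l \<and> b \<le> l ! i}"
    show "i \<in> {..<j}"
    proof (rule ccontr)
      assume "i \<notin> {..<j}"
      hence "l ! i \<le> l ! j" using i sorted_rev_nth_mono[OF s, of j i] by auto
      thus False using lt i by simp
    qed
  qed
  hence "length (filter (\<lambda>e. b \<le> e) l) \<le> card {..<j}"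
    unfolding length_filter_conv_card by (intro card_mono) auto
  thus False using assms \<open>j < card UNIV\<close> by (simp add: l_def)
qed

section \<open>Perturbation of the positive eigenspace\<close>

text \<open>One Gram-Schmidt step per vector. This turns the almost orthogonal M into an exact
  rotation; \<open>K\<close> and \<open>\<delta>0\<close> precede the vectors, because the vectors
  change with the sample.\<close>

lemma orthonormal_close:
  fixes I :: "'i set"
  assumes "finite I"
  shows "\<exists>K \<delta>0. K \<ge> (0::real) \<and> \<delta>0 > 0 \<and> (\<forall>\<delta>\<le>\<delta>0. \<forall>v :: 'i \<Rightarrow> 'a::real_inner. \<delta> \<ge> 0 \<longrightarrow>
     (\<forall>i\<in>I. \<forall>j\<in>I. \<bar>inner (v i) (v j) - (if i = j then 1 else 0)\<bar> \<le> \<delta>) \<longrightarrow>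
     (\<exists>w. (\<forall>i\<in>I. \<forall>j\<in>I. inner (w i) (w j) = (if i = j then 1 else 0)) \<and> (\<forall>i\<in>I. norm (v i - w i) \<le> K * \<delta>)))"
  using assms
proof (induction I)
  case empty
  show ?case by (rule exI[of _ 0], rule exI[of _ 1]) auto
next
  case (insert a I)
  obtain K \<delta>0 where "K \<ge> 0 \<and> \<delta>0 > 0 \<and> (\<forall>\<delta>\<le>\<delta>0. \<forall>v :: 'i \<Rightarrow> 'a. \<delta> \<ge> 0 \<longrightarrow>
     (\<forall>i\<in>I. \<forall>j\<in>I. \<bar>inner (v i) (v j) - (if i = j then 1 else 0)\<bar> \<le> \<delta>) \<longrightarrow>
     (\<exists>w. (\<forall>i\<in>I. \<forall>j\<in>I. inner (w i) (w j) = (if i = j then 1 else 0)) \<and> (\<forall>i\<in>I. norm (v i - w i) \<le> K * \<delta>)))"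
    using insert.IH by (elim exE) (erule that)
  note K = conjunct1[OF this] conjunct1[OF conjunct2[OF this]] and IH = conjunct2[OF conjunct2[OF this]]
  \<comment> \<open>\<open>q * \<delta>\<close> will bound the projection of the new vector onto the
    previous ones: \<open>card I\<close> coefficients, each at most
    \<open>(1 + 2 * K) * \<delta>\<close>, where 2 bounds the norm of the new vector.\<close>
  define q where "q = real (card I) * (1 + 2 * K)"
  have q: "q \<ge> 0" using K by (simp add: q_def)
  \<comment> \<open>With \<open>\<delta> * (1 + q) \<le> 1 / 2\<close> the orthogonalized vector
    keeps norm at least 1/2 and can be normalized.\<close>
  define \<delta>1 where "\<delta>1 = min \<delta>0 (1 / (2 * (1 + q)))"
  have d1: "\<delta>1 > 0" using K q by (simp add: \<delta>1_def)
  show ?case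
  proof (rule exI[of _ "K + 2 * q + 1"], rule exI[of _ \<delta>1], intro conjI allI impI)
    fix \<delta> and v :: "'i \<Rightarrow> 'a"
    assume \<delta>: "\<delta> \<le> \<delta>1" "0 \<le> \<delta>"
      and v: "\<forall>i\<in>insert a I. \<forall>j\<in>insert a I. \<bar>inner (v i) (v j) - (if i = j then 1 else 0)\<bar> \<le> \<delta>"
    have \<delta>': "\<delta> \<le> \<delta>0" "\<delta> * (1 + q) \<le> 1 / 2"
      using \<delta> q by (auto simp: \<delta>1_def field_simps)
    have "\<forall>i\<in>I. \<forall>j\<in>I. \<bar>inner (v i) (v j) - (if i = j then 1 else 0)\<bar> \<le> \<delta>" using v by blast
    from IH[rule_format, OF \<delta>'(1) \<delta>(2) this[rule_format]]
    obtain w where w: "\<And>i j. \<lbrakk>i \<in> I; j \<in> I\<rbrakk> \<Longrightarrow> inner (w i) (w j) = (if i = j then 1 else 0)"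
      "\<And>i. i \<in> I \<Longrightarrow> norm (v i - w i) \<le> K * \<delta>"
      by blast
    have nva: "\<bar>(norm (v a))\<^sup>2 - 1\<bar> \<le> \<delta>"
      using v by (auto simp: power2_norm_eq_inner)
    have "\<delta> * 1 \<le> \<delta> * (1 + q)" using \<delta> q by (intro mult_left_mono) auto
    hence "\<delta> \<le> 1/2" using \<delta>' by linarith
    have na1: "\<bar>norm (v a) - 1\<bar> \<le> \<delta>"
    proof -
      have "\<bar>(norm (v a))\<^sup>2 - 1\<bar> = \<bar>norm (v a) - 1\<bar> * (norm (v a) + 1)"
      proof -
        have "(norm (v a))\<^sup>2 - 1 = (norm (v a) - 1) * (norm (v a) + 1)"
          by (simp add: power2_eq_square algebra_simps)
        thus ?thesis by (simp only: abs_mult) simp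
      qed
      also have "\<dots> \<ge> \<bar>norm (v a) - 1\<bar> * 1"
        by (intro mult_left_mono) auto
      finally show ?thesis using nva by simp
    qed
    have na: "norm (v a) \<le> 2" using na1 \<open>\<delta> \<le> 1/2\<close> by linarith
    define p where "p = (\<Sum>j\<in>I. (inner (v a) (w j)) *\<^sub>R w j)"
    have vw: "\<bar>inner (v a) (w j)\<bar> \<le> (1 + 2 * K) * \<delta>" if "j \<in> I" for j
    proof -
      have "inner (v a) (w j) = inner (v a) (v j) - inner (v a) (v j - w j)" by (simp add: inner_diff_right)
      moreover have "\<bar>inner (v a) (v j)\<bar> \<le> \<delta>"
      proof -
        have "a \<noteq> j" using that insert.hyps by auto
        thus ?thesis using v[rule_format, of a j] that by simp
      qed
      moreover have "\<bar>inner (v a) (v j - w j)\<bar> \<le> 2 * (K * \<delta>)"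
        by (rule order.trans[OF Cauchy_Schwarz_ineq2], rule mult_mono) (use na w(2)[OF that] K \<delta> in auto)
      ultimately show ?thesis by (simp add: algebra_simps)
    qed
    have np: "norm p \<le> q * \<delta>"
    proof -
      have "norm p \<le> (\<Sum>j\<in>I. norm (inner (v a) (w j) *\<^sub>R w j))" unfolding p_def by (rule norm_sum)
      also have "\<dots> \<le> (\<Sum>j\<in>I. (1 + 2 * K) * \<delta>)"
        using vw w(1) by (intro sum_mono) (simp add: norm_eq_sqrt_inner)
      finally show ?thesis by (simp add: q_def)
    qed
    define u where "u = v a - p"
    have uw: "inner u (w j) = 0" if "j \<in> I" for j
    proof -
      have "inner p (w j) = (\<Sum>i\<in>I. (inner (v a) (w i)) * (if i = j then 1 else 0))"
        unfolding p_def inner_sum_left using w(1) that by (intro sum.cong) auto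
      also have "\<dots> = inner (v a) (w j)" using that insert.hyps by (simp add: if_distrib cong: if_cong)
      finally show ?thesis by (simp add: u_def inner_diff_left)
    qed
    have nu: "\<bar>norm u - 1\<bar> \<le> \<delta> * (1 + q)"
    proof -
      have "\<bar>norm u - norm (v a)\<bar> \<le> q * \<delta>"
        using norm_triangle_ineq3[of u "v a"] np by (simp add: u_def)
      thus ?thesis using na1 by (simp add: algebra_simps)
    qed
    have nu0: "norm u > 0" using nu \<delta>' by linarith
    define w' where "w' = w(a := (1 / norm u) *\<^sub>R u)"
    have nd: "norm (v a - (1 / norm u) *\<^sub>R u) \<le> (2 * q + 1) * \<delta>"
    proof -
      have "v a - (1 / norm u) *\<^sub>R u = p + (1 - 1 / norm u) *\<^sub>R u"
        by (simp add: u_def algebra_simps)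
      moreover have "norm ((1 - 1 / norm u) *\<^sub>R u) = \<bar>norm u - 1\<bar>"
      proof -
        have "norm ((1 - 1 / norm u) *\<^sub>R u) = \<bar>(1 - 1 / norm u) * norm u\<bar>" by (simp add: abs_mult)
        also have "(1 - 1 / norm u) * norm u = norm u - 1" using nu0 by (simp add: field_simps)
        finally show ?thesis .
      qed
      ultimately have "norm (v a - (1 / norm u) *\<^sub>R u) \<le> norm p + \<bar>norm u - 1\<bar>"
        by (metis norm_triangle_ineq)
      thus ?thesis using np nu by (simp add: algebra_simps)
    qed
    show "\<exists>w. (\<forall>i\<in>insert a I. \<forall>j\<in>insert a I. inner (w i) (w j) = (if i = j then 1 else 0)) \<and>
           (\<forall>i\<in>insert a I. norm (v i - w i) \<le> (K + 2 * q + 1) * \<delta>)"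
    proof (intro exI[of _ w'] conjI ballI)
      fix i j assume ij: "i \<in> insert a I" "j \<in> insert a I"
      have "u \<bullet> u = norm u * norm u" by (simp add: norm_eq_sqrt_inner)
      thus "inner (w' i) (w' j) = (if i = j then 1 else 0)"
        using ij insert.hyps w(1) uw nu0 by (auto simp: w'_def inner_commute)
    next
      fix i assume "i \<in> insert a I"
      thus "norm (v i - w' i) \<le> (K + 2 * q + 1) * \<delta>"
      proof (cases "i = a")
        case True
        moreover have "(2 * q + 1) * \<delta> \<le> (K + 2 * q + 1) * \<delta>" using \<delta> K by (intro mult_right_mono) auto
        ultimately show ?thesis using nd by (simp add: w'_def)
      next
        case False
        hence "norm (v i - w' i) \<le> K * \<delta>" using w(2) \<open>i \<in> insert a I\<close> by (auto simp: w'_def)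
        moreover have "K * \<delta> \<le> (K + 2 * q + 1) * \<delta>" using \<delta> K q by (intro mult_right_mono) auto
        ultimately show ?thesis by linarith
      qed
    qed
  qed (use K q d1 in auto)
qed

lemma orthonormal_rows_expansion:
  fixes w :: "'d::finite \<Rightarrow> real ^ 'd"
  assumes "\<And>k l. w k \<bullet> w l = (if k = l then 1 else 0)"
  shows "orthogonal_matrix (\<chi> k. w k)" and "(\<Sum>k\<in>UNIV. (x \<bullet> w k) *\<^sub>R w k) = x"
proof -
  have "(\<chi> k. w k) ** transpose (\<chi> k. w k) = Finite_Cartesian_Product.mat 1"
    using assms by (simp add: Finite_Cartesian_Product.vec_eq_iff matrix_matrix_mult_def transpose_def Finite_Cartesian_Product.mat_def inner_vec_def)
  thus o: "orthogonal_matrix (\<chi> k. w k)"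
    unfolding orthogonal_matrix_def using matrix_left_right_inverse by auto
  have "x = transpose (\<chi> k. w k) *v ((\<chi> k. w k) *v x)"
    using o by (simp add: matrix_vector_mul_assoc orthogonal_matrix_def)
  also have "\<dots> = ((\<chi> k. w k) *v x) v* (\<chi> k. w k)" by (simp add: transpose_matrix_vector)
  also have "\<dots> = (\<Sum>k\<in>UNIV. (x \<bullet> w k) *\<^sub>R w k)"
    by (simp add: Finite_Cartesian_Product.vec_eq_iff vector_matrix_mult_def matrix_vector_mult_def inner_vec_def mult.commute)
  finally show "(\<Sum>k\<in>UNIV. (x \<bullet> w k) *\<^sub>R w k) = x" by simp
qed

lemma sum_mult_le_L2_set: "\<bar>\<Sum>i\<in>A. f i * g i\<bar> \<le> L2_set f A * L2_set g A"
proof -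
  have "\<bar>\<Sum>i\<in>A. f i * g i\<bar> \<le> (\<Sum>i\<in>A. \<bar>f i\<bar> * \<bar>g i\<bar>)"
    by (rule order.trans[OF sum_abs]) (simp add: abs_mult)
  thus ?thesis using L2_set_mult_ineq order.trans by blast
qed

lemma L2_set_le_sqrt_card:
  assumes "\<And>i. i \<in> A \<Longrightarrow> \<bar>f i\<bar> \<le> r" "0 \<le> r"
  shows "L2_set f A \<le> sqrt (real (card A)) * r"
proof -
  have "(\<Sum>i\<in>A. (f i)\<^sup>2) \<le> (\<Sum>i\<in>A. r\<^sup>2)"
    using assms by (intro sum_mono) (metis abs_of_nonneg abs_le_square_iff)
  hence "L2_set f A \<le> sqrt (real (card A) * r\<^sup>2)" unfolding L2_set_def by simp
  thus ?thesis using assms by (simp add: real_sqrt_mult)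
qed

text \<open>The symmetric matrix \<open>Z Z\<^sup>T - Y Y\<^sup>T + E\<close> has orthonormal eigenvectors \<open>u k\<close> with eigenvalues of
  order \<open>s\<^sup>2\<close>, while \<open>E\<close> and \<open>Y\<^sup>T Z\<close> are of order \<open>\<sigma> s\<^sup>2\<close>.\<close>

locale perturbed_eigenvectors =
  fixes N :: nat and s \<sigma> r c p :: real and Z Y :: "nat \<Rightarrow> real ^ 'd" and E :: "nat \<Rightarrow> nat \<Rightarrow> real"
    and u :: "'d::finite \<Rightarrow> nat \<Rightarrow> real" and ev :: "'d \<Rightarrow> real"
  assumes s: "s > 0" and \<sigma>: "0 \<le> \<sigma>" "\<sigma> \<le> 1" and r: "0 \<le> r" and c: "0 < c" and p: "0 \<le> p"
    and Np: "sqrt (real N) \<le> p * s"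
    and ev: "\<And>k. c * s\<^sup>2 \<le> ev k"
    and eig: "\<And>k h. h < N \<Longrightarrow>
      (\<Sum>h'<N. (Z h \<bullet> Z h' - Y h \<bullet> Y h' + E h h') * u k h') = ev k * u k h"
    and orthonormal: "\<And>k l. (\<Sum>h<N. u k h * u l h) = (if k = l then 1 else 0)"
    and Zr: "\<And>h. h < N \<Longrightarrow> norm (Z h) \<le> r" and Yr: "\<And>h. h < N \<Longrightarrow> norm (Y h) \<le> r"
    and E1: "\<And>h h'. \<lbrakk>h < N; h' < N\<rbrakk> \<Longrightarrow> \<bar>E h h'\<bar> \<le> 1"
    and Ebil: "\<And>x y. \<bar>\<Sum>h<N. x h * (\<Sum>h'<N. E h h' * y h')\<bar>
      \<le> \<sigma> * s\<^sup>2 * L2_set x {..<N} * L2_set y {..<N}"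
    and YZ: "\<And>\<alpha> \<beta>. \<bar>\<Sum>h<N. (Y h \<bullet> \<alpha>) * (Z h \<bullet> \<beta>)\<bar> \<le> \<sigma> * s\<^sup>2 * norm \<alpha> * norm \<beta>"
    and EZ: "\<And>h \<alpha>. h < N \<Longrightarrow> \<bar>\<Sum>h'<N. E h h' * (Z h' \<bullet> \<alpha>)\<bar> \<le> \<sigma> * s\<^sup>2 * norm \<alpha>"
begin

text \<open>Constants of the successive estimates: \<open>K1 * \<sigma> * s\<close> bounds the norm
  of \<open>t k\<close>, \<open>K2 * \<sigma>\<close> the defect of the Gram matrix of the
  \<open>\<mu> k\<close>, \<open>K3 * \<sigma> * s\<close> an entry of E u, and
  \<open>K4 * \<sigma>\<close> the residual of a row. They involve \<open>r\<close>,
  \<open>c\<close> and \<open>p\<close> only and are therefore uniform in the size of the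
  matrix.\<close>

definition "K1 = 2 * r * p / c"
definition "K2 = (K1\<^sup>2 + 1) / c"
definition "K3 = (r * p + p * (r * p) * K1 + p) / c"
definition "K4 = (r * K1 + K3) / sqrt c"

lemma K_nonneg: "0 \<le> K1" "0 \<le> K2" "0 \<le> K3" "0 \<le> K4"
proof -
  show 1: "0 \<le> K1" using r p c by (simp add: K1_def)
  show "0 \<le> K2" using c by (simp add: K2_def)
  show 3: "0 \<le> K3" unfolding K3_def using r p c 1 by (intro divide_nonneg_nonneg add_nonneg_nonneg mult_nonneg_nonneg) auto
  show "0 \<le> K4" unfolding K4_def using r c 1 3 by auto
qed

lemma cs: "0 < c * s\<^sup>2" using c s by simp

lemma ev_pos: "0 < ev k" using ev[of k] cs by linarith

lemma sqrt_ev: "sqrt c * s \<le> sqrt (ev k)" "0 < sqrt c * s"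
proof -
  have "sqrt (c * s\<^sup>2) \<le> sqrt (ev k)" using ev by simp
  thus "sqrt c * s \<le> sqrt (ev k)" using s by (simp add: real_sqrt_mult)
qed (use c s in simp)

lemma L2_inner_le:
  assumes "\<And>h. h < N \<Longrightarrow> norm (V h) \<le> r"
  shows "L2_set (\<lambda>h. V h \<bullet> \<alpha>) {..<N} \<le> r * p * s * norm \<alpha>"
proof -
  have "L2_set (\<lambda>h. V h \<bullet> \<alpha>) {..<N} \<le> sqrt (real (card {..<N})) * (r * norm \<alpha>)"
  proof (rule L2_set_le_sqrt_card)
    fix h assume "h \<in> {..<N}"
    thus "\<bar>V h \<bullet> \<alpha>\<bar> \<le> r * norm \<alpha>"
      using assms by (intro order.trans[OF Cauchy_Schwarz_ineq2] mult_right_mono) auto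
  qed (use r in simp)
  also have "\<dots> \<le> p * s * (r * norm \<alpha>)" using Np r by (intro mult_right_mono) auto
  finally show ?thesis by (simp add: mult_ac)
qed

lemma L2_u: "L2_set (u k) {..<N} = 1"
  using orthonormal[of k k] by (simp add: L2_set_def power2_eq_square)

text \<open>The k-th columns of the products Z^T U, Y^T U and E U of the overview.\<close>

definition "z k = (\<Sum>h<N. u k h *\<^sub>R Z h)"
definition "t k = (\<Sum>h<N. u k h *\<^sub>R Y h)"
definition "Eu k h = (\<Sum>h'<N. E h h' * u k h')"

lemma inner_z: "(\<Sum>h<N. u k h * (Z h \<bullet> \<alpha>)) = z k \<bullet> \<alpha>"
  by (simp add: z_def inner_sum_left)

lemma inner_t: "(\<Sum>h<N. u k h * (Y h \<bullet> \<alpha>)) = t k \<bullet> \<alpha>"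
  by (simp add: t_def inner_sum_left)

lemma norm_z: "norm (z k) \<le> r * p * s"
proof -
  have "norm (z k) * norm (z k) = (\<Sum>h<N. u k h * (Z h \<bullet> z k))"
    by (simp add: inner_z flip: power2_norm_eq_inner power2_eq_square)
  also have "\<dots> \<le> 1 * (r * p * s * norm (z k))"
    using sum_mult_le_L2_set[of "u k" "\<lambda>h. Z h \<bullet> z k" "{..<N}"] L2_inner_le[OF Zr, of "\<lambda>h. h" "z k"]
    by (simp add: L2_u)
  finally show ?thesis using r p s by (cases "norm (z k) = 0") auto
qed

lemma eig': "h < N \<Longrightarrow> ev k * u k h = Z h \<bullet> z k - Y h \<bullet> t k + Eu k h"
  unfolding eig[symmetric] z_def t_def Eu_def
  by (simp add: inner_sum_right sum.distrib sum_subtractf algebra_simps)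

text \<open>Testing the bilinear bound with E u itself turns it into a norm bound.\<close>

lemma L2_Eu: "L2_set (Eu k) {..<N} \<le> \<sigma> * s\<^sup>2"
proof -
  have "L2_set (Eu k) {..<N} * L2_set (Eu k) {..<N} = (\<Sum>h<N. Eu k h * (\<Sum>h'<N. E h h' * u k h'))"
    by (simp add: L2_set_def sum_nonneg power2_eq_square Eu_def)
  also have "\<dots> \<le> \<sigma> * s\<^sup>2 * L2_set (Eu k) {..<N} * 1"
    using Ebil[of "Eu k" "u k"] by (simp add: L2_u)
  finally show ?thesis using \<sigma> L2_set_nonneg[of "Eu k" "{..<N}"]
    by (cases "L2_set (Eu k) {..<N} = 0") (auto simp: mult_le_cancel_right)
qed

text \<open>The sign of \<open>- Y Y\<^sup>T\<close> keeps the eigenvectors with large positive eigenvalues away from the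
  range of \<open>Y\<close>.\<close>

lemma norm_t: "norm (t k) \<le> K1 * \<sigma> * s"
proof -
  have "ev k * (norm (t k))\<^sup>2 = (\<Sum>h<N. (ev k * u k h) * (Y h \<bullet> t k))"
    by (simp add: power2_norm_eq_inner mult.assoc inner_t flip: sum_distrib_left)
  also have "\<dots> = (\<Sum>h<N. (Y h \<bullet> t k) * (Z h \<bullet> z k)) - (\<Sum>h<N. (Y h \<bullet> t k)\<^sup>2)
      + (\<Sum>h<N. (Y h \<bullet> t k) * Eu k h)"
    by (simp add: eig' algebra_simps sum.distrib sum_subtractf power2_eq_square)
  \<comment> \<open>The sum of squares stands with a minus sign and is replaced by 0; with the
    opposite sign of Y Y^T this would be impossible.\<close>
  also have "\<dots> \<le> \<sigma> * s\<^sup>2 * norm (t k) * (r * p * s) - 0 + \<sigma> * s\<^sup>2 * (r * p * s * norm (t k)) * 1"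
  proof (intro add_mono diff_mono)
    show "(\<Sum>h<N. (Y h \<bullet> t k) * (Z h \<bullet> z k)) \<le> \<sigma> * s\<^sup>2 * norm (t k) * (r * p * s)"
      using YZ[of "t k" "z k"] norm_z[of k] \<sigma>
      by (meson abs_le_D1 mult_left_mono mult_nonneg_nonneg norm_ge_zero order.trans zero_le_power2)
    have "(\<Sum>h<N. (Y h \<bullet> t k) * Eu k h) \<le> \<sigma> * s\<^sup>2 * L2_set (\<lambda>h. Y h \<bullet> t k) {..<N} * 1"
      using Ebil[of "\<lambda>h. Y h \<bullet> t k" "u k"] by (simp add: L2_u Eu_def)
    also have "\<dots> \<le> \<sigma> * s\<^sup>2 * (r * p * s * norm (t k)) * 1"
      using L2_inner_le[of Y "t k"] Yr \<sigma> by (intro mult_right_mono mult_left_mono) auto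
    finally show "(\<Sum>h<N. (Y h \<bullet> t k) * Eu k h) \<le> \<sigma> * s\<^sup>2 * (r * p * s * norm (t k)) * 1" .
  qed (simp add: sum_nonneg)
  finally have "ev k * (norm (t k))\<^sup>2 \<le> 2 * \<sigma> * s\<^sup>2 * (r * p * s) * norm (t k)" by (simp add: mult_ac)
  moreover have "c * s\<^sup>2 * (norm (t k))\<^sup>2 \<le> ev k * (norm (t k))\<^sup>2" using ev by (intro mult_right_mono) auto
  ultimately have "(c * s\<^sup>2 * norm (t k)) * norm (t k) \<le> (2 * \<sigma> * s\<^sup>2 * (r * p * s)) * norm (t k)"
    by (simp add: power2_eq_square)
  show ?thesis
  proof (cases "t k = 0")
    case False
    hence "c * s\<^sup>2 * norm (t k) \<le> 2 * \<sigma> * s\<^sup>2 * (r * p * s)"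
      using \<open>(c * s\<^sup>2 * norm (t k)) * norm (t k) \<le> _\<close> by (simp add: mult_le_cancel_right)
    hence "s\<^sup>2 * (c * norm (t k)) \<le> s\<^sup>2 * (2 * r * p * \<sigma> * s)" by (simp add: mult_ac)
    hence "c * norm (t k) \<le> 2 * r * p * \<sigma> * s" using s unfolding mult_le_cancel_left by simp
    thus ?thesis using c by (simp add: K1_def field_simps)
  qed (use K_nonneg \<sigma> s in simp)
qed

text \<open>The inner product of the eigenvector equation for \<open>u k\<close> with
  \<open>u l\<close> reads: the eigenvalue, if k = l, equals z_k . z_l minus t_k . t_l plus the
  noise form at (u_l, u_k). The last two terms are the error.\<close>

lemma gram_z: "\<bar>z k \<bullet> z l - (if k = l then ev k else 0)\<bar> \<le> (K1\<^sup>2 + 1) * \<sigma> * s\<^sup>2"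
proof -
  have "(if k = l then ev k else 0) = ev k * (\<Sum>h<N. u k h * u l h)" using orthonormal by simp
  also have "\<dots> = (\<Sum>h<N. u l h * (ev k * u k h))" by (simp add: sum_distrib_left mult_ac)
  also have "\<dots> = (\<Sum>h<N. u l h * (Z h \<bullet> z k)) - (\<Sum>h<N. u l h * (Y h \<bullet> t k)) + (\<Sum>h<N. u l h * Eu k h)"
    by (simp add: eig' algebra_simps sum.distrib sum_subtractf)
  finally have "z k \<bullet> z l - (if k = l then ev k else 0) = t l \<bullet> t k - (\<Sum>h<N. u l h * Eu k h)"
    by (simp add: inner_z inner_t inner_commute)
  moreover have "\<bar>t l \<bullet> t k\<bar> \<le> (K1 * \<sigma> * s) * (K1 * \<sigma> * s)"
    using norm_t[of l] norm_t[of k] by (intro order.trans[OF Cauchy_Schwarz_ineq2] mult_mono) (auto intro: order.trans[OF norm_ge_zero])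
  \<comment> \<open>The quadratic term in \<sigma> is made linear by \<sigma> \<le> 1.\<close>
  moreover have "(K1 * \<sigma> * s) * (K1 * \<sigma> * s) \<le> K1\<^sup>2 * \<sigma> * s\<^sup>2"
  proof -
    have "\<sigma> * (K1\<^sup>2 * \<sigma> * s\<^sup>2) \<le> 1 * (K1\<^sup>2 * \<sigma> * s\<^sup>2)" using \<sigma> by (intro mult_right_mono) auto
    thus ?thesis by (simp add: power2_eq_square mult_ac)
  qed
  moreover have "\<bar>\<Sum>h<N. u l h * Eu k h\<bar> \<le> \<sigma> * s\<^sup>2"
    using Ebil[of "u l" "u k"] by (simp add: L2_u Eu_def)
  ultimately show ?thesis by (simp add: algebra_simps)
qed

text \<open>The entrywise estimate. Cauchy-Schwarz on the row gives only \<open>p * s\<close>,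
  without a factor \<sigma>. After multiplication by the eigenvalue and substitution of the equation
  for \<open>u\<close>, each of the terms E Z z, E Y t and E E u is of order \<sigma> s^3: the first
  by the row bound \<open>EZ\<close>, the second because \<open>t\<close> is small, the third
  because E u has a small norm. Division by \<open>c * s\<^sup>2\<close> leaves order \<sigma>
  s.\<close>

lemma Eu_le:
  assumes h: "h < N"
  shows "\<bar>Eu k h\<bar> \<le> K3 * \<sigma> * s"
proof -
  have Eh: "L2_set (E h) {..<N} \<le> p * s"
    using L2_set_le_sqrt_card[of "{..<N}" "E h" 1] E1 h Np by auto
  have "ev k * Eu k h = (\<Sum>h'<N. E h h' * (ev k * u k h'))"
    by (simp add: Eu_def sum_distrib_left mult_ac)
  also have "\<dots> = (\<Sum>h'<N. E h h' * (Z h' \<bullet> z k)) - (\<Sum>h'<N. E h h' * (Y h' \<bullet> t k)) + (\<Sum>h'<N. E h h' * Eu k h')"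
    by (simp add: eig' algebra_simps sum.distrib sum_subtractf)
  finally have eq: "ev k * Eu k h = \<dots>" .
  have "\<bar>\<Sum>h'<N. E h h' * (Z h' \<bullet> z k)\<bar> \<le> \<sigma> * s\<^sup>2 * (r * p * s)"
    using EZ[OF h, of "z k"] norm_z[of k] \<sigma>
    by (meson mult_left_mono mult_nonneg_nonneg order.trans zero_le_power2)
  moreover have "\<bar>\<Sum>h'<N. E h h' * (Y h' \<bullet> t k)\<bar> \<le> (p * s) * (r * p * s * (K1 * \<sigma> * s))"
  proof (rule order.trans[OF sum_mult_le_L2_set] mult_mono[OF Eh])+
    have "L2_set (\<lambda>h'. Y h' \<bullet> t k) {..<N} \<le> r * p * s * norm (t k)"
      using L2_inner_le[of Y] Yr by auto
    also have "\<dots> \<le> r * p * s * (K1 * \<sigma> * s)" using norm_t r p s by (intro mult_left_mono) auto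
    finally show "L2_set (\<lambda>h'. Y h' \<bullet> t k) {..<N} \<le> r * p * s * (K1 * \<sigma> * s)" .
  qed (use p s in auto)
  moreover have "\<bar>\<Sum>h'<N. E h h' * Eu k h'\<bar> \<le> (p * s) * (\<sigma> * s\<^sup>2)"
    by (rule order.trans[OF sum_mult_le_L2_set] mult_mono[OF Eh L2_Eu])+ (use p s in auto)
  ultimately have "\<bar>ev k * Eu k h\<bar> \<le> \<sigma> * s\<^sup>2 * (r * p * s) + (p * s) * (r * p * s * (K1 * \<sigma> * s)) + (p * s) * (\<sigma> * s\<^sup>2)"
    unfolding eq by linarith
  also have "\<dots> = c * s\<^sup>2 * (K3 * \<sigma> * s)" using c by (simp add: K3_def field_simps power2_eq_square)
  finally have "ev k * \<bar>Eu k h\<bar> \<le> c * s\<^sup>2 * (K3 * \<sigma> * s)" using ev_pos[of k] by (simp add: abs_mult)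
  moreover have "c * s\<^sup>2 * \<bar>Eu k h\<bar> \<le> ev k * \<bar>Eu k h\<bar>" using ev by (intro mult_right_mono) auto
  ultimately have "c * s\<^sup>2 * \<bar>Eu k h\<bar> \<le> c * s\<^sup>2 * (K3 * \<sigma> * s)" by linarith
  thus ?thesis using cs by (simp add: mult_le_cancel_left)
qed

text \<open>The k-th column of the matrix M of the overview.\<close>

definition "\<mu> k = (1 / sqrt (ev k)) *\<^sub>R z k"

text \<open>By the eigenvector equation the difference is (E u - Y t) / sqrt (ev), a numerator of
  order \<sigma> s over a denominator of order s.\<close>

lemma residual_le:
  assumes h: "h < N"
  shows "\<bar>u k h * sqrt (ev k) - Z h \<bullet> \<mu> k\<bar> \<le> K4 * \<sigma>"
proof -
  have "sqrt (ev k) * (u k h * sqrt (ev k) - Z h \<bullet> \<mu> k) = ev k * u k h - Z h \<bullet> z k"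
    using ev_pos[of k] by (simp add: \<mu>_def algebra_simps)
  also have "\<dots> = - (Y h \<bullet> t k) + Eu k h" using eig'[OF h] by simp
  also have "\<bar>\<dots>\<bar> \<le> r * (K1 * \<sigma> * s) + K3 * \<sigma> * s"
  proof -
    have "\<bar>Y h \<bullet> t k\<bar> \<le> r * (K1 * \<sigma> * s)"
      using Yr[OF h] norm_t[of k] r by (intro order.trans[OF Cauchy_Schwarz_ineq2] mult_mono) auto
    thus ?thesis using Eu_le[OF h, of k] by linarith
  qed
  also have "\<dots> = (sqrt c * s) * (K4 * \<sigma>)" using c by (simp add: K4_def field_simps)
  finally have "sqrt (ev k) * \<bar>u k h * sqrt (ev k) - Z h \<bullet> \<mu> k\<bar> \<le> (sqrt c * s) * (K4 * \<sigma>)"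
    using ev_pos[of k] by (simp add: abs_mult)
  moreover have "(sqrt c * s) * \<bar>u k h * sqrt (ev k) - Z h \<bullet> \<mu> k\<bar> \<le> sqrt (ev k) * \<bar>u k h * sqrt (ev k) - Z h \<bullet> \<mu> k\<bar>"
    using sqrt_ev by (intro mult_right_mono) auto
  ultimately have "(sqrt c * s) * \<bar>u k h * sqrt (ev k) - Z h \<bullet> \<mu> k\<bar> \<le> (sqrt c * s) * (K4 * \<sigma>)" by linarith
  thus ?thesis using sqrt_ev(2) by (simp add: mult_le_cancel_left)
qed

lemma gram_\<mu>: "\<bar>\<mu> k \<bullet> \<mu> l - (if k = l then 1 else 0)\<bar> \<le> K2 * \<sigma>"
proof -
  have "(sqrt (ev k) * sqrt (ev l)) * (\<mu> k \<bullet> \<mu> l - (if k = l then 1 else 0)) = z k \<bullet> z l - (if k = l then ev k else 0)"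
    using ev_pos[of k] ev_pos[of l] by (simp add: \<mu>_def algebra_simps)
  hence "(sqrt (ev k) * sqrt (ev l)) * \<bar>\<mu> k \<bullet> \<mu> l - (if k = l then 1 else 0)\<bar> = \<bar>z k \<bullet> z l - (if k = l then ev k else 0)\<bar>"
    using ev_pos[of k] ev_pos[of l] by (metis abs_mult abs_of_nonneg mult_nonneg_nonneg order_less_imp_le real_sqrt_ge_0_iff)
  also have "\<dots> \<le> (K1\<^sup>2 + 1) * \<sigma> * s\<^sup>2" by (rule gram_z)
  also have "\<dots> = c * s\<^sup>2 * (K2 * \<sigma>)" using c by (simp add: K2_def field_simps)
  also have "c * s\<^sup>2 = (sqrt c * s) * (sqrt c * s)" using c by (simp add: power2_eq_square)
  finally have "(sqrt (ev k) * sqrt (ev l)) * \<bar>\<mu> k \<bullet> \<mu> l - (if k = l then 1 else 0)\<bar>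
     \<le> (sqrt c * s) * (sqrt c * s) * (K2 * \<sigma>)" .
  moreover have "((sqrt c * s) * (sqrt c * s)) * \<bar>\<mu> k \<bullet> \<mu> l - (if k = l then 1 else 0)\<bar>
     \<le> (sqrt (ev k) * sqrt (ev l)) * \<bar>\<mu> k \<bullet> \<mu> l - (if k = l then 1 else 0)\<bar>"
    using sqrt_ev(1)[of k] sqrt_ev(1)[of l] sqrt_ev(2) ev_pos[of k] by (intro mult_right_mono mult_mono) auto
  ultimately have "((sqrt c * s) * (sqrt c * s)) * \<bar>\<mu> k \<bullet> \<mu> l - (if k = l then 1 else 0)\<bar>
     \<le> ((sqrt c * s) * (sqrt c * s)) * (K2 * \<sigma>)" by linarith
  thus ?thesis using sqrt_ev(2) by (simp add: mult_le_cancel_left)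
qed

text \<open>Both vectors are expanded in the orthonormal basis \<open>w\<close>, the rows of the
  rotation, so the error splits into coordinates. Each one collects the residual and the cost
  \<open>r * \<delta>\<close> of replacing \<open>\<mu> k\<close> by \<open>w k\<close>.\<close>

lemma aligned:
  assumes w: "\<And>k l. w k \<bullet> w l = (if k = l then 1 else 0)" and close: "\<And>k. norm (\<mu> k - w k) \<le> \<delta>"
    and h: "h < N"
  shows "norm ((\<chi> k. u k h * sqrt (ev k)) v* (\<chi> k. w k) - Z h) \<le> real CARD('d) * (K4 * \<sigma> + r * \<delta>)"
proof -
  have "(\<chi> k. u k h * sqrt (ev k)) v* (\<chi> k. w k) = (\<Sum>k\<in>UNIV. (u k h * sqrt (ev k)) *\<^sub>R w k)"
    by (simp add: Finite_Cartesian_Product.vec_eq_iff vector_matrix_mult_def mult_ac)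
  moreover have "Z h = (\<Sum>k\<in>UNIV. (Z h \<bullet> w k) *\<^sub>R w k)"
    using orthonormal_rows_expansion(2)[OF w] by simp
  ultimately have "(\<chi> k. u k h * sqrt (ev k)) v* (\<chi> k. w k) - Z h =
      (\<Sum>k\<in>UNIV. (u k h * sqrt (ev k) - Z h \<bullet> w k) *\<^sub>R w k)"
    by (simp add: sum_subtractf algebra_simps)
  also have "norm \<dots> \<le> (\<Sum>k\<in>(UNIV :: 'd set). K4 * \<sigma> + r * \<delta>)"
  proof (rule sum_norm_le)
    fix k :: 'd
    have "\<bar>Z h \<bullet> (\<mu> k - w k)\<bar> \<le> r * \<delta>"
      using Zr[OF h] close[of k] r by (intro order.trans[OF Cauchy_Schwarz_ineq2] mult_mono) auto
    moreover have "u k h * sqrt (ev k) - Z h \<bullet> w k = (u k h * sqrt (ev k) - Z h \<bullet> \<mu> k) + Z h \<bullet> (\<mu> k - w k)"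
      by (simp add: inner_diff_right)
    moreover have "norm (w k) = 1" using w by (simp add: norm_eq_sqrt_inner)
    ultimately show "norm ((u k h * sqrt (ev k) - Z h \<bullet> w k) *\<^sub>R w k) \<le> K4 * \<sigma> + r * \<delta>"
      using residual_le[OF h, of k] by simp
  qed
  finally show ?thesis by simp
qed

end

text \<open>The order of quantifiers is the point: \<open>K\<close> and \<open>\<sigma>0\<close> are
  found from \<open>r\<close>, \<open>c\<close>, \<open>p\<close> before the matrices are given, so
  they serve all n and all samples at once.\<close>

lemma perturbed_eigenvectors_aligned:
  fixes c r p :: real
  obtains K \<sigma>0 where "K \<ge> 0" "\<sigma>0 > 0"
    "\<And>N s \<sigma> Z Y E u ev. perturbed_eigenvectors N s \<sigma> r c p Z Y E (u :: 'd::finite \<Rightarrow> _) ev \<Longrightarrow> \<sigma> \<le> \<sigma>0 \<Longrightarrow>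
       \<exists>W. orthogonal_matrix W \<and> (\<forall>h<N. norm ((\<chi> k. u k h * sqrt (ev k)) v* W - Z h) \<le> K * \<sigma>)"
proof -
  obtain K' \<delta>0 where "K' \<ge> (0::real) \<and> \<delta>0 > 0 \<and> (\<forall>\<delta>\<le>\<delta>0. \<forall>v :: 'd \<Rightarrow> real ^ 'd. \<delta> \<ge> 0 \<longrightarrow>
     (\<forall>i\<in>UNIV. \<forall>j\<in>UNIV. \<bar>(v i \<bullet> v j) - (if i = j then 1 else 0)\<bar> \<le> \<delta>) \<longrightarrow>
     (\<exists>w. (\<forall>i\<in>UNIV. \<forall>j\<in>UNIV. w i \<bullet> w j = (if i = j then 1 else 0)) \<and> (\<forall>i\<in>UNIV. norm (v i - w i) \<le> K' * \<delta>)))"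
    using orthonormal_close[OF finite[of UNIV]] by (elim exE) (erule that)
  note K' = conjunct1[OF this] conjunct1[OF conjunct2[OF this]] and close = conjunct2[OF conjunct2[OF this]]
  \<comment> \<open>Copies of \<open>K1\<close> to \<open>K4\<close>, fixed before any particular
    eigenvectors are considered. The parameters carry no sign conditions here, hence the
    \<open>max 0\<close> in \<open>K\<close> and the absolute value in the bound for \<sigma>
    below.\<close>
  define k1 where "k1 = 2 * r * p / c"
  define k2 where "k2 = (k1\<^sup>2 + 1) / c"
  define k3 where "k3 = (r * p + p * (r * p) * k1 + p) / c"
  define k4 where "k4 = (r * k1 + k3) / sqrt c"
  define K where "K = max 0 (real CARD('d) * (k4 + r * (K' * k2)))"
  show ?thesis
  proof (rule that[of K "\<delta>0 / (\<bar>k2\<bar> + 1)"])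
    show "K \<ge> 0" by (simp add: K_def)
    show "\<delta>0 / (\<bar>k2\<bar> + 1) > 0" using K' by (intro divide_pos_pos) auto
    fix N s \<sigma> Z Y E and u :: "'d \<Rightarrow> nat \<Rightarrow> real" and ev
    assume "perturbed_eigenvectors N s \<sigma> r c p Z Y E u ev" and \<sigma>0: "\<sigma> \<le> \<delta>0 / (\<bar>k2\<bar> + 1)"
    then interpret perturbed_eigenvectors N s \<sigma> r c p Z Y E u ev by simp
    have Ks: "K2 = k2" "K4 = k4"
      by (simp_all add: K1_def K2_def K3_def K4_def k1_def k2_def k3_def k4_def)
    have "k2 * \<sigma> \<le> (\<bar>k2\<bar> + 1) * \<sigma>" using \<sigma> by (intro mult_right_mono) auto
    also have "\<dots> \<le> \<delta>0" using \<sigma>0 by (simp add: field_simps)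
    finally have d: "k2 * \<sigma> \<le> \<delta>0" .
    have "k2 * \<sigma> \<ge> 0" using K_nonneg \<sigma> Ks by simp
    from close[rule_format, OF d this, of \<mu>] gram_\<mu>
    obtain w where w: "\<And>k l. w k \<bullet> w l = (if k = l then 1 else 0)"
      "\<And>k. norm (\<mu> k - w k) \<le> K' * (k2 * \<sigma>)"
      unfolding Ks by auto
    have "norm ((\<chi> k. u k h * sqrt (ev k)) v* (\<chi> k. w k) - Z h) \<le> K * \<sigma>" if "h < N" for h
    proof -
      have "real CARD('d) * (k4 * \<sigma> + r * (K' * (k2 * \<sigma>))) = (real CARD('d) * (k4 + r * (K' * k2))) * \<sigma>"
        by (simp add: algebra_simps)
      also have "\<dots> \<le> K * \<sigma>" using \<sigma> by (intro mult_right_mono) (auto simp: K_def)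
      finally show ?thesis using aligned[OF w that] unfolding Ks by linarith
    qed
    thus "\<exists>W. orthogonal_matrix W \<and> (\<forall>h<N. norm ((\<chi> k. u k h * sqrt (ev k)) v* W - Z h) \<le> K * \<sigma>)"
      using orthonormal_rows_expansion(1)[OF w(1)] by blast
  qed
qed

section \<open>The omnibus matrix of a typical sample\<close>

lemma abs_sum_le:
  fixes f g :: "'a \<Rightarrow> real"
  shows "(\<And>i. i \<in> A \<Longrightarrow> \<bar>f i\<bar> \<le> g i) \<Longrightarrow> \<bar>sum f A\<bar> \<le> sum g A"
  by (rule order.trans[OF sum_abs sum_mono])

lemma sum_average_mult:
  fixes f a b :: "'a \<Rightarrow> real"
  shows "(\<Sum>i\<in>A. (a i + b i) / 2 * f i) = ((\<Sum>i\<in>A. a i * f i) + (\<Sum>i\<in>A. b i * f i)) / 2"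
    and "(\<Sum>i\<in>A. f i * ((a i + b i) / 2)) = ((\<Sum>i\<in>A. f i * a i) + (\<Sum>i\<in>A. f i * b i)) / 2"
proof -
  have "(a i + b i) / 2 * f i = (a i * f i + b i * f i) / 2" "f i * ((a i + b i) / 2) = (f i * a i + f i * b i) / 2" for i
    by (simp_all add: field_simps)
  thus "(\<Sum>i\<in>A. (a i + b i) / 2 * f i) = ((\<Sum>i\<in>A. a i * f i) + (\<Sum>i\<in>A. b i * f i)) / 2"
    "(\<Sum>i\<in>A. f i * ((a i + b i) / 2)) = ((\<Sum>i\<in>A. f i * a i) + (\<Sum>i\<in>A. f i * b i)) / 2"
    by (simp_all only: sum.distrib flip: sum_divide_distrib)
qed

lemma sum_div_mod:
  fixes f :: "nat \<Rightarrow> nat \<Rightarrow> 'a::comm_monoid_add"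
  assumes "n > 0"
  shows "(\<Sum>h<n * m. f (h div n) (h mod n)) = (\<Sum>g<m. \<Sum>i<n. f g i)"
proof (induction m)
  case (Suc m)
  have "(\<Sum>h<n * Suc m. f (h div n) (h mod n)) =
      (\<Sum>h<n * m. f (h div n) (h mod n)) + (\<Sum>h=n * m..<n * m + n. f (h div n) (h mod n))"
    by (simp add: lessThan_atLeast0 add.commute sum.atLeastLessThan_concat)
  also have "(\<Sum>h=n * m..<n * m + n. f (h div n) (h mod n)) = (\<Sum>i<n. f m i)"
    using assms sum.shift_bounds_nat_ivl[of "\<lambda>h. f (h div n) (h mod n)" 0 "n * m" n]
    by (simp add: lessThan_atLeast0 add.commute)
  finally show ?case using Suc by simp
qed simp

text \<open>At the vector Z \<alpha> the form equals |a|^2 - |y|^2 + q with a = Z^T Z \<alpha> and y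
  = Y^T Z \<alpha>. Cauchy-Schwarz for a . \<alpha> and \<open>ZZ\<close> give |a|^2 \<ge> \<gamma>
  |Z \<alpha>|^2, while the other two terms cost at most a quarter of this each. The result feeds
  \<open>count_large_eigenvalues\<close>.\<close>

lemma perturbed_quadratic_form:
  fixes Z Y :: "nat \<Rightarrow> 'a::real_inner"
  assumes YZ: "\<And>\<alpha> \<beta>. \<bar>\<Sum>h<N. (Y h \<bullet> \<alpha>) * (Z h \<bullet> \<beta>)\<bar> \<le> \<tau> * norm \<alpha> * norm \<beta>"
    and Ebil: "\<And>x y. \<bar>\<Sum>h<N. x h * (\<Sum>h'<N. E h h' * y h')\<bar> \<le> \<tau> * L2_set x {..<N} * L2_set y {..<N}"
    and ZZ: "\<And>\<alpha>. \<gamma> * (norm \<alpha>)\<^sup>2 \<le> (\<Sum>h<N. (Z h \<bullet> \<alpha>)\<^sup>2)"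
    and \<gamma>: "0 < \<gamma>" and \<tau>: "0 \<le> \<tau>" "\<tau> \<le> \<gamma> / 4"
  shows "\<gamma> / 2 * (\<Sum>h<N. (Z h \<bullet> \<alpha>)\<^sup>2)
    \<le> (\<Sum>h<N. (Z h \<bullet> \<alpha>) * (\<Sum>h'<N. (Z h \<bullet> Z h' - Y h \<bullet> Y h' + E h h') * (Z h' \<bullet> \<alpha>)))"
proof (cases "\<alpha> = 0")
  case False
  define \<zeta> where "\<zeta> = (\<Sum>h<N. (Z h \<bullet> \<alpha>)\<^sup>2)"
  define a where "a = (\<Sum>h<N. (Z h \<bullet> \<alpha>) *\<^sub>R Z h)"
  define y where "y = (\<Sum>h<N. (Z h \<bullet> \<alpha>) *\<^sub>R Y h)"
  define q where "q = (\<Sum>h<N. (Z h \<bullet> \<alpha>) * (\<Sum>h'<N. E h h' * (Z h' \<bullet> \<alpha>)))"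
  have na: "norm \<alpha> > 0" using False by simp
  have "\<zeta> \<ge> \<gamma> * (norm \<alpha>)\<^sup>2" using ZZ by (simp add: \<zeta>_def)
  hence n\<alpha>: "(norm \<alpha>)\<^sup>2 \<le> \<zeta> / \<gamma>" using \<gamma> by (simp add: field_simps)
  have \<zeta>0: "\<zeta> \<ge> 0" by (simp add: \<zeta>_def sum_nonneg)
  have sum: "(\<Sum>h<N. (Z h \<bullet> \<alpha>) * (\<Sum>h'<N. (Z h \<bullet> Z h' - Y h \<bullet> Y h' + E h h') * (Z h' \<bullet> \<alpha>)))
     = a \<bullet> a - y \<bullet> y + q"
  proof -
    have "(\<Sum>h'<N. (Z h \<bullet> Z h' - Y h \<bullet> Y h' + E h h') * (Z h' \<bullet> \<alpha>)) =
        Z h \<bullet> a - Y h \<bullet> y + (\<Sum>h'<N. E h h' * (Z h' \<bullet> \<alpha>))" for h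
      by (simp add: a_def y_def inner_sum_right sum.distrib sum_subtractf algebra_simps)
    note inner = this
    have "(\<Sum>h<N. (Z h \<bullet> \<alpha>) * (\<Sum>h'<N. (Z h \<bullet> Z h' - Y h \<bullet> Y h' + E h h') * (Z h' \<bullet> \<alpha>)))
       = (\<Sum>h<N. (Z h \<bullet> \<alpha>) * (Z h \<bullet> a)) - (\<Sum>h<N. (Z h \<bullet> \<alpha>) * (Y h \<bullet> y)) + q"
      unfolding inner q_def by (simp add: ring_distribs sum.distrib sum_subtractf)
    moreover have "(\<Sum>h<N. (Z h \<bullet> \<alpha>) * (Z h \<bullet> v)) = a \<bullet> v" "(\<Sum>h<N. (Z h \<bullet> \<alpha>) * (Y h \<bullet> v)) = y \<bullet> v" for v
      by (simp_all add: a_def y_def inner_sum_left)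
    ultimately show ?thesis by simp
  qed
  have "a \<bullet> \<alpha> = \<zeta>" by (simp add: a_def \<zeta>_def inner_sum_left power2_eq_square)
  hence "\<zeta> \<le> norm a * norm \<alpha>" using norm_cauchy_schwarz[of a \<alpha>] by simp
  hence "\<zeta> * \<zeta> \<le> (norm a * norm \<alpha>) * (norm a * norm \<alpha>)" using \<zeta>0 by (intro mult_mono) auto
  also have "\<dots> = (a \<bullet> a) * (norm \<alpha>)\<^sup>2" by (simp add: dot_square_norm power2_eq_square)
  also have "\<dots> \<le> (a \<bullet> a) * (\<zeta> / \<gamma>)" using n\<alpha> by (intro mult_left_mono) auto
  finally have "\<zeta> * (\<gamma> * \<zeta>) \<le> \<zeta> * (a \<bullet> a)" using \<gamma> by (simp add: field_simps)
  moreover have "\<zeta> > 0"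
    using \<open>\<zeta> \<ge> \<gamma> * (norm \<alpha>)\<^sup>2\<close> \<gamma> na by (smt (verit) mult_pos_pos zero_less_power)
  ultimately have aa: "\<gamma> * \<zeta> \<le> a \<bullet> a" by (simp add: mult_le_cancel_left)
  have "norm y * norm y = (\<Sum>h<N. (Y h \<bullet> y) * (Z h \<bullet> \<alpha>))"
    by (simp add: y_def inner_sum_left mult.commute flip: power2_eq_square power2_norm_eq_inner)
       (simp add: power2_norm_eq_inner inner_sum_left y_def mult.commute)
  also have "\<dots> \<le> \<tau> * norm \<alpha> * norm y" using YZ[of y \<alpha>] by (simp add: mult_ac)
  finally have "norm y \<le> \<tau> * norm \<alpha>" using \<tau> by (cases "norm y = 0") (auto simp: mult_le_cancel_right)
  hence "norm y * norm y \<le> (\<tau> * norm \<alpha>) * (\<tau> * norm \<alpha>)" by (intro mult_mono) (use \<tau> in auto)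
  also have "\<dots> = (\<tau> * \<tau>) * (norm \<alpha>)\<^sup>2" by (simp add: power2_eq_square)
  also have "\<dots> \<le> (\<gamma> / 4 * (\<gamma> / 4)) * (\<zeta> / \<gamma>)" using \<tau> \<gamma> n\<alpha> by (intro mult_mono) auto
  also have "\<dots> \<le> \<gamma> / 4 * \<zeta>" using \<gamma> \<zeta>0 by (simp add: field_simps)
  finally have yy: "y \<bullet> y \<le> \<gamma> / 4 * \<zeta>" by (simp add: dot_square_norm power2_eq_square)
  have "L2_set (\<lambda>h. Z h \<bullet> \<alpha>) {..<N} * L2_set (\<lambda>h. Z h \<bullet> \<alpha>) {..<N} = \<zeta>"
    by (simp add: L2_set_def \<zeta>_def sum_nonneg)
  hence "\<bar>q\<bar> \<le> \<tau> * \<zeta>" using Ebil[of "\<lambda>h. Z h \<bullet> \<alpha>" "\<lambda>h. Z h \<bullet> \<alpha>"] by (simp add: q_def mult.assoc)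
  also have "\<dots> \<le> \<gamma> / 4 * \<zeta>" using \<tau> \<zeta>0 by (intro mult_right_mono)
  finally have "- (\<gamma> / 4 * \<zeta>) \<le> q" by linarith
  thus ?thesis unfolding sum using aa yy by (simp add: \<zeta>_def[symmetric])
qed simp

text \<open>The weights \<open>Sp\<close> and \<open>Sm\<close> split \<open>(C\<^sup>g + C\<^sup>k) / 2\<close> as \<open>Sp\<^sup>g Sp\<^sup>k - Sm\<^sup>g Sm\<^sup>k\<close>; the choice
  \<open>q = C\<^sub>m powr (1/4)\<close> makes them orthogonal in each coordinate, so that \<open>Z\<close> and \<open>Y\<close> below nearly span
  the positive and the negative eigenspaces of the expected omnibus matrix.\<close>

locale omnibus_weights =
  fixes m :: nat and c :: "nat \<Rightarrow> 'd::finite \<Rightarrow> real" and q :: "'d \<Rightarrow> real"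
    and \<Delta> :: "'d \<Rightarrow> real" and \<gamma> :: real
  assumes m: "m \<ge> 1" and c: "\<And>g k. g < m \<Longrightarrow> 0 \<le> c g k" and q: "\<And>k. 0 < q k"
    and q4: "\<And>k. real m * q k ^ 4 = (\<Sum>g<m. (c g k)\<^sup>2)"
    and \<gamma>: "0 < \<gamma>" "\<And>k. 2 * \<gamma> \<le> \<Delta> k * (real m * (q k)\<^sup>2 / 4)"
begin

definition "Sp g k = (c g k / q k + q k) / 2"
definition "Sm g k = (c g k / q k - q k) / 2"
text \<open>\<open>r\<close> bounds all weights, and hence the rows of Z and Y; the 1 keeps it
  positive. \<open>\<kappa>\<close> is the loss in passing from single graphs to the omnibus matrix,
  a sum of the separate losses: \<open>(real m)\<^sup>2\<close> for the bilinear form, the next term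
  for rows of E Z, the last for weighted Gram matrices.\<close>

definition "r = 1 + (\<Sum>g<m. \<Sum>k\<in>UNIV. c g k / q k + q k)"
definition "\<kappa> = 1 + (real m)\<^sup>2 + real m * real CARD('d) * r + (real CARD('d))\<^sup>2 * (real m * r\<^sup>2)"

lemma r_pos: "0 < r"
  unfolding r_def using c q by (intro add_pos_nonneg sum_nonneg add_nonneg_nonneg divide_nonneg_nonneg) (auto intro: less_imp_le)

lemma \<kappa>_pos: "0 < \<kappa>"
  unfolding \<kappa>_def using r_pos by (intro add_pos_nonneg) auto

lemma S_bound:
  assumes g: "g < m"
  shows "\<bar>Sp g k\<bar> \<le> r" "\<bar>Sm g k\<bar> \<le> r"
proof -
  have nn: "0 \<le> c g' k / q k" "0 \<le> c g' k / q k + q k" if "g' < m" for g' k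
    using c[OF that, of k] q[of k] by (auto intro: add_nonneg_nonneg less_imp_le)
  have nn2: "0 \<le> (\<Sum>k\<in>UNIV. c g' k / q k + q k)" if "g' < m" for g'
    by (rule sum_nonneg) (rule nn(2)[OF that])
  have "c g k / q k + q k \<le> (\<Sum>k\<in>UNIV. c g k / q k + q k)"
    by (rule member_le_sum) (use nn g in auto)
  also have "\<dots> \<le> (\<Sum>g<m. \<Sum>k\<in>UNIV. c g k / q k + q k)"
    by (rule member_le_sum[of g "{..<m}" "\<lambda>g. \<Sum>k\<in>UNIV. c g k / q k + q k"])
       (use nn2 g in \<open>auto simp del: sum.distrib\<close>)
  finally have "c g k / q k + q k \<le> r" by (simp add: r_def)
  thus "\<bar>Sp g k\<bar> \<le> r" "\<bar>Sm g k\<bar> \<le> r"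
    using nn(1)[OF g, of k] q[of k] unfolding Sp_def Sm_def by (simp_all add: abs_le_iff)
qed

lemma S_split: "Sp g k * Sp g' k - Sm g k * Sm g' k = (c g k + c g' k) / 2"
  using q[of k] by (simp add: Sp_def Sm_def field_simps)

text \<open>A difference of squares: the product is (c^2 / q^2 - q^2) / 4, and its sum over the
  graphs vanishes because m q^4 is the sum of the c^2. This is the origin of the exponent
  1/4.\<close>

lemma S_orthogonal: "(\<Sum>g<m. Sm g k * Sp g k) = 0"
proof -
  have "Sm g k * Sp g k = ((c g k)\<^sup>2 / (q k)\<^sup>2 - (q k)\<^sup>2) / 4" for g
    using q[of k] by (simp add: Sp_def Sm_def field_simps power2_eq_square)
  hence "(\<Sum>g<m. Sm g k * Sp g k) = (\<Sum>g<m. ((c g k)\<^sup>2 / (q k)\<^sup>2 - (q k)\<^sup>2) / 4)"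
    by (rule sum.cong[OF refl])
  also have "\<dots> = ((\<Sum>g<m. (c g k)\<^sup>2) / (q k)\<^sup>2 - real m * (q k)\<^sup>2) / 4"
    by (simp add: sum_subtractf flip: sum_divide_distrib)
  also have "\<dots> = 0" using q[of k] by (simp add: q4[of k, symmetric]) (simp add: power2_eq_square power4_eq_xxxx)
  finally show ?thesis .
qed

text \<open>Nonnegative weights give Sp \<ge> q / 2. The factor 2 leaves room for the fluctuations
  of the Gram matrix, which take away one \<gamma> in \<open>ZZ\<close>.\<close>

lemma Sp_sum_squares: "2 * \<gamma> \<le> \<Delta> k * (\<Sum>g<m. Sp g k * Sp g k)"
proof -
  have "(\<Sum>g<m. (q k)\<^sup>2 / 4) \<le> (\<Sum>g<m. Sp g k * Sp g k)"
  proof (rule sum_mono)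
    fix g assume "g \<in> {..<m}"
    hence "q k / 2 \<le> Sp g k" using c[of g k] q[of k] by (simp add: Sp_def)
    hence "q k / 2 * (q k / 2) \<le> Sp g k * Sp g k" using q[of k] by (intro mult_mono) auto
    thus "(q k)\<^sup>2 / 4 \<le> Sp g k * Sp g k" by (simp add: power2_eq_square)
  qed
  moreover have "0 \<le> \<Delta> k"
  proof (rule ccontr)
    assume "\<not> ?thesis"
    hence "\<Delta> k * (real m * (q k)\<^sup>2 / 4) \<le> 0" by (intro mult_nonpos_nonneg) auto
    thus False using \<gamma>(1) \<gamma>(2)[of k] by linarith
  qed
  ultimately have "\<Delta> k * (real m * (q k)\<^sup>2 / 4) \<le> \<Delta> k * (\<Sum>g<m. Sp g k * Sp g k)"
    by (intro mult_left_mono) auto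
  thus ?thesis using \<gamma>(2)[of k] by linarith
qed

end

text \<open>The good event for one fixed sample, free of probability: \<open>x\<close> are the
  latent positions, \<open>e g\<close> is the noise of graph \<open>g\<close>, and all deviations
  are measured relative to n by \<sigma>.\<close>

locale omnibus_sample = omnibus_weights m c q \<Delta> \<gamma>
  for m and c :: "nat \<Rightarrow> 'd::finite \<Rightarrow> real" and q \<Delta> \<gamma> +
  fixes n :: nat and x :: "nat \<Rightarrow> real ^ 'd" and e :: "nat \<Rightarrow> nat \<Rightarrow> nat \<Rightarrow> real" and \<sigma> :: real
  assumes n: "n \<ge> 1" and \<sigma>: "0 \<le> \<sigma>"
    and x1: "\<And>i. i < n \<Longrightarrow> norm (x i) \<le> 1"
    and gram: "\<And>k l. \<bar>(\<Sum>i<n. x i $ k * x i $ l) - (if k = l then real n * \<Delta> k else 0)\<bar> \<le> \<sigma> * real n"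
    and e1: "\<And>g i j. \<lbrakk>g < m; i < n; j < n\<rbrakk> \<Longrightarrow> \<bar>e g i j\<bar> \<le> 1"
    and ebil: "\<And>g y w. g < m \<Longrightarrow> \<bar>\<Sum>i<n. y i * (\<Sum>j<n. e g i j * w j)\<bar>
       \<le> \<sigma> * real n * L2_set y {..<n} * L2_set w {..<n}"
    and erow: "\<And>g i k. \<lbrakk>g < m; i < n\<rbrakk> \<Longrightarrow> \<bar>\<Sum>j<n. e g i j * x j $ k\<bar> \<le> \<sigma> * real n"
begin

definition "Z h = (\<chi> k. Sp (h div n) k * x (h mod n) $ k)"
definition "Y h = (\<chi> k. Sm (h div n) k * x (h mod n) $ k)"
definition "E h h' = (e (h div n) (h mod n) (h' mod n) + e (h' div n) (h mod n) (h' mod n)) / 2"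

lemma index: "h < n * m \<Longrightarrow> h div n < m \<and> h mod n < n"
  using n by (simp add: less_mult_imp_div_less mult.commute)

lemma ZY: "Z h \<bullet> Z h' - Y h \<bullet> Y h' =
    (\<Sum>k\<in>UNIV. x (h mod n) $ k * ((c (h div n) k + c (h' div n) k) / 2) * x (h' mod n) $ k)"
  unfolding S_split[symmetric]
  by (simp add: Z_def Y_def inner_vec_def algebra_simps flip: sum_subtractf)

lemma ZYr:
  assumes h: "h < n * m"
  shows "norm (Z h) \<le> r" "norm (Y h) \<le> r"
proof -
  have 1: "norm (x (h mod n)) \<le> 1" using x1 index[OF h] by simp
  have "norm (Z h) \<le> norm (r *\<^sub>R x (h mod n))" "norm (Y h) \<le> norm (r *\<^sub>R x (h mod n))"
    unfolding Z_def Y_def using S_bound[of "h div n"] index[OF h] r_pos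
    by (intro norm_le_componentwise_cart; simp add: abs_mult mult_right_mono)+
  moreover have "norm (r *\<^sub>R x (h mod n)) \<le> r" using 1 r_pos by simp
  ultimately show "norm (Z h) \<le> r" "norm (Y h) \<le> r" by linarith+
qed

lemma E1: "\<lbrakk>h < n * m; h' < n * m\<rbrakk> \<Longrightarrow> \<bar>E h h'\<bar> \<le> 1"
  using index[of h] index[of h'] e1[of "h div n" "h mod n" "h' mod n"] e1[of "h' div n" "h mod n" "h' mod n"]
  unfolding E_def by simp

lemma L2_block:
  assumes g: "g < m"
  shows "L2_set (\<lambda>i. y (n * g + i)) {..<n} \<le> L2_set y {..<n * m}"
proof -
  have "(\<Sum>i<n. (y (n * g + i))\<^sup>2) \<le> (\<Sum>g<m. \<Sum>i<n. (y (n * g + i))\<^sup>2)"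
    by (rule member_le_sum[of g "{..<m}" "\<lambda>g. \<Sum>i<n. (y (n * g + i))\<^sup>2"]) (use g in \<open>auto intro: sum_nonneg\<close>)
  also have "\<dots> = (\<Sum>h<n * m. (y (n * (h div n) + h mod n))\<^sup>2)"
    using n by (subst sum_div_mod) auto
  finally show ?thesis by (simp add: L2_set_def)
qed

text \<open>The form splits into m^2 blocks. Each is an average of two single-graph forms evaluated
  at blocks of \<open>y\<close> and \<open>w\<close>, whose norms do not exceed the full
  norms.\<close>

lemma Ebil: "\<bar>\<Sum>h<n * m. y h * (\<Sum>h'<n * m. E h h' * w h')\<bar>
   \<le> (\<kappa> * \<sigma>) * real n * L2_set y {..<n * m} * L2_set w {..<n * m}"
proof -
  define b where "b a g k = (\<Sum>i<n. y (n * g + i) * (\<Sum>j<n. e a i j * w (n * k + j)))" for a g k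
  define T where "T = \<sigma> * real n * (L2_set y {..<n * m} * L2_set w {..<n * m})"
  have T0: "0 \<le> T" using \<sigma> by (simp add: T_def)
  have b: "\<bar>b a g k\<bar> \<le> T" if "a < m" "g < m" "k < m" for a g k
  proof -
    have "\<bar>b a g k\<bar> \<le> \<sigma> * real n * (L2_set (\<lambda>i. y (n * g + i)) {..<n} * L2_set (\<lambda>i. w (n * k + i)) {..<n})"
      unfolding b_def using ebil[OF that(1), of "\<lambda>i. y (n * g + i)" "\<lambda>i. w (n * k + i)"] by (simp add: mult.assoc)
    also have "\<dots> \<le> T"
      unfolding T_def using L2_block that \<sigma> by (intro mult_left_mono mult_mono) auto
    finally show ?thesis .
  qed
  have n0: "n > 0" using n by simp
  have inner: "(\<Sum>h'<n * m. E h h' * w h') =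
      (\<Sum>k<m. \<Sum>j<n. (e (h div n) (h mod n) j + e k (h mod n) j) / 2 * w (n * k + j))" for h
    using sum_div_mod[OF n0, of "\<lambda>k j. (e (h div n) (h mod n) j + e k (h mod n) j) / 2 * w (n * k + j)" m]
    by (simp add: E_def)
  have "(\<Sum>h<n * m. y h * (\<Sum>h'<n * m. E h h' * w h')) =
      (\<Sum>g<m. \<Sum>i<n. y (n * g + i) * (\<Sum>k<m. \<Sum>j<n. (e g i j + e k i j) / 2 * w (n * k + j)))"
    using sum_div_mod[OF n0, of "\<lambda>g i. y (n * g + i) * (\<Sum>k<m. \<Sum>j<n. (e g i j + e k i j) / 2 * w (n * k + j))" m]
    unfolding inner by simp
  also have "\<dots> = (\<Sum>g<m. \<Sum>k<m. (b g g k + b k g k) / 2)"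
  proof (rule sum.cong[OF refl])
    fix g
    have "(\<Sum>i<n. y (n * g + i) * (\<Sum>k<m. \<Sum>j<n. (e g i j + e k i j) / 2 * w (n * k + j))) =
       (\<Sum>i<n. \<Sum>k<m. y (n * g + i) * (\<Sum>j<n. (e g i j + e k i j) / 2 * w (n * k + j)))"
      by (simp add: sum_distrib_left)
    also have "\<dots> = (\<Sum>k<m. \<Sum>i<n. y (n * g + i) * (\<Sum>j<n. (e g i j + e k i j) / 2 * w (n * k + j)))"
      by (rule sum.swap)
    also have "\<dots> = (\<Sum>k<m. (b g g k + b k g k) / 2)"
      unfolding sum_average_mult b_def ..
    finally show "(\<Sum>i<n. y (n * g + i) * (\<Sum>k<m. \<Sum>j<n. (e g i j + e k i j) / 2 * w (n * k + j))) = \<dots>" .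
  qed
  also have "\<bar>\<dots>\<bar> \<le> (\<Sum>g<m. \<Sum>k<m. T)"
  proof (rule abs_sum_le)+
    fix g k assume "g \<in> {..<m}" "k \<in> {..<m}"
    thus "\<bar>(b g g k + b k g k) / 2\<bar> \<le> T" using b[of g g k] b[of k g k] by simp
  qed
  also have "\<dots> = (real m)\<^sup>2 * T" by (simp add: power2_eq_square)
  also have "\<dots> \<le> \<kappa> * T"
    unfolding \<kappa>_def using T0 r_pos by (intro mult_right_mono) auto
  finally show ?thesis by (simp add: T_def mult_ac)
qed

lemma EZ:
  assumes h: "h < n * m"
  shows "\<bar>\<Sum>h'<n * m. E h h' * (Z h' \<bullet> \<alpha>)\<bar> \<le> (\<kappa> * \<sigma>) * real n * norm \<alpha>"
proof -
  define g i where "g = h div n" and "i = h mod n"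
  have gi: "g < m" "i < n" using index[OF h] by (auto simp: g_def i_def)
  have "(\<Sum>h'<n * m. E h h' * (Z h' \<bullet> \<alpha>)) = (\<Sum>k<m. \<Sum>j<n. (e g i j + e k i j) / 2 * (\<Sum>l\<in>UNIV. Sp k l * x j $ l * \<alpha> $ l))"
    using sum_div_mod[of n "\<lambda>k j. (e g i j + e k i j) / 2 * (\<Sum>l\<in>UNIV. Sp k l * x j $ l * \<alpha> $ l)" m] n
    by (simp add: E_def Z_def inner_vec_def g_def i_def)
  also have "\<dots> = (\<Sum>k<m. \<Sum>l\<in>UNIV. Sp k l * \<alpha> $ l * (((\<Sum>j<n. e g i j * x j $ l) + (\<Sum>j<n. e k i j * x j $ l)) / 2))"
  proof (rule sum.cong[OF refl])
    fix k
    have "(\<Sum>j<n. (e g i j + e k i j) / 2 * (\<Sum>l\<in>UNIV. Sp k l * x j $ l * \<alpha> $ l)) =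
       (\<Sum>j<n. \<Sum>l\<in>UNIV. (e g i j + e k i j) / 2 * (Sp k l * x j $ l * \<alpha> $ l))"
      by (simp add: sum_distrib_left)
    also have "\<dots> = (\<Sum>l\<in>UNIV. \<Sum>j<n. (e g i j + e k i j) / 2 * (Sp k l * x j $ l * \<alpha> $ l))"
      by (rule sum.swap)
    also have "\<dots> = (\<Sum>l\<in>UNIV. Sp k l * \<alpha> $ l * (((\<Sum>j<n. e g i j * x j $ l) + (\<Sum>j<n. e k i j * x j $ l)) / 2))"
    proof (rule sum.cong[OF refl])
      fix l
      have "(\<Sum>j<n. (e g i j + e k i j) / 2 * (Sp k l * x j $ l * \<alpha> $ l))
          = (\<Sum>j<n. Sp k l * \<alpha> $ l * ((e g i j + e k i j) / 2 * x j $ l))"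
        by (rule sum.cong) (simp_all add: mult_ac)
      thus "(\<Sum>j<n. (e g i j + e k i j) / 2 * (Sp k l * x j $ l * \<alpha> $ l))
          = Sp k l * \<alpha> $ l * (((\<Sum>j<n. e g i j * x j $ l) + (\<Sum>j<n. e k i j * x j $ l)) / 2)"
        by (simp only: sum_average_mult flip: sum_distrib_left)
    qed
    finally show "(\<Sum>j<n. (e g i j + e k i j) / 2 * (\<Sum>l\<in>UNIV. Sp k l * x j $ l * \<alpha> $ l)) = \<dots>" .
  qed
  also have "\<bar>\<dots>\<bar> \<le> (\<Sum>k<m. \<Sum>l\<in>(UNIV::'d set). r * norm \<alpha> * (\<sigma> * real n))"
  proof (rule abs_sum_le)+
    fix k and l :: 'd assume k: "k \<in> {..<m}"
    have "\<bar>((\<Sum>j<n. e g i j * x j $ l) + (\<Sum>j<n. e k i j * x j $ l)) / 2\<bar> \<le> \<sigma> * real n"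
      using erow[of g i l] erow[of k i l] gi k by simp
    thus "\<bar>Sp k l * \<alpha> $ l * (((\<Sum>j<n. e g i j * x j $ l) + (\<Sum>j<n. e k i j * x j $ l)) / 2)\<bar>
       \<le> r * norm \<alpha> * (\<sigma> * real n)"
      unfolding abs_mult using S_bound(1)[of k l] k component_le_norm_cart[of \<alpha> l] r_pos
      by (intro mult_mono) auto
  qed
  also have "\<dots> = (real m * real CARD('d) * r) * (\<sigma> * real n * norm \<alpha>)" by simp
  also have "\<dots> \<le> \<kappa> * (\<sigma> * real n * norm \<alpha>)"
    unfolding \<kappa>_def using \<sigma> r_pos by (intro mult_right_mono) auto
  finally show ?thesis by (simp add: mult_ac)
qed

text \<open>Common source of \<open>YZ\<close> and \<open>ZZ\<close>: coordinatewise the sum factors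
  into the sum of S T over the graphs and an entry of the Gram matrix of \<open>x\<close>, which is
  then replaced by n \<Delta> on the diagonal. For S = Sm and T = Sp the main term is zero by
  \<open>S_orthogonal\<close>.\<close>

lemma weighted_gram:
  assumes "\<And>g k. g < m \<Longrightarrow> \<bar>S g k\<bar> \<le> r" "\<And>g k. g < m \<Longrightarrow> \<bar>T g k\<bar> \<le> r"
  shows "\<bar>(\<Sum>h<n * m. ((\<chi> k. S (h div n) k * x (h mod n) $ k) \<bullet> \<alpha>) * ((\<chi> k. T (h div n) k * x (h mod n) $ k) \<bullet> \<beta>))
     - real n * (\<Sum>k\<in>UNIV. \<alpha> $ k * \<beta> $ k * (\<Delta> k * (\<Sum>g<m. S g k * T g k)))\<bar>
    \<le> (\<kappa> * \<sigma>) * real n * norm \<alpha> * norm \<beta>"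
proof -
  define G where "G k l = (\<Sum>i<n. x i $ k * x i $ l)" for k l
  define D where "D k l = (if k = l then real n * \<Delta> k else 0)" for k l
  define V where "V k l = (\<Sum>g<m. S g k * T g l)" for k l
  have "(\<Sum>h<n * m. ((\<chi> k. S (h div n) k * x (h mod n) $ k) \<bullet> \<alpha>) * ((\<chi> k. T (h div n) k * x (h mod n) $ k) \<bullet> \<beta>))
    = (\<Sum>g<m. \<Sum>i<n. (\<Sum>k\<in>UNIV. S g k * x i $ k * \<alpha> $ k) * (\<Sum>l\<in>UNIV. T g l * x i $ l * \<beta> $ l))"
    using sum_div_mod[of n "\<lambda>g i. (\<Sum>k\<in>UNIV. S g k * x i $ k * \<alpha> $ k) * (\<Sum>l\<in>UNIV. T g l * x i $ l * \<beta> $ l)" m] n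
    by (simp add: inner_vec_def)
  also have "\<dots> = (\<Sum>g<m. \<Sum>i<n. \<Sum>k\<in>UNIV. \<Sum>l\<in>UNIV. \<alpha> $ k * \<beta> $ l * ((S g k * T g l) * (x i $ k * x i $ l)))"
    by (simp add: sum_product mult_ac)
  also have "\<dots> = (\<Sum>k\<in>UNIV. \<Sum>l\<in>UNIV. \<Sum>g<m. \<Sum>i<n. \<alpha> $ k * \<beta> $ l * ((S g k * T g l) * (x i $ k * x i $ l)))"
    by (subst (2) sum.swap, subst sum.swap, subst (3) sum.swap, subst (2) sum.swap) simp
  also have "\<dots> = (\<Sum>k\<in>UNIV. \<Sum>l\<in>UNIV. \<alpha> $ k * \<beta> $ l * (V k l * G k l))"
    by (simp only: V_def G_def sum_product) (simp only: sum_distrib_left)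
  finally have 1: "(\<Sum>h<n * m. ((\<chi> k. S (h div n) k * x (h mod n) $ k) \<bullet> \<alpha>) * ((\<chi> k. T (h div n) k * x (h mod n) $ k) \<bullet> \<beta>))
    = (\<Sum>k\<in>UNIV. \<Sum>l\<in>UNIV. \<alpha> $ k * \<beta> $ l * (V k l * G k l))" .
  have 2: "real n * (\<Sum>k\<in>UNIV. \<alpha> $ k * \<beta> $ k * (\<Delta> k * (\<Sum>g<m. S g k * T g k)))
    = (\<Sum>k\<in>UNIV. \<Sum>l\<in>UNIV. \<alpha> $ k * \<beta> $ l * (V k l * D k l))"
    by (simp add: D_def V_def if_distrib sum_distrib_left mult_ac cong: if_cong)
  have "\<bar>(\<Sum>k\<in>UNIV. \<Sum>l\<in>UNIV. \<alpha> $ k * \<beta> $ l * (V k l * (G k l - D k l)))\<bar>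
     \<le> (\<Sum>k\<in>(UNIV::'d set). \<Sum>l\<in>(UNIV::'d set). norm \<alpha> * norm \<beta> * ((real m * r\<^sup>2) * (\<sigma> * real n)))"
  proof (rule abs_sum_le)+
    fix k l
    have "\<bar>V k l\<bar> \<le> (\<Sum>g<m. r * r)"
      unfolding V_def
    proof (rule abs_sum_le)+
      fix g assume "g \<in> {..<m}"
      thus "\<bar>S g k * T g l\<bar> \<le> r * r" unfolding abs_mult using assms r_pos by (intro mult_mono) auto
    qed
    hence "\<bar>V k l\<bar> \<le> real m * r\<^sup>2" by (simp add: power2_eq_square)
    thus "\<bar>\<alpha> $ k * \<beta> $ l * (V k l * (G k l - D k l))\<bar> \<le> norm \<alpha> * norm \<beta> * ((real m * r\<^sup>2) * (\<sigma> * real n))"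
      unfolding abs_mult using gram[of k l] component_le_norm_cart[of \<alpha> k] component_le_norm_cart[of \<beta> l] \<sigma>
      by (intro mult_mono) (auto simp: G_def D_def)
  qed
  also have "\<dots> = ((real CARD('d))\<^sup>2 * (real m * r\<^sup>2)) * (\<sigma> * real n * (norm \<alpha> * norm \<beta>))"
    by (simp add: power2_eq_square)
  also have "\<dots> \<le> \<kappa> * (\<sigma> * real n * (norm \<alpha> * norm \<beta>))"
    unfolding \<kappa>_def using \<sigma> r_pos by (intro mult_right_mono) auto
  finally show ?thesis unfolding 1 2 by (simp add: right_diff_distrib sum_subtractf mult_ac)
qed

lemma YZ: "\<bar>\<Sum>h<n * m. (Y h \<bullet> \<alpha>) * (Z h \<bullet> \<beta>)\<bar> \<le> (\<kappa> * \<sigma>) * real n * norm \<alpha> * norm \<beta>"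
  using weighted_gram[of Sm Sp \<alpha> \<beta>, OF S_bound(2,1)] by (simp add: S_orthogonal Z_def Y_def)

lemma ZZ:
  assumes \<sigma>\<gamma>: "\<kappa> * \<sigma> \<le> \<gamma>"
  shows "\<gamma> * real n * (norm \<alpha>)\<^sup>2 \<le> (\<Sum>h<n * m. (Z h \<bullet> \<alpha>)\<^sup>2)"
proof -
  have "(\<Sum>k\<in>UNIV. \<alpha> $ k * \<alpha> $ k * (2 * \<gamma>)) \<le> (\<Sum>k\<in>UNIV. \<alpha> $ k * \<alpha> $ k * (\<Delta> k * (\<Sum>g<m. Sp g k * Sp g k)))"
    using Sp_sum_squares by (intro sum_mono mult_left_mono) auto
  moreover have "(\<Sum>k\<in>UNIV. \<alpha> $ k * \<alpha> $ k * (2 * \<gamma>)) = (norm \<alpha>)\<^sup>2 * (2 * \<gamma>)"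
    by (simp add: power2_norm_eq_inner inner_vec_def sum_distrib_right)
  ultimately have "real n * ((norm \<alpha>)\<^sup>2 * (2 * \<gamma>)) \<le> real n * (\<Sum>k\<in>UNIV. \<alpha> $ k * \<alpha> $ k * (\<Delta> k * (\<Sum>g<m. Sp g k * Sp g k)))"
    by (intro mult_left_mono) auto
  moreover have "\<bar>(\<Sum>h<n * m. (Z h \<bullet> \<alpha>)\<^sup>2) - real n * (\<Sum>k\<in>UNIV. \<alpha> $ k * \<alpha> $ k * (\<Delta> k * (\<Sum>g<m. Sp g k * Sp g k)))\<bar>
     \<le> (\<kappa> * \<sigma>) * (real n * (norm \<alpha>)\<^sup>2)"
    using weighted_gram[of Sp Sp \<alpha> \<alpha>, OF S_bound(1,1)] by (simp add: Z_def power2_eq_square mult_ac)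
  moreover have "(\<kappa> * \<sigma>) * (real n * (norm \<alpha>)\<^sup>2) \<le> \<gamma> * (real n * (norm \<alpha>)\<^sup>2)"
    using \<sigma>\<gamma> by (intro mult_right_mono) auto
  ultimately show ?thesis by (simp add: mult_ac)
qed

end

text \<open>The deterministic half of the theorem. \<open>K\<close> and \<open>\<sigma>0\<close>
  depend on the weights only, so that one choice covers every n and every sample in the good
  event.\<close>

lemma omnibus_aligned:
  fixes c :: "nat \<Rightarrow> 'd::{finite,linorder} \<Rightarrow> real"
  assumes weights: "omnibus_weights m c q \<Delta> \<gamma>"
  obtains K \<sigma>0 where "K \<ge> 0" "\<sigma>0 > 0"
    "\<And>n x e \<sigma> Bs (L :: nat \<Rightarrow> real ^ 'd::_). \<lbrakk>omnibus_sample m c q \<Delta> \<gamma> n x e \<sigma>; \<sigma> \<le> \<sigma>0; length Bs = m;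
       \<And>g. g < m \<Longrightarrow> transpose_mat (Bs ! g) = Bs ! g \<and> Bs ! g \<in> carrier_mat n n;
       \<And>g i j. \<lbrakk>g < m; i < n; j < n\<rbrakk> \<Longrightarrow> Bs ! g $$ (i, j) = e g i j + (\<Sum>k\<in>UNIV. x i $ k * c g k * x j $ k);
       is_omni n Bs L\<rbrakk> \<Longrightarrow>
       \<exists>W. orthogonal_matrix W \<and>
         (\<forall>h<n * m. norm (L h v* W - (\<chi> k. (c (h div n) k / q k + q k) / 2 * x (h mod n) $ k)) \<le> K * \<sigma>)"
proof -
  interpret omnibus_weights m c q \<Delta> \<gamma> by (rule weights)
  obtain K' \<sigma>1 where K': "K' \<ge> 0" "\<sigma>1 > 0"
    and aligned: "\<And>N s \<sigma> Z Y E u ev. perturbed_eigenvectors N s \<sigma> r (\<gamma> / 2) (sqrt (real m)) Z Y E (u :: 'd \<Rightarrow> _) ev \<Longrightarrow> \<sigma> \<le> \<sigma>1 \<Longrightarrow>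
       \<exists>W. orthogonal_matrix W \<and> (\<forall>h<N. norm ((\<chi> k. u k h * sqrt (ev k)) v* W - Z h) \<le> K' * \<sigma>)"
    using perturbed_eigenvectors_aligned[where 'd = 'd, of r "\<gamma> / 2" "sqrt (real m)"] by blast
  \<comment> \<open>The three bounds serve the alignment lemma, the assumption \<sigma> \<le> 1 of
    \<open>perturbed_eigenvectors\<close>, and the smallness required by
    \<open>perturbed_quadratic_form\<close>. Dividing by \<kappa> below pays for replacing \<sigma>
    by \<kappa> \<sigma>.\<close>
  define \<sigma>2 where "\<sigma>2 = min \<sigma>1 (min 1 (\<gamma> / 4))"
  have \<sigma>2: "\<sigma>2 > 0" "\<sigma>2 \<le> \<sigma>1" "\<sigma>2 \<le> 1" "\<sigma>2 \<le> \<gamma> / 4" using K' \<gamma> by (auto simp: \<sigma>2_def)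
  show ?thesis
  proof (rule that[of "K' * \<kappa>" "\<sigma>2 / \<kappa>"])
    show "K' * \<kappa> \<ge> 0" "\<sigma>2 / \<kappa> > 0" using K' \<kappa>_pos \<sigma>2 by auto
    fix n x e \<sigma> Bs and L :: "nat \<Rightarrow> real ^ 'd::_"
    assume sample: "omnibus_sample m c q \<Delta> \<gamma> n x e \<sigma>" and \<sigma>0: "\<sigma> \<le> \<sigma>2 / \<kappa>" and len: "length Bs = m"
      and Bs: "\<And>g. g < m \<Longrightarrow> transpose_mat (Bs ! g) = Bs ! g \<and> Bs ! g \<in> carrier_mat n n"
      and entry: "\<And>g i j. \<lbrakk>g < m; i < n; j < n\<rbrakk> \<Longrightarrow> Bs ! g $$ (i, j) = e g i j + (\<Sum>k\<in>UNIV. x i $ k * c g k * x j $ k)"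
      and omni: "is_omni n Bs L"
    interpret omnibus_sample m c q \<Delta> \<gamma> n x e \<sigma> by (rule sample)
    define \<sigma>' where "\<sigma>' = \<kappa> * \<sigma>"
    have \<sigma>': "0 \<le> \<sigma>'" "\<sigma>' \<le> \<sigma>2" using \<sigma>0 \<sigma> \<kappa>_pos by (auto simp: \<sigma>'_def field_simps)
    define B where "B = omnibus_matrix n Bs"
    have B: "B \<in> carrier_mat (n * m) (n * m)" by (simp add: B_def omnibus_matrix_def len)
    have symm: "Bs ! g $$ (i, j) = Bs ! g $$ (j, i)" if "g < m" "i < n" "j < n" for g i j
      using Bs[OF that(1)] that(2,3) by (metis carrier_matD index_transpose_mat(1))
    have symB: "transpose_mat B = B"
    proof (rule eq_matI)
      fix h h' assume "h < dim_row B" "h' < dim_col B"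
      hence h: "h < n * m" "h' < n * m" using B by auto
      show "transpose_mat B $$ (h, h') = B $$ (h, h')"
        using h symm[of "h div n" "h mod n" "h' mod n"] symm[of "h' div n" "h mod n" "h' mod n"]
          index[OF h(1)] index[OF h(2)]
        by (simp add: B_def omnibus_matrix_def len)
    qed (use B in auto)
    have Bentry: "B $$ (h, h') = Z h \<bullet> Z h' - Y h \<bullet> Y h' + E h h'" if h: "h < n * m" "h' < n * m" for h h'
    proof -
      have "(\<Sum>k\<in>UNIV. x (h mod n) $ k * ((c (h div n) k + c (h' div n) k) / 2) * x (h' mod n) $ k) =
        ((\<Sum>k\<in>UNIV. x (h mod n) $ k * c (h div n) k * x (h' mod n) $ k)
        + (\<Sum>k\<in>UNIV. x (h mod n) $ k * c (h' div n) k * x (h' mod n) $ k)) / 2"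
        by (simp add: ring_distribs add_divide_distrib sum.distrib sum_divide_distrib)
      thus ?thesis
        using h entry index[OF h(1)] index[OF h(2)]
        by (simp add: ZY B_def omnibus_matrix_def len E_def field_simps)
    qed
    have sn: "sqrt (real n) > 0" "(sqrt (real n))\<^sup>2 = real n" using n by auto
    have \<gamma>n: "\<gamma> * real n > 0" using \<gamma> n by simp
    have ZZ': "\<gamma> * real n * (norm \<alpha>)\<^sup>2 \<le> (\<Sum>h<n * m. (Z h \<bullet> \<alpha>)\<^sup>2)" for \<alpha>
      using ZZ \<sigma>' \<sigma>2 \<gamma> unfolding \<sigma>'_def by auto
    have count: "CARD('d) \<le> length (filter (\<lambda>e. \<gamma> / 2 * real n \<le> e) (eigenvalues_desc B))"
    proof -
      have "DIM(real ^ 'd::_) \<le> length (filter (\<lambda>e. \<gamma> / 2 * real n \<le> e) (eigenvalues_desc B))"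
      proof (rule count_large_eigenvalues[OF B symB, of Z])
        fix \<alpha> :: "real ^ 'd::_" assume "\<alpha> \<noteq> 0"
        hence "0 < \<gamma> * real n * (norm \<alpha>)\<^sup>2" using \<gamma>n by simp
        thus "0 < (\<Sum>h<n * m. (Z h \<bullet> \<alpha>)\<^sup>2)" using ZZ' by (rule less_le_trans)
      next
        fix \<alpha> :: "real ^ 'd::_"
        have "\<gamma> * real n / 2 * (\<Sum>h<n * m. (Z h \<bullet> \<alpha>)\<^sup>2) \<le>
          (\<Sum>h<n * m. (Z h \<bullet> \<alpha>) * (\<Sum>h'<n * m. (Z h \<bullet> Z h' - Y h \<bullet> Y h' + E h h') * (Z h' \<bullet> \<alpha>)))"
        proof (rule perturbed_quadratic_form[where \<tau> = "\<sigma>' * real n"])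
          show "\<sigma>' * real n \<le> \<gamma> * real n / 4"
            using mult_right_mono[of \<sigma>' "\<gamma> / 4" "real n"] \<sigma>' \<sigma>2 by simp
        qed (use YZ Ebil ZZ' \<gamma>n \<sigma>' in \<open>auto simp: \<sigma>'_def\<close>)
        also have "\<dots> = (\<Sum>h<n * m. (Z h \<bullet> \<alpha>) * (\<Sum>h'<n * m. B $$ (h, h') * (Z h' \<bullet> \<alpha>)))"
          by (intro sum.cong refl arg_cong[of _ _ "\<lambda>t. _ * t"]) (simp add: Bentry)
        finally show "\<gamma> / 2 * real n * (\<Sum>h<n * m. (Z h \<bullet> \<alpha>)\<^sup>2) \<le> \<dots>" by simp
      qed
      thus ?thesis by simp
    qed
    \<comment> \<open>This discharges the premise inside \<open>is_omni\<close>, without which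
      nothing would be known about \<open>L\<close>.\<close>
    have "CARD('d) \<le> length (filter (\<lambda>e. 0 < e) (eigenvalues_desc B))"
    proof -
      have "filter (\<lambda>e. \<gamma> / 2 * real n \<le> e) (eigenvalues_desc B)
          = filter (\<lambda>e. \<gamma> / 2 * real n \<le> e) (filter (\<lambda>e. 0 < e) (eigenvalues_desc B))"
        using \<gamma>n by (auto intro!: filter_cong)
      thus ?thesis using count length_filter_le by (metis order.trans)
    qed
    then obtain U :: "'d \<Rightarrow> real Matrix.vec" where U: "\<And>k. eigenvector B (U k) (top_eigenvalue B k)"
      "\<And>k l. scalar_prod (U k) (U l) = (if k = l then 1 else 0)"
      "\<And>h. h < n * m \<Longrightarrow> L h = (\<chi> k. vec_index (U k) h * sqrt (top_eigenvalue B k))"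
      using omni unfolding is_omni_def Let_def B_def len by blast
    have Uc: "U k \<in> carrier_vec (n * m)" and Ue: "B *\<^sub>v U k = top_eigenvalue B k \<cdot>\<^sub>v U k" for k
      using U(1)[of k] B by (auto simp: eigenvector_def)
    \<comment> \<open>The scale s is sqrt n, so that p = sqrt m accounts for the n m rows, and c =
      \<gamma> / 2 is the eigenvalue bound from the counting argument.\<close>
    have "perturbed_eigenvectors (n * m) (sqrt (real n)) \<sigma>' r (\<gamma> / 2) (sqrt (real m)) Z Y E
        (\<lambda>k h. vec_index (U k) h) (top_eigenvalue B)"
    proof
      show "\<gamma> / 2 * (sqrt (real n))\<^sup>2 \<le> top_eigenvalue B k" for k :: 'd
        using top_eigenvalue_ge[OF count] by (simp add: sn)
      show "(\<Sum>h'<n * m. (Z h \<bullet> Z h' - Y h \<bullet> Y h' + E h h') * vec_index (U k) h')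
          = top_eigenvalue B k * vec_index (U k) h" if "h < n * m" for h k
      proof -
        have "vec_index (B *\<^sub>v U k) h = (\<Sum>h'<n * m. B $$ (h, h') * vec_index (U k) h')"
          using that B Uc[of k] by (simp add: scalar_prod_def lessThan_atLeast0)
        thus ?thesis using Ue[of k] that Uc[of k] by (simp add: Bentry)
      qed
      show "(\<Sum>h<n * m. vec_index (U k) h * vec_index (U l) h) = (if k = l then 1 else 0)" for k l
        using U(2)[of k l] Uc[of l] by (simp add: scalar_prod_def lessThan_atLeast0)
      show "sqrt (real (n * m)) \<le> sqrt (real m) * sqrt (real n)" by (simp add: real_sqrt_mult)
    qed (use sn \<sigma>' \<sigma>2 r_pos \<gamma> ZYr E1 Ebil YZ EZ in \<open>auto simp: \<sigma>'_def\<close>)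
    from aligned[OF this] \<sigma>' \<sigma>2 obtain W where W: "orthogonal_matrix W"
      "\<And>h. h < n * m \<Longrightarrow> norm ((\<chi> k. vec_index (U k) h * sqrt (top_eigenvalue B k)) v* W - Z h) \<le> K' * \<sigma>'"
      by auto
    have "norm (L h v* W - (\<chi> k. (c (h div n) k / q k + q k) / 2 * x (h mod n) $ k)) \<le> K' * \<kappa> * \<sigma>"
      if "h < n * m" for h
      using W(2)[OF that] U(3)[OF that] by (simp add: Z_def Sp_def \<sigma>'_def mult_ac)
    thus "\<exists>W. orthogonal_matrix W \<and>
         (\<forall>h<n * m. norm (L h v* W - (\<chi> k. (c (h div n) k / q k + q k) / 2 * x (h mod n) $ k)) \<le> K' * \<kappa> * \<sigma>)"
      using W(1) by blast
  qed
qed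

section \<open>Concentration\<close>

text \<open>Every point outside the support has a null open neighbourhood, which may be taken from a
  countable basis; countably many null sets cover the complement.\<close>

lemma AE_support:
  fixes F :: "'a::second_countable_topology measure"
  assumes F: "sets F = sets borel"
  shows "AE x in F. x \<in> support F"
proof -
  obtain B :: "'a set set" where B: "countable B" "topological_basis B"
    using ex_countable_basis by blast
  define N where "N = \<Union>{b \<in> B. emeasure F b = 0}"
  have "b \<in> null_sets F" if "b \<in> B" "emeasure F b = 0" for b
    using that topological_basis_open[OF B(2)] F by (auto intro: null_setsI)
  hence "N \<in> null_sets F"
    unfolding N_def using B(1) by (intro null_sets_UN'[of _ "\<lambda>b. b", simplified]) auto
  moreover have "{x \<in> space F. x \<notin> support F} \<subseteq> N"
  proof
    fix x assume "x \<in> {x \<in> space F. x \<notin> support F}"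
    then obtain V where V: "open V" "x \<in> V" "emeasure F V = 0" by (auto simp: support_def)
    obtain b where b: "b \<in> B" "x \<in> b" "b \<subseteq> V" using topological_basisE[OF B(2) V(1,2)] by blast
    have "emeasure F b \<le> emeasure F V" using b V F by (intro emeasure_mono) auto
    thus "x \<in> N" using b V by (auto simp: N_def)
  qed
  ultimately show ?thesis by (rule AE_I')
qed

text \<open>Each summand ranges over an interval of length |w e|. The bound is stated with an upper
  estimate \<open>V\<close> of the sum of squares, since the weights will depend on the latent
  positions while the tail bound must not.\<close>

lemma bernoulli_Hoeffding:
  fixes w p :: "'i \<Rightarrow> real"
  assumes I: "finite I" and p: "\<And>e. e \<in> I \<Longrightarrow> p e \<in> {0..1}"
    and V: "(\<Sum>e\<in>I. (w e)\<^sup>2) \<le> V" and t: "0 \<le> t"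
  shows "measure_pmf.prob (Pi_pmf I False (\<lambda>e. bernoulli_pmf (p e)))
    {a. t < \<bar>\<Sum>e\<in>I. w e * (of_bool (a e) - p e)\<bar>} \<le> 2 * exp (- 2 * t\<^sup>2 / V)"
proof -
  define P where "P = Pi_pmf I False (\<lambda>e. bernoulli_pmf (p e))"
  show ?thesis
  proof (cases "(\<Sum>e\<in>I. (w e)\<^sup>2) = 0")
    \<comment> \<open>All weights vanish, a degenerate case for Hoeffding; the strict inequality in
      the event makes it empty even for t = 0.\<close>
    case True
    hence "w e = 0" if "e \<in> I" for e using that I by (simp add: sum_nonneg_eq_0_iff)
    hence "{a. t < \<bar>\<Sum>e\<in>I. w e * (of_bool (a e) - p e)\<bar>} = {}" using t by auto
    thus ?thesis by simp
  next
    case False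
    hence pos: "0 < (\<Sum>e\<in>I. (w e)\<^sup>2)" using sum_nonneg[of I "\<lambda>e. (w e)\<^sup>2"] by simp
    have "prob_space.indep_vars P (\<lambda>_. count_space UNIV) (\<lambda>e a. a e) I"
      unfolding P_def by (rule indep_vars_Pi_pmf[OF I])
    hence indep: "prob_space.indep_vars P (\<lambda>_. borel) (\<lambda>e a. w e * of_bool (a e)) I"
      by (rule prob_space.indep_vars_compose2[OF prob_space_measure_pmf]) auto
    interpret Hoeffding_ineq P I "\<lambda>e a. w e * of_bool (a e)" "\<lambda>e. min 0 (w e)" "\<lambda>e. max 0 (w e)"
      "\<Sum>e\<in>I. measure_pmf.expectation P (\<lambda>a. w e * of_bool (a e))"
      by unfold_locales (use I indep in \<open>auto simp: min_def max_def\<close>)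
    have ex: "measure_pmf.expectation P (\<lambda>a. w e * of_bool (a e)) = w e * p e" if e: "e \<in> I" for e
    proof -
      have "measure_pmf.expectation P (\<lambda>a. w e * of_bool (a e))
          = measure_pmf.expectation (map_pmf (\<lambda>a. a e) P) (\<lambda>b. w e * of_bool b)" by simp
      also have "map_pmf (\<lambda>a. a e) P = bernoulli_pmf (p e)"
        unfolding P_def by (simp add: Pi_pmf_component[OF I] e)
      finally show ?thesis using p[OF e] by simp
    qed
    have "(\<Sum>e\<in>I. (max 0 (w e) - min 0 (w e))\<^sup>2) = (\<Sum>e\<in>I. (w e)\<^sup>2)"
      by (intro sum.cong) (auto simp: min_def max_def)
    hence "measure_pmf.prob P {a. t \<le> \<bar>(\<Sum>e\<in>I. w e * of_bool (a e)) - (\<Sum>e\<in>I. w e * p e)\<bar>}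
        \<le> 2 * exp (- 2 * t\<^sup>2 / (\<Sum>e\<in>I. (w e)\<^sup>2))"
    proof -
      have "(\<Sum>e\<in>I. measure_pmf.expectation P (\<lambda>a. w e * of_bool (a e))) = (\<Sum>e\<in>I. w e * p e)"
        by (rule sum.cong[OF refl ex])
      from Hoeffding_ineq_abs_ge[OF t, unfolded this] pos
      show ?thesis unfolding \<open>(\<Sum>e\<in>I. (max 0 (w e) - min 0 (w e))\<^sup>2) = _\<close> by simp
    qed
    moreover have "measure_pmf.prob P {a. t < \<bar>\<Sum>e\<in>I. w e * (of_bool (a e) - p e)\<bar>}
       \<le> measure_pmf.prob P {a. t \<le> \<bar>(\<Sum>e\<in>I. w e * of_bool (a e)) - (\<Sum>e\<in>I. w e * p e)\<bar>}"
      by (rule measure_pmf.finite_measure_mono) (auto simp: right_diff_distrib sum_subtractf)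
    moreover have "- 2 * t\<^sup>2 / (\<Sum>e\<in>I. (w e)\<^sup>2) \<le> - 2 * t\<^sup>2 / V"
      using pos V by (simp add: frac_le)
    hence "2 * exp (- 2 * t\<^sup>2 / (\<Sum>e\<in>I. (w e)\<^sup>2)) \<le> 2 * exp (- 2 * t\<^sup>2 / V)" by simp
    ultimately have "measure_pmf.prob P {a. t < \<bar>\<Sum>e\<in>I. w e * (of_bool (a e) - p e)\<bar>} \<le> 2 * exp (- 2 * t\<^sup>2 / V)" by linarith
    thus ?thesis by (simp only: P_def)
  qed
qed

lemma finite_edge_indices [simp]: "finite (edge_indices m n)"
  by (rule finite_subset[of _ "{..<m} \<times> {..<n} \<times> {..<n}"]) (auto simp: edge_indices_def)

lemma subalgebra_latent_algebra:
  assumes X: "\<And>i. i < n \<Longrightarrow> X i \<in> borel_measurable M"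
  shows "subalgebra M (latent_algebra M n X)"
proof -
  have "(\<lambda>\<omega>. \<lambda>i\<in>{..<n}. X i \<omega>) \<in> measurable M (\<Pi>\<^sub>M i\<in>{..<n}. borel)"
    using X by measurable
  thus ?thesis
    unfolding subalgebra_def latent_algebra_def
    by (simp add: sets_image_in_sets)
qed

lemma measurable_latent_algebra:
  assumes "i < n"
  shows "X i \<in> borel_measurable (latent_algebra M n X)"
proof -
  have "(\<lambda>\<omega>. \<lambda>i\<in>{..<n}. X i \<omega>) \<in> measurable (latent_algebra M n X) (\<Pi>\<^sub>M i\<in>{..<n}. borel)"
    unfolding latent_algebra_def by (rule measurable_vimage_algebra1) (auto simp: space_PiM)
  from measurable_compose[OF this measurable_component_singleton[of i]] assms
  show ?thesis by (simp cong: measurable_cong)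
qed

text \<open>The observed graphs as a Boolean configuration, \<open>False\<close> off the index set
  to agree with the default value of \<open>Pi_pmf\<close>.\<close>

definition edges :: "nat \<Rightarrow> nat \<Rightarrow> (nat \<Rightarrow> real mat) \<Rightarrow> nat \<times> nat \<times> nat \<Rightarrow> bool" where
  "edges m n A = (\<lambda>(g, i, j). (g, i, j) \<in> edge_indices m n \<and> A g $$ (i, j) = 1)"

text \<open>A bound on the probability given the latent positions is integrated out.\<close>

lemma ESRDPG_prob_le:
  fixes A :: "nat \<Rightarrow> 'w \<Rightarrow> real mat" and X :: "nat \<Rightarrow> 'w \<Rightarrow> real ^ 'd"
  assumes G: "ESRDPG F n m C M A X"
    and T: "\<And>a. {\<omega> \<in> space M. T a \<omega>} \<in> sets (latent_algebra M n X)"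
    and AE_le: "AE \<omega> in M. measure_pmf.prob (Pi_pmf (edge_indices m n) False
        (\<lambda>(g, i, j). bernoulli_pmf (X i \<omega> \<bullet> (C g *v X j \<omega>)))) {a. T a \<omega>} \<le> \<epsilon>"
  shows "{\<omega> \<in> space M. T (edges m n (\<lambda>g. A g \<omega>)) \<omega>} \<in> sets M"
    and "measure M {\<omega> \<in> space M. T (edges m n (\<lambda>g. A g \<omega>)) \<omega>} \<le> \<epsilon>"
proof -
  define I where "I = edge_indices m n"
  have fI: "finite I" by (simp add: I_def)
  have P: "prob_space M" and X: "\<And>i. i < n \<Longrightarrow> X i \<in> borel_measurable M"
    and adj: "\<And>g \<omega>. g < m \<Longrightarrow> \<omega> \<in> space M \<Longrightarrow> adjacency_matrix n (A g \<omega>)"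
    and A [measurable]: "\<And>g i j. g < m \<Longrightarrow> i < n \<Longrightarrow> j < n \<Longrightarrow> (\<lambda>\<omega>. A g \<omega> $$ (i, j)) \<in> borel_measurable M"
    using G unfolding ESRDPG_def by blast+
  define S where "S a = {\<omega>'\<in>space M. \<forall>(g, i, j)\<in>I. A g \<omega>' $$ (i, j) = of_bool (a (g, i, j))}" for a
  have ce: "AE \<omega> in M. real_cond_exp M (latent_algebra M n X) (indicator (S a)) \<omega>
          = (\<Prod>(g, i, j)\<in>I. pmf (bernoulli_pmf (X i \<omega> \<bullet> (C g *v X j \<omega>))) (a (g, i, j)))" for a
    using G unfolding ESRDPG_def S_def I_def by blast
  interpret prob_space M by (rule P)
  interpret finite_measure_subalgebra M "latent_algebra M n X"
    by unfold_locales (rule subalgebra_latent_algebra[OF X])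
  have subset: "sets (latent_algebra M n X) \<subseteq> sets M" using subalg by (simp add: subalgebra_def)
  have S [measurable]: "S a \<in> sets M" for a
  proof -
    have "S a = {\<omega>'\<in>space M. \<forall>e\<in>I. A (fst e) \<omega>' $$ (fst (snd e), snd (snd e)) = of_bool (a e)}"
      by (auto simp: S_def)
    also have "\<dots> \<in> sets M"
    proof (rule sets.sets_Collect_finite_All[OF _ fI])
      fix e assume "e \<in> I"
      hence "fst e < m" "fst (snd e) < n" "snd (snd e) < n" by (auto simp: I_def edge_indices_def)
      from A[OF this] show "{\<omega>'\<in>space M. A (fst e) \<omega>' $$ (fst (snd e), snd (snd e)) = of_bool (a e)} \<in> sets M"
        by measurable
    qed
    finally show ?thesis .
  qed
  define cfg where "cfg = PiE_dflt I False (\<lambda>_. UNIV :: bool set)"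
  have fcfg: "finite cfg" unfolding cfg_def using fI by (intro finite_PiE_dflt) auto
  define TT where "TT a = {\<omega> \<in> space M. T a \<omega>}" for a
  have TT: "TT a \<in> sets M" "TT a \<in> sets (latent_algebra M n X)" for a
    using T[of a] subset by (auto simp: TT_def)
  have A01: "A g \<omega> $$ (i, j) = 0 \<or> A g \<omega> $$ (i, j) = 1" if "(g, i, j) \<in> I" "\<omega> \<in> space M" for g i j \<omega>
  proof -
    have "g < m" "i < n" "j < n" using that(1) by (auto simp: I_def edge_indices_def)
    thus ?thesis using adj[OF _ that(2), of g] by (simp add: adjacency_matrix_def)
  qed
  have int_S: "integrable M (indicat_real (S a))" for a
    by (rule integrable_real_indicator) (auto simp: emeasure_eq_measure)
  have in_cfg: "edges m n (\<lambda>g. A g \<omega>) \<in> cfg" for \<omega>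
    by (auto simp: cfg_def PiE_dflt_def edges_def I_def)
  have S_iff: "\<omega> \<in> S a \<longleftrightarrow> edges m n (\<lambda>g. A g \<omega>) = a" if \<omega>: "\<omega> \<in> space M" and a: "a \<in> cfg" for \<omega> a
  proof
    assume "edges m n (\<lambda>g. A g \<omega>) = a"
    thus "\<omega> \<in> S a"
      using A01[OF _ \<omega>] \<omega> by (auto simp: S_def edges_def I_def)
  next
    assume *: "\<omega> \<in> S a"
    show "edges m n (\<lambda>g. A g \<omega>) = a"
    proof
      fix e :: "nat \<times> nat \<times> nat"
      obtain g i j where e: "e = (g, i, j)" by (cases e)
      show "edges m n (\<lambda>g. A g \<omega>) e = a e"
      proof (cases "e \<in> I")
        case True
        hence "A g \<omega> $$ (i, j) = of_bool (a e)" using * e by (auto simp: S_def)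
        thus ?thesis using True e by (simp add: edges_def I_def)
      next
        case False
        thus ?thesis using a e by (auto simp: cfg_def PiE_dflt_def edges_def I_def)
      qed
    qed
  qed
  \<comment> \<open>There are finitely many configurations. Once the configuration is fixed to be
    \<open>a\<close>, the remaining condition \<open>TT a\<close> depends on the latent positions
    only and can be pulled through the conditional expectation.\<close>
  have eq: "{\<omega> \<in> space M. T (edges m n (\<lambda>g. A g \<omega>)) \<omega>} = (\<Union>a\<in>cfg. S a \<inter> TT a)"
  proof -
    have "S a \<subseteq> space M" for a by (auto simp: S_def)
    thus ?thesis using S_iff in_cfg unfolding TT_def by blast
  qed
  show "{\<omega> \<in> space M. T (edges m n (\<lambda>g. A g \<omega>)) \<omega>} \<in> sets M"
    unfolding eq using fcfg TT S by auto
  let ?ce = "\<lambda>a. real_cond_exp M (latent_algebra M n X) (indicator (S a))"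
  have int_ce: "integrable M (\<lambda>\<omega>. indicator (TT a) \<omega> * ?ce a \<omega>)" for a
    using TT by (intro integrable_mult_indicator[of _ M "?ce a", simplified real_scaleR_def] real_cond_exp_int int_S) auto
  have "measure M (\<Union>a\<in>cfg. S a \<inter> TT a) \<le> (\<Sum>a\<in>cfg. measure M (S a \<inter> TT a))"
    using fcfg TT by (intro measure_UNION_le) auto
  also have "\<dots> = (\<Sum>a\<in>cfg. \<integral>\<omega>. indicator (TT a) \<omega> * ?ce a \<omega> \<partial>M)"
  proof (rule sum.cong[OF refl])
    fix a
    have "measure M (S a \<inter> TT a) = (\<integral>\<omega>. indicator (TT a) \<omega> * indicator (S a) \<omega> \<partial>M)"
    proof -
      have "(\<lambda>\<omega>. indicator (TT a) \<omega> * indicator (S a) \<omega> :: real) = indicator (S a \<inter> TT a)"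
        by (auto simp: indicator_def fun_eq_iff)
      thus ?thesis using TT by simp
    qed
    \<comment> \<open>The defining property of conditional expectation, applicable because
      \<open>TT a\<close> belongs to the latent algebra.\<close>
    also have "\<dots> = (\<integral>\<omega>. indicator (TT a) \<omega> * ?ce a \<omega> \<partial>M)"
      using real_cond_exp_intA[of "indicator (S a)" "TT a"] TT int_S[of a]
      unfolding set_lebesgue_integral_def by simp
    finally show "measure M (S a \<inter> TT a) = \<dots>" .
  qed
  also have "\<dots> = (\<integral>\<omega>. (\<Sum>a\<in>cfg. indicator (TT a) \<omega> * ?ce a \<omega>) \<partial>M)"
    using int_ce by (intro Bochner_Integration.integral_sum[symmetric]) auto
  also have "\<dots> \<le> (\<integral>\<omega>. \<epsilon> \<partial>M)"
  proof (rule integral_mono_AE)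
    have "AE \<omega> in M. \<forall>a\<in>cfg. ?ce a \<omega> = (\<Prod>(g, i, j)\<in>I. pmf (bernoulli_pmf (X i \<omega> \<bullet> (C g *v X j \<omega>))) (a (g, i, j)))"
      using ce fcfg by (intro AE_finite_allI) auto
    thus "AE \<omega> in M. (\<Sum>a\<in>cfg. indicator (TT a) \<omega> * ?ce a \<omega>) \<le> \<epsilon>"
      using AE_le AE_space
    proof eventually_elim
      case (elim \<omega>)
      define P where "P = Pi_pmf I False (\<lambda>(g, i, j). bernoulli_pmf (X i \<omega> \<bullet> (C g *v X j \<omega>)))"
      have "?ce a \<omega> = pmf P a" if a: "a \<in> cfg" for a
      proof -
        have "pmf P a = (\<Prod>e\<in>I. pmf (case e of (g, i, j) \<Rightarrow> bernoulli_pmf (X i \<omega> \<bullet> (C g *v X j \<omega>))) (a e))"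
          unfolding P_def by (rule pmf_Pi'[OF fI]) (use a in \<open>auto simp: cfg_def PiE_dflt_def\<close>)
        also have "\<dots> = ?ce a \<omega>" using elim(1) a by (auto simp: case_prod_beta intro!: prod.cong)
        finally show ?thesis by simp
      qed
      hence "(\<Sum>a\<in>cfg. indicator (TT a) \<omega> * ?ce a \<omega>) = (\<Sum>a\<in>cfg. indicator (TT a) \<omega> * pmf P a)"
        by (intro sum.cong) auto
      also have "\<dots> = (\<Sum>a\<in>{a \<in> cfg. T a \<omega>}. pmf P a)"
      proof -
        have "(\<Sum>a\<in>cfg. indicator (TT a) \<omega> * pmf P a) = (\<Sum>a\<in>cfg. if T a \<omega> then pmf P a else 0)"
          using elim(3) by (intro sum.cong) (auto simp: TT_def)
        thus ?thesis using fcfg by (simp add: sum.inter_filter)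
      qed
      also have "\<dots> = measure_pmf.prob P {a \<in> cfg. T a \<omega>}"
        using fcfg by (simp add: measure_measure_pmf_finite)
      also have "\<dots> \<le> measure_pmf.prob P {a. T a \<omega>}" by (intro measure_pmf.finite_measure_mono) auto
      also have "\<dots> \<le> \<epsilon>" using elim(2) by (simp add: P_def I_def)
      finally show ?case .
    qed
  qed (use int_ce in auto)
  finally show "measure M {\<omega> \<in> space M. T (edges m n (\<lambda>g. A g \<omega>)) \<omega>} \<le> \<epsilon>"
    unfolding eq by (simp add: prob_space)
qed

section \<open>Discretizing the test vectors of a bilinear form\<close>

text \<open>A net for the unit ball. The integer vectors are extensional to keep the set finite. Its
  cardinality is an exponential of order n ln n, more than that of an optimal net, but a tail
  exponent of order n (ln (n m))^2 outweighs it.\<close>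

definition grid :: "nat \<Rightarrow> (nat \<Rightarrow> real) set" where
  "grid n = (\<lambda>k i. real_of_int (k i) / real n) ` ({..<n} \<rightarrow>\<^sub>E {- int n..int n})"

lemma finite_grid: "finite (grid n)"
  by (simp add: grid_def finite_PiE)

lemma card_grid: "card (grid n) \<le> (2 * n + 1) ^ n"
proof -
  have "card (grid n) \<le> card ({..<n} \<rightarrow>\<^sub>E {- int n..int n})"
    unfolding grid_def by (intro card_image_le finite_PiE) auto
  also have "\<dots> = (2 * n + 1) ^ n"
  proof -
    have "card {- int n..int n} = 2 * n + 1" unfolding card_atLeastAtMost_int by arith
    thus ?thesis by (simp only: card_PiE finite_lessThan prod_constant card_lessThan)
  qed
  finally show ?thesis .
qed

lemma grid_approx:
  assumes n: "n \<ge> 1" and y: "\<And>i. i < n \<Longrightarrow> \<bar>y i\<bar> \<le> 1"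
  obtains y' where "y' \<in> grid n" "\<And>i. i < n \<Longrightarrow> \<bar>y i - y' i\<bar> \<le> 1 / real n"
proof -
  define k where "k = (\<lambda>i\<in>{..<n}. \<lfloor>real n * y i\<rfloor>)"
  have n0: "real n > 0" using n by simp
  have "k i \<in> {- int n..int n}" if "i < n" for i
  proof -
    have "real n * \<bar>y i\<bar> \<le> real n * 1" using y[OF that] by (intro mult_left_mono) auto
    hence "\<bar>real n * y i\<bar> \<le> real n" by (simp add: abs_mult)
    hence "- real n \<le> real n * y i" "real n * y i < real n + 1" by linarith+
    thus ?thesis using that by (simp add: k_def le_floor_iff floor_le_iff)
  qed
  hence "k \<in> {..<n} \<rightarrow>\<^sub>E {- int n..int n}" by (auto simp: k_def)
  moreover have "\<bar>y i - real_of_int (k i) / real n\<bar> \<le> 1 / real n" if "i < n" for i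
  proof -
    have "\<bar>real n * y i - real_of_int (k i)\<bar> \<le> 1" using that by (simp add: k_def) linarith
    moreover have "y i - real_of_int (k i) / real n = (real n * y i - real_of_int (k i)) / real n"
      using n0 by (simp add: field_simps)
    ultimately show ?thesis using n0 by (simp add: divide_right_mono)
  qed
  ultimately show ?thesis using that[of "\<lambda>i. real_of_int (k i) / real n"] unfolding grid_def by blast
qed

text \<open>Since the entries of \<open>e\<close> are at most \<open>1\<close>, the trivial bound \<open>n\<close> on its norm is good enough to
  control the error of rounding to a grid of width \<open>1 / n\<close>.\<close>

lemma bilinear_le_of_grid:
  fixes e :: "nat \<Rightarrow> nat \<Rightarrow> real"
  assumes n: "n \<ge> 1" and e1: "\<And>i j. \<lbrakk>i < n; j < n\<rbrakk> \<Longrightarrow> \<bar>e i j\<bar> \<le> 1"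
    and grid: "\<And>y w. \<lbrakk>y \<in> grid n; w \<in> grid n; L2_set y {..<n} \<le> 2; L2_set w {..<n} \<le> 2\<rbrakk> \<Longrightarrow>
      \<bar>\<Sum>i<n. y i * (\<Sum>j<n. e i j * w j)\<bar> \<le> \<theta>"
  shows "\<bar>\<Sum>i<n. y i * (\<Sum>j<n. e i j * w j)\<bar> \<le> (\<theta> + 3 * sqrt (real n)) * L2_set y {..<n} * L2_set w {..<n}"
proof -
  define b where "b y w = (\<Sum>i<n. y i * (\<Sum>j<n. e i j * w j))" for y w
  have b_diff: "b (\<lambda>i. y i - y' i) w = b y w - b y' w" "b y (\<lambda>i. w i - w' i) = b y w - b y w'" for y y' w w'
    by (simp_all add: b_def algebra_simps sum_subtractf)
  have sn: "sqrt (real n) > 0" "sqrt (real n) * sqrt (real n) = real n" using n by auto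
  have trivial: "\<bar>b y w\<bar> \<le> real n * L2_set y {..<n} * L2_set w {..<n}" for y w
  proof -
    have "\<bar>\<Sum>j<n. e i j * w j\<bar> \<le> sqrt (real n) * L2_set w {..<n}" if "i < n" for i
    proof -
      have "L2_set (e i) {..<n} \<le> sqrt (real n)"
        using L2_set_le_sqrt_card[of "{..<n}" "e i" 1] e1 that by simp
      thus ?thesis by (intro order.trans[OF sum_mult_le_L2_set] mult_right_mono) auto
    qed
    hence "L2_set (\<lambda>i. \<Sum>j<n. e i j * w j) {..<n} \<le> sqrt (real n) * (sqrt (real n) * L2_set w {..<n})"
      using L2_set_le_sqrt_card[of "{..<n}" "\<lambda>i. \<Sum>j<n. e i j * w j" "sqrt (real n) * L2_set w {..<n}"] by simp
    also have "\<dots> = real n * L2_set w {..<n}" using sn(2) by (simp only: mult.assoc[symmetric])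
    finally have "\<bar>b y w\<bar> \<le> L2_set y {..<n} * (real n * L2_set w {..<n})"
      unfolding b_def by (intro order.trans[OF sum_mult_le_L2_set] mult_left_mono) auto
    thus ?thesis by (simp add: mult_ac)
  qed
  have unit: "\<bar>b y w\<bar> \<le> \<theta> + 3 * sqrt (real n)"
    if y: "L2_set y {..<n} = 1" and w: "L2_set w {..<n} = 1" for y w
  proof -
    have approx: "\<exists>y'\<in>grid n. L2_set (\<lambda>i. y i - y' i) {..<n} \<le> 1 / sqrt (real n) \<and> L2_set y' {..<n} \<le> 2"
      if y: "L2_set y {..<n} = 1" for y
    proof -
      have "\<bar>y i\<bar> \<le> 1" if "i < n" for i
        using member_le_L2_set[of "{..<n}" i "\<lambda>i. \<bar>y i\<bar>"] that y by (simp add: L2_set_def)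
      then obtain y' where y': "y' \<in> grid n" "\<And>i. i < n \<Longrightarrow> \<bar>y i - y' i\<bar> \<le> 1 / real n"
        using grid_approx[OF n] by blast
      have "L2_set (\<lambda>i. y i - y' i) {..<n} \<le> sqrt (real n) * (1 / real n)"
        using L2_set_le_sqrt_card[of "{..<n}" "\<lambda>i. y i - y' i" "1 / real n"] y'(2) by simp
      also have "\<dots> = 1 / sqrt (real n)" using sn by (simp add: field_simps)
      finally have d: "L2_set (\<lambda>i. y i - y' i) {..<n} \<le> 1 / sqrt (real n)" .
      have "L2_set y' {..<n} = L2_set (\<lambda>i. y i + (- (y i - y' i))) {..<n}" by simp
      also have "\<dots> \<le> L2_set y {..<n} + L2_set (\<lambda>i. - (y i - y' i)) {..<n}" by (rule L2_set_triangle_ineq)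
      also have "L2_set (\<lambda>i. - (y i - y' i)) {..<n} = L2_set (\<lambda>i. y i - y' i) {..<n}"
        by (simp add: L2_set_def power2_commute)
      finally have "L2_set y' {..<n} \<le> L2_set y {..<n} + L2_set (\<lambda>i. y i - y' i) {..<n}" .
      moreover have "1 / sqrt (real n) \<le> 1" using n by simp
      ultimately have "L2_set y' {..<n} \<le> 2" using d y by linarith
      thus ?thesis using y' d by (intro bexI[of _ y']) auto
    qed
    obtain y' where y': "y' \<in> grid n" "L2_set (\<lambda>i. y i - y' i) {..<n} \<le> 1 / sqrt (real n)" "L2_set y' {..<n} \<le> 2"
      using approx[OF y] by blast
    obtain w' where w': "w' \<in> grid n" "L2_set (\<lambda>i. w i - w' i) {..<n} \<le> 1 / sqrt (real n)" "L2_set w' {..<n} \<le> 2"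
      using approx[OF w] by blast
    have ns: "real n * (1 / sqrt (real n)) = sqrt (real n)"
      using sn by (simp add: field_simps)
    \<comment> \<open>Rounding one argument at a time costs 2 sqrt n and then sqrt n, whence the 3
      sqrt n of the statement; the 2 is the norm bound of the rounded vector.\<close>
    have "b y w = b y' w' + b (\<lambda>i. y i - y' i) w' + b y (\<lambda>i. w i - w' i)" by (simp add: b_diff)
    moreover have "\<bar>b y' w'\<bar> \<le> \<theta>" unfolding b_def using grid y' w' by blast
    moreover have "\<bar>b (\<lambda>i. y i - y' i) w'\<bar> \<le> real n * (1 / sqrt (real n)) * 2"
      by (rule order.trans[OF trivial]) (use y' w' in \<open>intro mult_mono, auto\<close>)
    moreover have "\<bar>b y (\<lambda>i. w i - w' i)\<bar> \<le> real n * 1 * (1 / sqrt (real n))"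
      by (rule order.trans[OF trivial]) (use y w' in \<open>intro mult_mono, auto\<close>)
    ultimately show ?thesis using ns by simp
  qed
  show ?thesis
  proof (cases "L2_set y {..<n} = 0 \<or> L2_set w {..<n} = 0")
    case True
    thus ?thesis using trivial[of y w] unfolding b_def by auto
  next
    case False
    define s t where "s = L2_set y {..<n}" and "t = L2_set w {..<n}"
    have st: "s > 0" "t > 0" using False by (auto simp: s_def t_def less_le)
    have "L2_set (\<lambda>i. 1 / s * y i) {..<n} = 1" "L2_set (\<lambda>i. 1 / t * w i) {..<n} = 1"
      using st L2_set_right_distrib[of "1 / s" y "{..<n}"] L2_set_right_distrib[of "1 / t" w "{..<n}"]
      by (auto simp: s_def t_def)
    from unit[OF this] have "\<bar>b (\<lambda>i. 1 / s * y i) (\<lambda>i. 1 / t * w i)\<bar> \<le> \<theta> + 3 * sqrt (real n)" .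
    moreover have "b (\<lambda>i. 1 / s * y i) (\<lambda>i. 1 / t * w i) = b y w / (s * t)"
      by (simp add: b_def sum_divide_distrib[symmetric] mult_ac)
    ultimately have "\<bar>b y w\<bar> / (s * t) \<le> \<theta> + 3 * sqrt (real n)"
      using st by simp
    hence "\<bar>b y w\<bar> \<le> (\<theta> + 3 * sqrt (real n)) * (s * t)"
      using st by (simp only: pos_divide_le_eq mult_pos_pos)
    thus ?thesis by (simp add: b_def s_def t_def mult.assoc)
  qed
qed

lemma sum_square_triangle:
  fixes f :: "nat \<Rightarrow> nat \<Rightarrow> 'a::comm_monoid_add"
  shows "(\<Sum>i<n. \<Sum>j<n. f i j) = (\<Sum>j<n. \<Sum>i<j. f i j + f j i) + (\<Sum>i<n. f i i)"
  by (induction n) (auto simp: sum.distrib algebra_simps)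

lemma sum_edge_indices:
  fixes h :: "nat \<Rightarrow> nat \<Rightarrow> real"
  assumes "g < m"
  shows "(\<Sum>(g', i, j)\<in>edge_indices m n. if g' = g then h i j else 0) = (\<Sum>j<n. \<Sum>i<j. h i j)"
proof -
  have "(\<Sum>(g', i, j)\<in>edge_indices m n. if g' = g then h i j else 0)
      = (\<Sum>(g', i, j)\<in>(\<lambda>(j, i). (g, i, j)) ` (SIGMA j:{..<n}. {..<j}). if g' = g then h i j else 0)"
  proof (rule sum.mono_neutral_right)
    show "finite (edge_indices m n)" by simp
  qed (use assms in \<open>auto simp: edge_indices_def image_iff\<close>)
  also have "\<dots> = (\<Sum>(j, i)\<in>(SIGMA j:{..<n}. {..<j}). h i j)"
    by (subst sum.reindex) (auto simp: inj_on_def intro!: sum.cong)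
  also have "\<dots> = (\<Sum>j<n. \<Sum>i<j. h i j)" by (subst sum.Sigma) auto
  finally show ?thesis .
qed

text \<open>Only the entries above the diagonal are independent, so the form is rewritten in terms
  of them, with the diagonal kept apart.\<close>

lemma bilinear_triangle:
  fixes e :: "nat \<Rightarrow> nat \<Rightarrow> real"
  assumes sym: "\<And>i j. \<lbrakk>i < n; j < n\<rbrakk> \<Longrightarrow> e i j = e j i"
  shows "(\<Sum>i<n. y i * (\<Sum>j<n. e i j * w j)) = (\<Sum>j<n. \<Sum>i<j. (y i * w j + y j * w i) * e i j) + (\<Sum>i<n. y i * w i * e i i)"
proof -
  have "(\<Sum>i<n. y i * (\<Sum>j<n. e i j * w j)) = (\<Sum>i<n. \<Sum>j<n. y i * e i j * w j)"
    by (simp add: sum_distrib_left mult.assoc)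
  also have "\<dots> = (\<Sum>j<n. \<Sum>i<j. y i * e i j * w j + y j * e j i * w i) + (\<Sum>i<n. y i * e i i * w i)"
    by (rule sum_square_triangle)
  also have "(\<Sum>j<n. \<Sum>i<j. y i * e i j * w j + y j * e j i * w i) = (\<Sum>j<n. \<Sum>i<j. (y i * w j + y j * w i) * e i j)"
  proof (intro sum.cong refl)
    fix j i assume "j \<in> {..<n}" "i \<in> {..<j}"
    hence "e j i = e i j" using sym[of i j] by simp
    thus "y i * e i j * w j + y j * e j i * w i = (y i * w j + y j * w i) * e i j" by (simp add: algebra_simps)
  qed
  finally show ?thesis by (simp add: mult_ac)
qed

text \<open>The sum of squared weights that enters the Hoeffding exponent. After (a + b)^2 \<le> 2
  a^2 + 2 b^2, adding the diagonal completes the triangle to a full product sum.\<close>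

lemma triangle_weights_le:
  fixes y w :: "nat \<Rightarrow> real"
  shows "(\<Sum>j<n. \<Sum>i<j. (y i * w j + y j * w i)\<^sup>2) \<le> 2 * (L2_set y {..<n})\<^sup>2 * (L2_set w {..<n})\<^sup>2"
proof -
  have "(\<Sum>j<n. \<Sum>i<j. (y i * w j + y j * w i)\<^sup>2) \<le> (\<Sum>j<n. \<Sum>i<j. 2 * ((y i * w j)\<^sup>2) + 2 * ((y j * w i)\<^sup>2))"
  proof (intro sum_mono)
    fix i j
    have "0 \<le> (y i * w j - y j * w i)\<^sup>2" by simp
    thus "(y i * w j + y j * w i)\<^sup>2 \<le> 2 * ((y i * w j)\<^sup>2) + 2 * ((y j * w i)\<^sup>2)"
      by (simp add: power2_eq_square algebra_simps)
  qed
  also have "\<dots> \<le> (\<Sum>j<n. \<Sum>i<j. 2 * ((y i * w j)\<^sup>2) + 2 * ((y j * w i)\<^sup>2)) + (\<Sum>i<n. 2 * ((y i * w i)\<^sup>2))"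
    by (simp add: sum_nonneg)
  also have "\<dots> = (\<Sum>i<n. \<Sum>j<n. 2 * ((y i * w j)\<^sup>2))"
    by (rule sum_square_triangle[symmetric])
  also have "\<dots> = 2 * ((\<Sum>i<n. (y i)\<^sup>2) * (\<Sum>j<n. (w j)\<^sup>2))"
    unfolding sum_product by (simp add: power_mult_distrib flip: sum_distrib_left)
  also have "\<dots> = 2 * (L2_set y {..<n})\<^sup>2 * (L2_set w {..<n})\<^sup>2"
    by (simp add: L2_set_def sum_nonneg)
  finally show ?thesis .
qed

lemma inner_diagonal_matrix:
  assumes "diagonal_matrix D"
  shows "x \<bullet> (D *v y) = (\<Sum>k\<in>UNIV. x $ k * D $ k $ k * y $ k)"
proof -
  have "(\<Sum>j\<in>UNIV. D $ k $ j * y $ j) = D $ k $ k * y $ k" for k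
  proof -
    have "(\<Sum>j\<in>UNIV. D $ k $ j * y $ j) = (\<Sum>j\<in>UNIV. if j = k then D $ k $ k * y $ k else 0)"
      using assms by (intro sum.cong) (auto simp: diagonal_matrix_def)
    thus ?thesis by simp
  qed
  thus ?thesis by (simp add: inner_vec_def matrix_vector_mult_def mult.assoc)
qed

lemma borel_measurable_vec_nth' [measurable (raw)]:
  fixes f :: "'a \<Rightarrow> real ^ 'd"
  shows "f \<in> borel_measurable M \<Longrightarrow> (\<lambda>x. f x $ i) \<in> borel_measurable M"
  by (rule measurable_compose[OF _ borel_measurable_continuous_onI]) (auto intro: continuous_intros)

lemma borel_measurable_inner_matrix [measurable (raw)]:
  fixes f g :: "'a \<Rightarrow> real ^ 'd"
  assumes [measurable]: "f \<in> borel_measurable M" "g \<in> borel_measurable M"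
  shows "(\<lambda>x. f x \<bullet> (D *v g x)) \<in> borel_measurable M"
  unfolding inner_vec_def matrix_vector_mult_def by simp

section \<open>Tail bounds for the noise and the Gram matrix\<close>

locale esrdpg =
  fixes F :: "(real ^ 'd) measure" and n m :: nat and C :: "nat \<Rightarrow> real ^ 'd ^ 'd"
    and M :: "'w measure" and A :: "nat \<Rightarrow> 'w \<Rightarrow> real mat" and X :: "nat \<Rightarrow> 'w \<Rightarrow> real ^ 'd"
  assumes model: "ESRDPG F n m C M A X" and n: "n \<ge> 1"
begin

lemma F: "inner_product_distribution F" "prob_space F" "sets F = sets borel"
  and C: "\<And>g. g < m \<Longrightarrow> C g \<in> diagonal_weighting_space F"
  and X [measurable]: "\<And>i. i < n \<Longrightarrow> X i \<in> borel_measurable M"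
  and distr_X: "\<And>i. i < n \<Longrightarrow> distr M borel (X i) = F"
  and adjacency: "\<And>g \<omega>. g < m \<Longrightarrow> \<omega> \<in> space M \<Longrightarrow> adjacency_matrix n (A g \<omega>)"
  and A [measurable]: "\<And>g i j. g < m \<Longrightarrow> i < n \<Longrightarrow> j < n \<Longrightarrow> (\<lambda>\<omega>. A g \<omega> $$ (i, j)) \<in> borel_measurable M"
  using model unfolding ESRDPG_def inner_product_distribution_def by blast+

lemma indep_X: "prob_space.indep_vars M (\<lambda>_. borel) X {..<n}"
  using model unfolding ESRDPG_def by blast

sublocale prob_space M
  using model unfolding ESRDPG_def by blast

lemma AE_X_support: "AE \<omega> in M. \<forall>i\<in>{..<n}. X i \<omega> \<in> support F"
proof (rule AE_finite_allI)
  fix i assume i: "i \<in> {..<n}"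
  have "AE x in F. x \<in> support F" by (rule AE_support[OF F(3)])
  hence "AE x in distr M borel (X i). x \<in> support F" by (subst distr_X) (use i in auto)
  thus "AE \<omega> in M. X i \<omega> \<in> support F"
    by (rule AE_distrD[rotated]) (use i X in auto)
qed simp

lemma norm_support: "x \<in> support F \<Longrightarrow> norm x \<le> 1"
  using F(1) unfolding inner_product_distribution_def by (auto simp: norm_eq_sqrt_inner)

lemma edge_prob_support:
  "\<lbrakk>g < m; x \<in> support F; y \<in> support F\<rbrakk> \<Longrightarrow> x \<bullet> (C g *v y) \<in> {0..1}"
  using C unfolding diagonal_weighting_space_def by blast

lemma diagonal_C: "g < m \<Longrightarrow> diagonal_matrix (C g)"
  using C unfolding diagonal_weighting_space_def by blast

lemma adjacency_entry: "\<lbrakk>g < m; \<omega> \<in> space M; i < n; j < n\<rbrakk> \<Longrightarrow> A g \<omega> $$ (i, j) \<in> {0, 1}"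
  using adjacency[of g \<omega>] unfolding adjacency_matrix_def by blast

lemma adjacency_sym: "\<lbrakk>g < m; \<omega> \<in> space M; i < n; j < n\<rbrakk> \<Longrightarrow> A g \<omega> $$ (i, j) = A g \<omega> $$ (j, i)"
  using adjacency[of g \<omega>] unfolding adjacency_matrix_def by (metis carrier_matD index_transpose_mat(1))

definition noise :: "'w \<Rightarrow> nat \<Rightarrow> nat \<Rightarrow> nat \<Rightarrow> real" where
  "noise \<omega> g i j = A g \<omega> $$ (i, j) - X i \<omega> \<bullet> (C g *v X j \<omega>)"

lemma noise_measurable [measurable]:
  "\<lbrakk>g < m; i < n; j < n\<rbrakk> \<Longrightarrow> (\<lambda>\<omega>. noise \<omega> g i j) \<in> borel_measurable M"
  unfolding noise_def by measurable

lemma noise_le_1: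
  assumes "g < m" "i < n" "j < n" "\<omega> \<in> space M" "\<forall>i\<in>{..<n}. X i \<omega> \<in> support F"
  shows "\<bar>noise \<omega> g i j\<bar> \<le> 1"
  using adjacency_entry[OF assms(1,4,2,3)] edge_prob_support[OF assms(1), of "X i \<omega>" "X j \<omega>"] assms
  unfolding noise_def by auto

lemma noise_sym:
  assumes "g < m" "i < n" "j < n" "\<omega> \<in> space M"
  shows "noise \<omega> g i j = noise \<omega> g j i"
  using adjacency_sym[OF assms(1,4,2,3)] unfolding noise_def inner_diagonal_matrix[OF diagonal_C[OF assms(1)]]
  by (simp add: mult_ac)

definition bilinear :: "'w \<Rightarrow> nat \<Rightarrow> (nat \<Rightarrow> real) \<Rightarrow> (nat \<Rightarrow> real) \<Rightarrow> real" where
  "bilinear \<omega> g y w = (\<Sum>i<n. y i * (\<Sum>j<n. noise \<omega> g i j * w j))"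

text \<open>The test vectors may depend on the latent positions, because the rows of E Z are tested
  against columns of X. The product of norms added to \<theta> pays for the diagonal, where the
  noise is minus the entry of P and not random given X.\<close>

lemma bilinear_prob:
  fixes y w :: "'w \<Rightarrow> nat \<Rightarrow> real"
  assumes g: "g < m" and \<theta>: "0 \<le> \<theta>"
    and y: "\<And>i. i < n \<Longrightarrow> (\<lambda>\<omega>. y \<omega> i) \<in> borel_measurable (latent_algebra M n X)"
    and w: "\<And>i. i < n \<Longrightarrow> (\<lambda>\<omega>. w \<omega> i) \<in> borel_measurable (latent_algebra M n X)"
    and V: "AE \<omega> in M. 2 * (L2_set (y \<omega>) {..<n})\<^sup>2 * (L2_set (w \<omega>) {..<n})\<^sup>2 \<le> V"
  shows "{\<omega> \<in> space M. \<theta> + L2_set (y \<omega>) {..<n} * L2_set (w \<omega>) {..<n} < \<bar>bilinear \<omega> g (y \<omega>) (w \<omega>)\<bar>} \<in> sets M"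
    (is "?B \<in> _")
    and "prob {\<omega> \<in> space M. \<theta> + L2_set (y \<omega>) {..<n} * L2_set (w \<omega>) {..<n} < \<bar>bilinear \<omega> g (y \<omega>) (w \<omega>)\<bar>}
      \<le> 2 * exp (- 2 * \<theta>\<^sup>2 / V)"
proof -
  let ?L = "latent_algebra M n X"
  have sub: "subalgebra M ?L" by (rule subalgebra_latent_algebra[OF X])
  have [measurable]: "i < n \<Longrightarrow> (\<lambda>\<omega>. y \<omega> i) \<in> borel_measurable M" "i < n \<Longrightarrow> (\<lambda>\<omega>. w \<omega> i) \<in> borel_measurable M" for i
    using y w measurable_from_subalg[OF sub] by auto
  show B: "?B \<in> sets M"
    unfolding bilinear_def L2_set_def using g by measurable
  define I where "I = edge_indices m n"
  \<comment> \<open>The coefficients of the independent entries; those of the other graphs are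
    zero.\<close>
  define W where "W = (\<lambda>\<omega> (g', i, j). if g' = g then y \<omega> i * w \<omega> j + y \<omega> j * w \<omega> i else 0)"
  define p where "p = (\<lambda>\<omega> (g', i, j). X i \<omega> \<bullet> (C g' *v X j \<omega>))"
  define T where "T = (\<lambda>a \<omega>. \<theta> < \<bar>\<Sum>e\<in>I. W \<omega> e * (of_bool (a e) - p \<omega> e)\<bar>)"
  have Tm: "{\<omega> \<in> space M. T a \<omega>} \<in> sets ?L" for a
  proof -
    have X' [measurable]: "i < n \<Longrightarrow> X i \<in> borel_measurable ?L" for i by (rule measurable_latent_algebra)
    have m1: "(\<lambda>\<omega>. W \<omega> e * (of_bool (a e) - p \<omega> e)) \<in> borel_measurable ?L" if e: "e \<in> I" for e
    proof -
      obtain g' i j where e': "e = (g', i, j)" by (cases e)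
      hence [measurable]: "i < n" "j < n" using e by (auto simp: I_def edge_indices_def)
      note [measurable] = y[OF \<open>i < n\<close>] y[OF \<open>j < n\<close>] w[OF \<open>i < n\<close>] w[OF \<open>j < n\<close>] X'[OF \<open>i < n\<close>] X'[OF \<open>j < n\<close>]
      show ?thesis
        unfolding e' W_def p_def prod.case by measurable
    qed
    have "{\<omega> \<in> space ?L. T a \<omega>} \<in> sets ?L"
      unfolding T_def using m1 by measurable
    thus ?thesis using sub by (simp add: subalgebra_def)
  qed
  have AE_T: "AE \<omega> in M. measure_pmf.prob (Pi_pmf (edge_indices m n) False
        (\<lambda>(g, i, j). bernoulli_pmf (X i \<omega> \<bullet> (C g *v X j \<omega>)))) {a. T a \<omega>} \<le> 2 * exp (- 2 * \<theta>\<^sup>2 / V)"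
    using V AE_X_support
  proof eventually_elim
    case (elim \<omega>)
    have "measure_pmf.prob (Pi_pmf I False (\<lambda>e. bernoulli_pmf (p \<omega> e)))
       {a. \<theta> < \<bar>\<Sum>e\<in>I. W \<omega> e * (of_bool (a e) - p \<omega> e)\<bar>} \<le> 2 * exp (- 2 * \<theta>\<^sup>2 / V)"
    proof (rule bernoulli_Hoeffding)
      fix e assume e: "e \<in> I"
      obtain g' i j where e': "e = (g', i, j)" by (cases e)
      have "g' < m" "i < n" "j < n" using e e' by (auto simp: I_def edge_indices_def)
      thus "p \<omega> e \<in> {0..1}" using elim(2) edge_prob_support[of g' "X i \<omega>" "X j \<omega>"] by (simp add: p_def e')
    next
      have "(\<Sum>e\<in>I. (W \<omega> e)\<^sup>2) = (\<Sum>(g', i, j)\<in>I. if g' = g then (y \<omega> i * w \<omega> j + y \<omega> j * w \<omega> i)\<^sup>2 else 0)"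
        by (intro sum.cong) (auto simp: W_def)
      also have "\<dots> \<le> 2 * (L2_set (y \<omega>) {..<n})\<^sup>2 * (L2_set (w \<omega>) {..<n})\<^sup>2"
        unfolding I_def sum_edge_indices[OF g] by (rule triangle_weights_le)
      finally show "(\<Sum>e\<in>I. (W \<omega> e)\<^sup>2) \<le> V" using elim(1) by linarith
    qed (use \<theta> in \<open>auto simp: I_def\<close>)
    moreover have "(\<lambda>(g, i, j). bernoulli_pmf (X i \<omega> \<bullet> (C g *v X j \<omega>))) = (\<lambda>e. bernoulli_pmf (p \<omega> e))"
      by (auto simp: p_def fun_eq_iff)
    ultimately show ?case by (simp add: T_def I_def)
  qed
  note TT = ESRDPG_prob_le[OF model, of T, OF Tm AE_T]
  have "prob ?B \<le> prob {\<omega> \<in> space M. T (edges m n (\<lambda>g. A g \<omega>)) \<omega>}"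
  proof (rule finite_measure_mono_AE[OF _ TT(1)])
    show "AE \<omega> in M. \<omega> \<in> ?B \<longrightarrow> \<omega> \<in> {\<omega> \<in> space M. T (edges m n (\<lambda>g. A g \<omega>)) \<omega>}"
      using AE_X_support AE_space
    proof eventually_elim
      case (elim \<omega>)
      have edge: "of_bool (edges m n (\<lambda>g. A g \<omega>) (g', i, j)) = A g' \<omega> $$ (i, j)" if "(g', i, j) \<in> I" for g' i j
        using that adjacency_entry[of g' \<omega> i j] elim(2) by (auto simp: edges_def I_def edge_indices_def)
      have "(\<Sum>e\<in>I. W \<omega> e * (of_bool (edges m n (\<lambda>g. A g \<omega>) e) - p \<omega> e))
        = (\<Sum>(g', i, j)\<in>I. if g' = g then (y \<omega> i * w \<omega> j + y \<omega> j * w \<omega> i) * noise \<omega> g i j else 0)"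
      proof (rule sum.cong[OF refl], clarify)
        fix g' i j assume e: "(g', i, j) \<in> I"
        show "W \<omega> (g', i, j) * (of_bool (edges m n (\<lambda>g. A g \<omega>) (g', i, j)) - p \<omega> (g', i, j))
          = (if g' = g then (y \<omega> i * w \<omega> j + y \<omega> j * w \<omega> i) * noise \<omega> g i j else 0)"
          unfolding edge[OF e] by (simp add: W_def p_def noise_def)
      qed
      also have "\<dots> = (\<Sum>j<n. \<Sum>i<j. (y \<omega> i * w \<omega> j + y \<omega> j * w \<omega> i) * noise \<omega> g i j)"
        unfolding I_def by (rule sum_edge_indices[OF g])
      finally have "bilinear \<omega> g (y \<omega>) (w \<omega>) = (\<Sum>e\<in>I. W \<omega> e * (of_bool (edges m n (\<lambda>g. A g \<omega>) e) - p \<omega> e))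
         + (\<Sum>i<n. y \<omega> i * w \<omega> i * noise \<omega> g i i)"
        unfolding bilinear_def using bilinear_triangle[of n "noise \<omega> g"] noise_sym[OF g _ _ elim(2)] by simp
      moreover have "\<bar>\<Sum>i<n. y \<omega> i * w \<omega> i * noise \<omega> g i i\<bar> \<le> (\<Sum>i<n. \<bar>y \<omega> i\<bar> * \<bar>w \<omega> i\<bar>)"
      proof (rule abs_sum_le)
        fix i assume "i \<in> {..<n}"
        hence "\<bar>noise \<omega> g i i\<bar> \<le> 1" using noise_le_1[OF g] elim by auto
        thus "\<bar>y \<omega> i * w \<omega> i * noise \<omega> g i i\<bar> \<le> \<bar>y \<omega> i\<bar> * \<bar>w \<omega> i\<bar>"
          unfolding abs_mult by (intro mult_left_le) auto
      qed
      moreover have "(\<Sum>i<n. \<bar>y \<omega> i\<bar> * \<bar>w \<omega> i\<bar>) \<le> L2_set (y \<omega>) {..<n} * L2_set (w \<omega>) {..<n}"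
        by (rule L2_set_mult_ineq)
      ultimately show ?case using elim(2) by (auto simp: T_def)
    qed
  qed
  also have "\<dots> \<le> 2 * exp (- 2 * \<theta>\<^sup>2 / V)" by (rule TT(2))
  finally show "prob ?B \<le> 2 * exp (- 2 * \<theta>\<^sup>2 / V)" .
qed

definition gram :: "'w \<Rightarrow> 'd \<Rightarrow> 'd \<Rightarrow> real" where
  "gram \<omega> k l = (\<Sum>i<n. X i \<omega> $ k * X i \<omega> $ l)"

lemma gram_prob:
  assumes t: "0 \<le> t"
  shows "{\<omega> \<in> space M. t \<le> \<bar>gram \<omega> k l - real n * second_moment_matrix F $ k $ l\<bar>} \<in> sets M"
    and "prob {\<omega> \<in> space M. t \<le> \<bar>gram \<omega> k l - real n * second_moment_matrix F $ k $ l\<bar>} \<le> 2 * exp (- t\<^sup>2 / (2 * real n))"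
proof -
  show "{\<omega> \<in> space M. t \<le> \<bar>gram \<omega> k l - real n * second_moment_matrix F $ k $ l\<bar>} \<in> sets M"
    unfolding gram_def by measurable
  have indep: "indep_vars (\<lambda>_. borel) (\<lambda>i \<omega>. X i \<omega> $ k * X i \<omega> $ l) {..<n}"
    by (rule indep_vars_compose2[OF indep_X]) simp
  interpret H: Hoeffding_ineq M "{..<n}" "\<lambda>i \<omega>. X i \<omega> $ k * X i \<omega> $ l" "\<lambda>_. -1" "\<lambda>_. 1"
    "\<Sum>i<n. expectation (\<lambda>\<omega>. X i \<omega> $ k * X i \<omega> $ l)"
  proof unfold_locales
    fix i assume i: "i \<in> {..<n}"
    show "AE \<omega> in M. X i \<omega> $ k * X i \<omega> $ l \<in> {- 1..1}"
      using AE_X_support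
    proof eventually_elim
      case (elim \<omega>)
      hence "norm (X i \<omega>) \<le> 1" using i norm_support by auto
      hence "\<bar>X i \<omega> $ k\<bar> \<le> 1" "\<bar>X i \<omega> $ l\<bar> \<le> 1"
        using component_le_norm_cart[of "X i \<omega>" k] component_le_norm_cart[of "X i \<omega>" l] by linarith+
      hence "\<bar>X i \<omega> $ k\<bar> * \<bar>X i \<omega> $ l\<bar> \<le> 1 * 1" by (intro mult_mono) auto
      hence "\<bar>X i \<omega> $ k * X i \<omega> $ l\<bar> \<le> 1" by (simp add: abs_mult)
      thus ?case by (simp add: abs_le_iff)
    qed
  qed (use indep in auto)
  have ex: "expectation (\<lambda>\<omega>. X i \<omega> $ k * X i \<omega> $ l) = second_moment_matrix F $ k $ l" if i: "i \<in> {..<n}" for i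
  proof -
    have "second_moment_matrix F $ k $ l = (\<integral>y. y $ k * y $ l \<partial>distr M borel (X i))"
      using distr_X[of i] i by (simp add: second_moment_matrix_def)
    also have "\<dots> = expectation (\<lambda>\<omega>. X i \<omega> $ k * X i \<omega> $ l)"
      by (rule integral_distr) (use i in auto)
    finally show ?thesis by simp
  qed
  have mu: "(\<Sum>i<n. expectation (\<lambda>\<omega>. X i \<omega> $ k * X i \<omega> $ l)) = real n * second_moment_matrix F $ k $ l"
    using ex by simp
  \<comment> \<open>Products of two coordinates lie in [-1, 1], so each of the n summands
    contributes 2^2 to the Hoeffding denominator.\<close>
  have "prob {\<omega> \<in> space M. t \<le> \<bar>gram \<omega> k l - real n * second_moment_matrix F $ k $ l\<bar>}
      \<le> 2 * exp (- 2 * t\<^sup>2 / (real n * 4))"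
    using H.Hoeffding_ineq_abs_ge[OF t, unfolded mu] n unfolding gram_def by simp
  also have "- 2 * t\<^sup>2 / (real n * 4) = - t\<^sup>2 / (2 * real n)" by (simp add: field_simps)
  finally show "prob {\<omega> \<in> space M. t \<le> \<bar>gram \<omega> k l - real n * second_moment_matrix F $ k $ l\<bar>}
      \<le> 2 * exp (- t\<^sup>2 / (2 * real n))" .
qed

end

lemma filterlim_ln_mult_nat:
  assumes "m \<ge> (1::nat)"
  shows "filterlim (\<lambda>n. ln (real (n * m))) at_top sequentially"
proof -
  have "filterlim (\<lambda>n. real n * real m) at_top sequentially"
    using assms by (intro filterlim_at_top_mult_tendsto_pos[OF tendsto_const] filterlim_real_sequentially) auto
  thus ?thesis by (simp add: filterlim_compose[OF ln_at_top])
qed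

text \<open>The three terms are union bounds over pairs of grid vectors, rows of noise, and entries
  of the Gram matrix. With L = ln (n m) the target is exp (-2 L), and each term is at most a third
  of it, since every tail exponent is quadratic in L while the numbers of events contribute only
  linear terms.\<close>

lemma failure_probability_small:
  fixes d :: real
  assumes m: "m \<ge> (1::nat)" and d: "0 \<le> d"
  shows "\<forall>\<^sub>F n in sequentially.
    real m * (real ((2 * n + 1) ^ n))\<^sup>2 * (2 * exp (- ((ln (real (n * m)))\<^sup>2 * real n / 16)))
    + real m * real n * d * (2 * exp (- (ln (real (n * m)))\<^sup>2))
    + d\<^sup>2 * (2 * exp (- ((ln (real (n * m)))\<^sup>2 / 2))) \<le> 1 / (real (n * m))\<^sup>2"
proof -
  have lim: "filterlim (\<lambda>n. ln (real (n * m))) at_top sequentially"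
    by (rule filterlim_ln_mult_nat[OF m])
  \<comment> \<open>The left side is the coefficient of n in the exponent of the grid term: m is at
    most exp (n L) and the squared grid size at most exp (n (2 L + 4)). Once it is negative, n may
    be replaced by 1.\<close>
  have 1: "\<forall>\<^sub>F L :: real in at_top. 3 * L + 4 - L\<^sup>2 / 16 \<le> - (3 * L)"
    by real_asymp
  have 2: "\<forall>\<^sub>F L :: real in at_top. 2 * exp (- (3 * L)) \<le> exp (- (2 * L)) / (3 :: real)"
    by real_asymp
  have "((\<lambda>L::real. exp (3 * L - L\<^sup>2)) \<longlongrightarrow> 0) at_top" by real_asymp
  hence 3: "\<forall>\<^sub>F L :: real in at_top. exp (3 * L - L\<^sup>2) < 1 / (6 * (d + 1))"
    using d by (intro order_tendstoD) auto
  have "((\<lambda>L::real. exp (2 * L - L\<^sup>2 / 2)) \<longlongrightarrow> 0) at_top" by real_asymp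
  hence 4: "\<forall>\<^sub>F L :: real in at_top. exp (2 * L - L\<^sup>2 / 2) < 1 / (6 * (d\<^sup>2 + 1))"
    using d by (intro order_tendstoD) (auto intro!: divide_pos_pos add_nonneg_pos)
  have "\<forall>\<^sub>F L :: real in at_top. 0 \<le> L" by (rule eventually_ge_at_top)
  hence "\<forall>\<^sub>F L :: real in at_top. 0 \<le> L \<and> 3 * L + 4 - L\<^sup>2 / 16 \<le> - (3 * L) \<and> 2 * exp (- (3 * L)) \<le> exp (- (2 * L)) / 3
     \<and> exp (3 * L - L\<^sup>2) < 1 / (6 * (d + 1)) \<and> exp (2 * L - L\<^sup>2 / 2) < 1 / (6 * (d\<^sup>2 + 1))"
    by (intro eventually_conj 1 2 3 4)
  from eventually_compose_filterlim[OF this lim] eventually_ge_at_top[of 1]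
  show ?thesis
  proof eventually_elim
    case (elim n)
    define L where "L = ln (real (n * m))"
    have L: "0 \<le> L" "3 * L + 4 - L\<^sup>2 / 16 \<le> - (3 * L)" "2 * exp (- (3 * L)) \<le> exp (- (2 * L)) / 3"
      "exp (3 * L - L\<^sup>2) < 1 / (6 * (d + 1))" "exp (2 * L - L\<^sup>2 / 2) < 1 / (6 * (d\<^sup>2 + 1))"
      using elim(1) by (auto simp: L_def)
    have nm: "real n * real m = exp L" using elim(2) m by (simp add: L_def)
    have n1: "real n \<ge> 1" "real m \<ge> 1" using elim(2) m by auto
    have mL: "real m \<le> exp (real n * L)"
    proof -
      have "real m \<le> real n * real m" using n1 by simp
      also have "\<dots> = exp L" by (rule nm)
      also have "\<dots> \<le> exp (real n * L)" using n1 L(1) by (simp add: mult_le_cancel_right1)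
      finally show ?thesis .
    qed
    have nL: "real (2 * n + 1) \<le> exp (L + 2)"
    proof -
      have "real (2 * n + 1) \<le> 3 * real n" using elim(2) by simp
      also have "\<dots> \<le> exp 2 * (real n * real m)"
        using n1 exp_ge_add_one_self[of "2 :: real"] by (intro mult_mono) auto
      also have "\<dots> = exp (L + 2)" by (simp add: nm exp_add)
      finally show ?thesis .
    qed
    have sq: "(real ((2 * n + 1) ^ n))\<^sup>2 \<le> exp (real n * (2 * L + 4))"
    proof -
      have "(real ((2 * n + 1) ^ n))\<^sup>2 = real (2 * n + 1) ^ (2 * n)" by (simp add: power_mult mult.commute flip: power_mult)
      also have "\<dots> \<le> exp (L + 2) ^ (2 * n)" by (rule power_mono[OF nL]) simp
      also have "\<dots> = exp (real n * (2 * L + 4))" by (simp add: exp_of_nat_mult[symmetric] algebra_simps)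
      finally show ?thesis .
    qed
    have "real m * (real ((2 * n + 1) ^ n))\<^sup>2 * (2 * exp (- (L\<^sup>2 * real n / 16)))
        \<le> exp (real n * L) * exp (real n * (2 * L + 4)) * (2 * exp (- (L\<^sup>2 * real n / 16)))"
      using mL sq by (intro mult_mono) auto
    also have "\<dots> = 2 * exp (real n * (3 * L + 4 - L\<^sup>2 / 16))"
      by (simp add: algebra_simps flip: exp_add)
    also have "\<dots> \<le> 2 * exp (- (3 * L))"
    proof -
      have "real n * (3 * L + 4 - L\<^sup>2 / 16) \<le> real n * (- (3 * L))" using L(2) by (intro mult_left_mono) auto
      also have "\<dots> \<le> - (3 * L)" using n1 L(1) by (simp add: mult_le_cancel_right1)
      finally show ?thesis by simp
    qed
    also have "\<dots> \<le> exp (- (2 * L)) / 3" by (rule L(3))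
    finally have t1: "real m * (real ((2 * n + 1) ^ n))\<^sup>2 * (2 * exp (- (L\<^sup>2 * real n / 16))) \<le> exp (- (2 * L)) / 3" .
    have "real m * real n * d * (2 * exp (- L\<^sup>2)) = exp (- (2 * L)) * (2 * d * exp (3 * L - L\<^sup>2))"
    proof -
      have "real m * real n * d * (2 * exp (- L\<^sup>2)) = exp L * exp (- L\<^sup>2) * (2 * d)"
        unfolding nm[symmetric] by simp
      also have "exp L * exp (- L\<^sup>2) = exp (- (2 * L)) * exp (3 * L - L\<^sup>2)"
        by (simp flip: exp_add)
      finally show ?thesis by simp
    qed
    also have "\<dots> \<le> exp (- (2 * L)) * (1 / 3)"
    proof (intro mult_left_mono)
      have "2 * d * exp (3 * L - L\<^sup>2) \<le> 2 * d * (1 / (6 * (d + 1)))" using L(4) d by (intro mult_left_mono) auto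
      also have "\<dots> \<le> 1 / 3" using d by (simp add: field_simps)
      finally show "2 * d * exp (3 * L - L\<^sup>2) \<le> 1 / 3" .
    qed simp
    finally have t2: "real m * real n * d * (2 * exp (- L\<^sup>2)) \<le> exp (- (2 * L)) / 3" by simp
    have "d\<^sup>2 * (2 * exp (- (L\<^sup>2 / 2))) = exp (- (2 * L)) * (2 * d\<^sup>2 * exp (2 * L - L\<^sup>2 / 2))"
    proof -
      have "exp (- (L\<^sup>2 / 2)) = exp (- (2 * L)) * exp (2 * L - L\<^sup>2 / 2)" by (simp flip: exp_add)
      thus ?thesis by simp
    qed
    also have "\<dots> \<le> exp (- (2 * L)) * (1 / 3)"
    proof (intro mult_left_mono)
      have "2 * d\<^sup>2 * exp (2 * L - L\<^sup>2 / 2) \<le> 2 * d\<^sup>2 * (1 / (6 * (d\<^sup>2 + 1)))" using L(5) by (intro mult_left_mono) auto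
      also have "\<dots> \<le> 1 / 3" by (simp add: divide_simps add_nonneg_pos)
      finally show "2 * d\<^sup>2 * exp (2 * L - L\<^sup>2 / 2) \<le> 1 / 3" .
    qed simp
    finally have t3: "d\<^sup>2 * (2 * exp (- (L\<^sup>2 / 2))) \<le> exp (- (2 * L)) / 3" by simp
    have "1 / (real (n * m))\<^sup>2 = exp (- (2 * L))"
      using nm by (simp add: exp_minus inverse_eq_divide exp_double)
    thus ?case using t1 t2 t3 unfolding L_def[symmetric] by linarith
  qed
qed

context esrdpg
begin

text \<open>The bilinear bound concerns uncountably many vectors, so a measurable exceptional set
  \<open>N\<close> is built from the grid and the conclusions are stated outside it.
  \<open>N\<close> also contains a null set off which all positions lie in the support.\<close>

lemma good_event:
  assumes L: "1 \<le> L"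
  obtains N where "N \<in> sets M"
    "prob N \<le> real m * (real ((2 * n + 1) ^ n))\<^sup>2 * (2 * exp (- (L\<^sup>2 * real n / 16)))
      + real m * real n * real CARD('d) * (2 * exp (- L\<^sup>2)) + (real CARD('d))\<^sup>2 * (2 * exp (- (L\<^sup>2 / 2)))"
    "\<And>\<omega>. \<omega> \<in> space M - N \<Longrightarrow> \<forall>i\<in>{..<n}. X i \<omega> \<in> support F"
    "\<And>\<omega> k l. \<omega> \<in> space M - N \<Longrightarrow> \<bar>gram \<omega> k l - real n * second_moment_matrix F $ k $ l\<bar> \<le> 8 * L / sqrt (real n) * real n"
    "\<And>\<omega> g y w. \<lbrakk>\<omega> \<in> space M - N; g < m\<rbrakk> \<Longrightarrow>
       \<bar>bilinear \<omega> g y w\<bar> \<le> 8 * L / sqrt (real n) * real n * L2_set y {..<n} * L2_set w {..<n}"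
    "\<And>\<omega> g i k. \<lbrakk>\<omega> \<in> space M - N; g < m; i < n\<rbrakk> \<Longrightarrow>
       \<bar>\<Sum>j<n. noise \<omega> g i j * X j \<omega> $ k\<bar> \<le> 8 * L / sqrt (real n) * real n"
proof -
  define Q where "Q = (2 * n + 1) ^ n"
  define \<theta> where "\<theta> = L * sqrt (real n)"
  have sn: "sqrt (real n) \<ge> 1" "(sqrt (real n))\<^sup>2 = real n" using n by auto
  have \<theta>: "0 \<le> \<theta>" "sqrt (real n) \<le> \<theta>" "\<theta>\<^sup>2 = L\<^sup>2 * real n"
    using L sn by (auto simp: \<theta>_def power_mult_distrib mult_le_cancel_right1)
  have \<sigma>: "8 * L / sqrt (real n) * real n = 8 * \<theta>"
    using sn by (simp add: \<theta>_def field_simps power2_eq_square)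
  define B where "B g y w = {\<omega> \<in> space M. \<theta> + L2_set y {..<n} * L2_set w {..<n} < \<bar>bilinear \<omega> g y w\<bar>}" for g y w
  define G where "G = {y \<in> grid n. L2_set y {..<n} \<le> 2}"
  have finG: "finite G" "card G \<le> Q"
  proof -
    show "finite G" by (simp add: G_def finite_grid)
    have "card G \<le> card (grid n)" by (rule card_mono[OF finite_grid]) (auto simp: G_def)
    thus "card G \<le> Q" unfolding Q_def using card_grid by (rule order.trans)
  qed
  have B: "B g y w \<in> sets M" "prob (B g y w) \<le> 2 * exp (- (L\<^sup>2 * real n / 16))"
    if "g < m" "y \<in> G" "w \<in> G" for g y w
  proof -
    have "(L2_set y {..<n})\<^sup>2 \<le> 2\<^sup>2" "(L2_set w {..<n})\<^sup>2 \<le> 2\<^sup>2"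
      using that by (intro power_mono; simp add: G_def)+
    hence "2 * (L2_set y {..<n})\<^sup>2 * (L2_set w {..<n})\<^sup>2 \<le> 2 * 2\<^sup>2 * 2\<^sup>2"
      by (intro mult_mono) auto
    \<comment> \<open>32 = 2 * 2^2 * 2^2 for grid vectors of norm at most 2, which gives the
      exponent 2 \<theta>^2 / 32 = L^2 n / 16.\<close>
    hence V: "AE \<omega> in M. 2 * (L2_set y {..<n})\<^sup>2 * (L2_set w {..<n})\<^sup>2 \<le> 32" by simp
    note * = bilinear_prob[OF that(1) \<theta>(1), of "\<lambda>_. y" "\<lambda>_. w", OF _ _ V]
    show "B g y w \<in> sets M" unfolding B_def by (rule *(1)) auto
    have "prob (B g y w) \<le> 2 * exp (- 2 * \<theta>\<^sup>2 / 32)" unfolding B_def by (rule *(2)) auto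
    thus "prob (B g y w) \<le> 2 * exp (- (L\<^sup>2 * real n / 16))" by (simp add: \<theta>(3) mult.commute)
  qed
  \<comment> \<open>Unit vectors: the form at \<open>\<delta> i\<close> and a column of X is the
    product of a row of the noise with that column.\<close>
  define \<delta> where "\<delta> i = (\<lambda>j. if j = i then 1 else 0 :: real)" for i :: nat
  have \<delta>: "L2_set (\<delta> i) {..<n} = 1" if "i < n" for i
  proof -
    have "(\<Sum>j<n. (\<delta> i j)\<^sup>2) = (\<Sum>j<n. if j = i then 1 else 0)" by (rule sum.cong) (auto simp: \<delta>_def)
    thus ?thesis using that by (simp add: L2_set_def)
  qed
  have X_le: "L2_set (\<lambda>j. X j \<omega> $ k) {..<n} \<le> sqrt (real n)" if "\<forall>i\<in>{..<n}. X i \<omega> \<in> support F" for \<omega> k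
  proof -
    have "\<bar>X j \<omega> $ k\<bar> \<le> 1" if j: "j < n" for j
      using component_le_norm_cart[of "X j \<omega>" k] norm_support[of "X j \<omega>"] j \<open>\<forall>i\<in>{..<n}. X i \<omega> \<in> support F\<close> by force
    thus ?thesis using L2_set_le_sqrt_card[of "{..<n}" "\<lambda>j. X j \<omega> $ k" 1] by simp
  qed
  define R where "R g i k = {\<omega> \<in> space M. \<theta> + L2_set (\<delta> i) {..<n} * L2_set (\<lambda>j. X j \<omega> $ k) {..<n}
      < \<bar>bilinear \<omega> g (\<delta> i) (\<lambda>j. X j \<omega> $ k)\<bar>}" for g i k
  have R: "R g i k \<in> sets M" "prob (R g i k) \<le> 2 * exp (- L\<^sup>2)" if "g < m" "i < n" for g i k
  proof -
    \<comment> \<open>Here the tail exponent becomes 2 \<theta>^2 / (2 n) = L^2. The bound holds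
      almost surely only, as it uses that the positions lie in the support.\<close>
    have V: "AE \<omega> in M. 2 * (L2_set (\<delta> i) {..<n})\<^sup>2 * (L2_set (\<lambda>j. X j \<omega> $ k) {..<n})\<^sup>2 \<le> 2 * real n"
      using AE_X_support
    proof eventually_elim
      case (elim \<omega>)
      have "(L2_set (\<lambda>j. X j \<omega> $ k) {..<n})\<^sup>2 \<le> (sqrt (real n))\<^sup>2"
        using X_le[OF elim] by (intro power_mono) auto
      thus ?case using \<delta>[OF that(2)] by simp
    qed
    have w: "(\<lambda>\<omega>. X j \<omega> $ k) \<in> borel_measurable (latent_algebra M n X)" if "j < n" for j
      using measurable_latent_algebra[of j n X M] that by measurable
    note * = bilinear_prob[OF that(1) \<theta>(1), of "\<lambda>_. \<delta> i" "\<lambda>\<omega> j. X j \<omega> $ k", OF _ w V]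
    show "R g i k \<in> sets M" unfolding R_def by (rule *(1)) auto
    have "prob (R g i k) \<le> 2 * exp (- 2 * \<theta>\<^sup>2 / (2 * real n))" unfolding R_def by (rule *(2)) auto
    thus "prob (R g i k) \<le> 2 * exp (- L\<^sup>2)" using n by (simp add: \<theta>(3))
  qed
  define H where "H k l = {\<omega> \<in> space M. \<theta> \<le> \<bar>gram \<omega> k l - real n * second_moment_matrix F $ k $ l\<bar>}" for k l
  have H: "H k l \<in> sets M" "prob (H k l) \<le> 2 * exp (- (L\<^sup>2 / 2))" for k l
    using gram_prob[OF \<theta>(1), of k l] n by (auto simp: H_def \<theta>(3))
  obtain N0 where N0: "{\<omega> \<in> space M. \<not> (\<forall>i\<in>{..<n}. X i \<omega> \<in> support F)} \<subseteq> N0" "N0 \<in> null_sets M"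
    using AE_X_support unfolding eventually_ae_filter by blast
  define UB where "UB = (\<Union>(g, y, w)\<in>{..<m} \<times> G \<times> G. B g y w)"
  define UR where "UR = (\<Union>(g, i, k)\<in>{..<m} \<times> {..<n} \<times> (UNIV :: 'd set). R g i k)"
  define UH where "UH = (\<Union>(k, l)\<in>(UNIV :: ('d \<times> 'd) set). H k l)"
  have UB: "UB \<in> sets M" "prob UB \<le> real m * (real Q)\<^sup>2 * (2 * exp (- (L\<^sup>2 * real n / 16)))"
  proof -
    show "UB \<in> sets M" unfolding UB_def using finG B by (intro sets.finite_UN) auto
    have "prob UB \<le> (\<Sum>z\<in>{..<m} \<times> G \<times> G. prob (case z of (g, y, w) \<Rightarrow> B g y w))"
      unfolding UB_def using finG B by (intro measure_UNION_le) auto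
    also have "\<dots> \<le> real (card ({..<m} \<times> G \<times> G)) * (2 * exp (- (L\<^sup>2 * real n / 16)))"
      using B by (intro sum_bounded_above) auto
    also have "real (card ({..<m} \<times> G \<times> G)) = real m * (real (card G))\<^sup>2"
      using finG by (simp add: card_cartesian_product power2_eq_square)
    also have "\<dots> * (2 * exp (- (L\<^sup>2 * real n / 16))) \<le> real m * (real Q)\<^sup>2 * (2 * exp (- (L\<^sup>2 * real n / 16)))"
      using finG(2) by (intro mult_right_mono mult_left_mono power_mono) (auto simp del: of_nat_power)
    finally show "prob UB \<le> \<dots>" .
  qed
  have UR: "UR \<in> sets M" "prob UR \<le> real m * real n * real CARD('d) * (2 * exp (- L\<^sup>2))"
  proof -
    show "UR \<in> sets M" unfolding UR_def using R by (intro sets.finite_UN) auto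
    have "prob UR \<le> (\<Sum>z\<in>{..<m} \<times> {..<n} \<times> (UNIV :: 'd set). prob (case z of (g, i, k) \<Rightarrow> R g i k))"
      unfolding UR_def using R by (intro measure_UNION_le) auto
    also have "\<dots> \<le> real (card ({..<m} \<times> {..<n} \<times> (UNIV :: 'd set))) * (2 * exp (- L\<^sup>2))"
      using R by (intro sum_bounded_above) auto
    finally show "prob UR \<le> real m * real n * real CARD('d) * (2 * exp (- L\<^sup>2))"
      by (simp add: card_cartesian_product mult.assoc)
  qed
  have UH: "UH \<in> sets M" "prob UH \<le> (real CARD('d))\<^sup>2 * (2 * exp (- (L\<^sup>2 / 2)))"
  proof -
    show "UH \<in> sets M" unfolding UH_def using H by (intro sets.finite_UN) auto
    have "prob UH \<le> (\<Sum>z\<in>(UNIV :: ('d \<times> 'd) set). prob (case z of (k, l) \<Rightarrow> H k l))"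
      unfolding UH_def using H by (intro measure_UNION_le) auto
    also have "\<dots> \<le> real (card (UNIV :: ('d \<times> 'd) set)) * (2 * exp (- (L\<^sup>2 / 2)))"
      using H by (intro sum_bounded_above) auto
    finally show "prob UH \<le> (real CARD('d))\<^sup>2 * (2 * exp (- (L\<^sup>2 / 2)))"
      by (simp add: card_prod power2_eq_square)
  qed
  define N where "N = N0 \<union> UB \<union> UR \<union> UH"
  have N0': "N0 \<in> sets M" "prob N0 = 0" using N0(2) by (auto simp: null_sets_def measure_def)
  have supp: "\<forall>i\<in>{..<n}. X i \<omega> \<in> support F" if "\<omega> \<in> space M - N" for \<omega>
    using that N0(1) by (auto simp: N_def)
  show ?thesis
  proof (rule that[of N])
    show "N \<in> sets M" using N0' UB UR UH by (auto simp: N_def)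
    have "prob N \<le> prob N0 + prob UB + prob UR + prob UH"
      unfolding N_def using N0'(1) UB(1) UR(1) UH(1)
      by (intro order.trans[OF measure_Un_le] add_mono order.refl) auto
    thus "prob N \<le> real m * (real ((2 * n + 1) ^ n))\<^sup>2 * (2 * exp (- (L\<^sup>2 * real n / 16)))
      + real m * real n * real CARD('d) * (2 * exp (- L\<^sup>2)) + (real CARD('d))\<^sup>2 * (2 * exp (- (L\<^sup>2 / 2)))"
      using N0'(2) UB(2) UR(2) UH(2) unfolding Q_def by linarith
    show "\<forall>i\<in>{..<n}. X i \<omega> \<in> support F" if "\<omega> \<in> space M - N" for \<omega> by (rule supp[OF that])
    show "\<bar>gram \<omega> k l - real n * second_moment_matrix F $ k $ l\<bar> \<le> 8 * L / sqrt (real n) * real n"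
      if "\<omega> \<in> space M - N" for \<omega> k l
    proof -
      have "\<omega> \<notin> H k l" "\<omega> \<in> space M" using that by (auto simp: N_def UH_def)
      thus ?thesis unfolding \<sigma> using \<theta>(1) by (simp add: H_def)
    qed
    show "\<bar>bilinear \<omega> g y w\<bar> \<le> 8 * L / sqrt (real n) * real n * L2_set y {..<n} * L2_set w {..<n}"
      if \<omega>: "\<omega> \<in> space M - N" and g: "g < m" for \<omega> g y w
    proof -
      have "\<bar>\<Sum>i<n. y i * (\<Sum>j<n. noise \<omega> g i j * w j)\<bar> \<le> (\<theta> + 4 + 3 * sqrt (real n)) * L2_set y {..<n} * L2_set w {..<n}"
      proof (rule bilinear_le_of_grid[OF n])
        show "\<bar>noise \<omega> g i j\<bar> \<le> 1" if "i < n" "j < n" for i j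
          using noise_le_1[OF g that] \<omega> supp[OF \<omega>] by simp
        fix y w assume yw: "y \<in> grid n" "w \<in> grid n" "L2_set y {..<n} \<le> 2" "L2_set w {..<n} \<le> 2"
        hence "\<omega> \<notin> B g y w" using \<omega> g by (auto simp: N_def UB_def G_def)
        hence "\<bar>bilinear \<omega> g y w\<bar> \<le> \<theta> + L2_set y {..<n} * L2_set w {..<n}" using \<omega> by (simp add: B_def)
        also have "L2_set y {..<n} * L2_set w {..<n} \<le> 2 * 2" using yw by (intro mult_mono) auto
        finally show "\<bar>\<Sum>i<n. y i * (\<Sum>j<n. noise \<omega> g i j * w j)\<bar> \<le> \<theta> + 4" by (simp add: bilinear_def)
      qed
      also have "\<dots> \<le> 8 * \<theta> * L2_set y {..<n} * L2_set w {..<n}"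
      proof (intro mult_right_mono)
        \<comment> \<open>The origin of the constant 8: \<theta> \<ge> sqrt n \<ge> 1 bounds the
          three summands by \<theta>, 4 \<theta> and 3 \<theta>.\<close>
        show "\<theta> + 4 + 3 * sqrt (real n) \<le> 8 * \<theta>" using \<theta>(2) sn(1) by linarith
      qed auto
      finally show ?thesis unfolding \<sigma> by (simp add: bilinear_def)
    qed
    show "\<bar>\<Sum>j<n. noise \<omega> g i j * X j \<omega> $ k\<bar> \<le> 8 * L / sqrt (real n) * real n"
      if \<omega>: "\<omega> \<in> space M - N" and g: "g < m" and i: "i < n" for \<omega> g i k
    proof -
      have "\<omega> \<notin> R g i k" using \<omega> g i by (auto simp: N_def UR_def)
      hence "\<bar>bilinear \<omega> g (\<delta> i) (\<lambda>j. X j \<omega> $ k)\<bar> \<le> \<theta> + L2_set (\<lambda>j. X j \<omega> $ k) {..<n}"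
        using \<omega> \<delta>[OF i] by (simp add: R_def)
      moreover have "bilinear \<omega> g (\<delta> i) (\<lambda>j. X j \<omega> $ k) = (\<Sum>j<n. noise \<omega> g i j * X j \<omega> $ k)"
      proof -
        have "bilinear \<omega> g (\<delta> i) (\<lambda>j. X j \<omega> $ k)
            = (\<Sum>i'<n. if i' = i then (\<Sum>j<n. noise \<omega> g i j * X j \<omega> $ k) else 0)"
          unfolding bilinear_def by (rule sum.cong) (auto simp: \<delta>_def)
        thus ?thesis using i by simp
      qed
      ultimately show ?thesis unfolding \<sigma> using X_le[OF supp[OF \<omega>], of k] \<theta> by linarith
    qed
  qed
qed

end

section \<open>Weights and measurability\<close>

lemma diag_powr_nth: "diag_powr D a $ i $ j = (if i = j then (D $ i $ i) powr a else 0)"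
  by (simp add: diag_powr_def)

lemma matrix_mult_diag_powr:
  assumes "diagonal_matrix A"
  shows "(A ** diag_powr D a) $ i $ j = (if i = j then A $ i $ i * (D $ i $ i) powr a else 0)"
proof -
  have "(A ** diag_powr D a) $ i $ j = (\<Sum>k\<in>UNIV. if k = i then A $ i $ i * diag_powr D a $ i $ j else 0)"
  proof -
    have "A $ i $ k * diag_powr D a $ k $ j = (if k = i then A $ i $ i * diag_powr D a $ i $ j else 0)" for k
      using assms by (simp add: diagonal_matrix_def)
    hence "(\<Sum>k\<in>UNIV. A $ i $ k * diag_powr D a $ k $ j) = (\<Sum>k\<in>UNIV. if k = i then A $ i $ i * diag_powr D a $ i $ j else 0)"
      by (rule sum.cong[OF refl])
    thus ?thesis by (simp add: matrix_matrix_mult_def)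
  qed
  thus ?thesis by (simp add: diag_powr_nth)
qed

lemma diagonal_matrix_vector:
  fixes A :: "real ^ 'd ^ 'd"
  assumes "\<And>i j. A $ i $ j = (if i = j then a i else 0)"
  shows "A *v x = (\<chi> k. a k * x $ k)" "x v* A = (\<chi> k. a k * x $ k)"
proof -
  have "(\<Sum>l\<in>UNIV. A $ k $ l * x $ l) = a k * x $ k" for k
    by (simp add: assms if_distrib[of "\<lambda>t. t * _"] cong: if_cong)
  thus "A *v x = (\<chi> k. a k * x $ k)" by (simp add: matrix_vector_mult_def)
  have *: "(\<Sum>l\<in>UNIV. A $ l $ k * x $ l) = a k * x $ k" for k
    by (simp add: assms if_distrib[of "\<lambda>t. t * _"] cong: if_cong)
  have "(\<Sum>l\<in>UNIV. x $ l * A $ l $ k) = a k * x $ k" for k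
    unfolding *[symmetric] by (intro sum.cong refl mult.commute)
  thus "x v* A = (\<chi> k. a k * x $ k)" by (simp add: vector_matrix_mult_def)
qed

lemma mean_square_weight_nth:
  assumes "\<And>g. g < m \<Longrightarrow> diagonal_matrix (C g)"
  shows "mean_square_weight m C $ k $ k = (1 / real m) * (\<Sum>g<m. (C g $ k $ k)\<^sup>2)"
proof -
  have "(C g ** C g) $ k $ k = (C g $ k $ k)\<^sup>2" if "g < m" for g
  proof -
    have "(C g ** C g) $ k $ k = (\<Sum>l\<in>UNIV. if l = k then (C g $ k $ k)\<^sup>2 else 0)"
    proof -
      have "C g $ k $ l * C g $ l $ k = (if l = k then (C g $ k $ k)\<^sup>2 else 0)" for l
        using assms[OF that] by (simp add: diagonal_matrix_def power2_eq_square)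
      hence "(\<Sum>l\<in>UNIV. C g $ k $ l * C g $ l $ k) = (\<Sum>l\<in>UNIV. if l = k then (C g $ k $ k)\<^sup>2 else 0)"
        by (rule sum.cong[OF refl])
      thus ?thesis by (simp add: matrix_matrix_mult_def)
    qed
    thus ?thesis by simp
  qed
  thus ?thesis by (simp add: mean_square_weight_def)
qed

lemma omni_weight_vector:
  assumes "\<And>g. g < m \<Longrightarrow> diagonal_matrix (C g)" and g: "g < m"
    and pos: "\<And>k. 0 < mean_square_weight m C $ k $ k"
    and q: "\<And>k. q k = mean_square_weight m C $ k $ k powr (1 / 4)"
  shows "omni_weight m C g *v x = (\<chi> k. (C g $ k $ k / q k + q k) / 2 * x $ k)"
proof (rule diagonal_matrix_vector(1))
  have "mean_square_weight m C $ k $ k powr (- (1 / 4)) = 1 / q k" for k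
    unfolding q by (rule powr_minus_divide)
  hence "mean_square_weight m C $ k $ k powr (- 1 / 4) = 1 / q k" for k by simp
  thus "omni_weight m C g $ i $ j = (if i = j then (C g $ i $ i / q i + q i) / 2 else 0)" for i j
    by (simp add: omni_weight_def matrix_mult_diag_powr[OF assms(1)[OF g]] diag_powr_nth q[symmetric])
qed

text \<open>A diagonal entry is the integral of a square; if it were zero, the diagonal matrix would
  annihilate a basis vector, against full rank.\<close>

lemma second_moment_pos:
  fixes F :: "(real ^ 'd) measure"
  assumes rank: "rank (second_moment_matrix F) = CARD('d)" and diag: "diagonal_matrix (second_moment_matrix F)"
  shows "0 < second_moment_matrix F $ k $ k"
proof -
  let ?D = "second_moment_matrix F"
  have "0 \<le> ?D $ k $ k" by (simp add: second_moment_matrix_def)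
  moreover have "?D $ k $ k \<noteq> 0"
  proof
    assume 0: "?D $ k $ k = 0"
    have "?D *v axis k 1 = (\<chi> i. ?D $ i $ k)"
      by (simp add: matrix_vector_mult_def axis_def if_distrib[of "\<lambda>t. _ * t"] cong: if_cong)
    also have "\<dots> = 0"
    proof -
      have "?D $ i $ k = 0" for i using 0 diag by (cases "i = k") (auto simp: diagonal_matrix_def)
      thus ?thesis by (simp add: Finite_Cartesian_Product.vec_eq_iff)
    qed
    also have "\<dots> = ?D *v 0" by simp
    finally have "axis k 1 = (0 :: real ^ 'd)"
      using rank unfolding full_rank_injective by (rule injD[rotated])
    thus False by (simp add: axis_eq_0_iff)
  qed
  ultimately show ?thesis by simp
qed

text \<open>The min-max condition makes each diagonal entry of C_m positive, so the quarter power
  can be inverted. \<open>2 * \<gamma>\<close> is the least of finitely many positive numbers, none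
  of which involves n.\<close>

lemma ESRDPG_weights:
  fixes F :: "(real ^ 'd) measure"
  assumes model: "ESRDPG F n m C M A X"
  defines "q \<equiv> \<lambda>k. mean_square_weight m C $ k $ k powr (1 / 4)"
  obtains \<gamma> where "omnibus_weights m (\<lambda>g k. C g $ k $ k) q (\<lambda>k. second_moment_matrix F $ k $ k) \<gamma>"
    "\<And>g x. g < m \<Longrightarrow> omni_weight m C g *v x = (\<chi> k. (C g $ k $ k / q k + q k) / 2 * x $ k)"
proof -
  have m: "m \<ge> 1" and C: "\<And>g. g < m \<Longrightarrow> C g \<in> diagonal_weighting_space F"
    and pos: "(MIN i. MAX g\<in>{..<m}. C g $ i $ i) > 0"
    and rank: "rank (second_moment_matrix F) = CARD('d)" and sdiag: "diagonal_matrix (second_moment_matrix F)"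
    using model unfolding ESRDPG_def by blast+
  have diag: "diagonal_matrix (C g)" and nonneg: "0 \<le> C g $ k $ k" if "g < m" for g k
    using C[OF that] by (auto simp: diagonal_weighting_space_def)
  have ms: "0 < mean_square_weight m C $ k $ k" for k
  proof -
    have "(MIN i. MAX g\<in>{..<m}. C g $ i $ i) \<le> (MAX g\<in>{..<m}. C g $ k $ k)" by (intro Min_le) auto
    hence "0 < (MAX g\<in>{..<m}. C g $ k $ k)" using pos by linarith
    moreover have "(MAX g\<in>{..<m}. C g $ k $ k) \<in> (\<lambda>g. C g $ k $ k) ` {..<m}"
      using m by (intro Max_in) (auto simp: lessThan_empty_iff)
    ultimately obtain g where g: "g < m" "0 < C g $ k $ k" by auto
    hence "0 < (C g $ k $ k)\<^sup>2" by simp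
    also have "\<dots> \<le> (\<Sum>g<m. (C g $ k $ k)\<^sup>2)" using g by (intro member_le_sum) auto
    finally show ?thesis using m by (simp add: mean_square_weight_nth[OF diag])
  qed
  have q: "0 < q k" "real m * q k ^ 4 = (\<Sum>g<m. (C g $ k $ k)\<^sup>2)" for k
  proof -
    show "0 < q k" using ms[of k] by (simp add: q_def)
    have "q k ^ 4 = q k powr 4" using \<open>0 < q k\<close> powr_realpow[of "q k" 4] by simp
    also have "\<dots> = mean_square_weight m C $ k $ k" using ms[of k] by (simp add: q_def powr_powr)
    finally show "real m * q k ^ 4 = (\<Sum>g<m. (C g $ k $ k)\<^sup>2)"
      using m by (simp add: mean_square_weight_nth[OF diag])
  qed
  define f where "f k = second_moment_matrix F $ k $ k * (real m * (q k)\<^sup>2 / 4)" for k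
  define \<gamma> where "\<gamma> = Min (range f) / 2"
  have "0 < f k" for k
    unfolding f_def using second_moment_pos[OF rank sdiag, of k] q(1)[of k] m
    by (intro mult_pos_pos divide_pos_pos zero_less_power) auto
  moreover have "Min (range f) \<in> range f" by (intro Min_in) auto
  ultimately have "0 < \<gamma>" by (auto simp: \<gamma>_def)
  moreover have "2 * \<gamma> \<le> f k" for k by (simp add: \<gamma>_def)
  ultimately have "omnibus_weights m (\<lambda>g k. C g $ k $ k) q (\<lambda>k. second_moment_matrix F $ k $ k) \<gamma>"
    unfolding f_def using m nonneg q by unfold_locales auto
  moreover have "omni_weight m C g *v x = (\<chi> k. (C g $ k $ k / q k + q k) / 2 * x $ k)" if "g < m" for g x
    by (rule omni_weight_vector[OF diag that ms]) (auto simp: q_def)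
  ultimately show ?thesis using that by blast
qed

text \<open>Choosing the rotation from a countable dense set makes it measurable.\<close>

lemma dense_orthogonal_matrices:
  obtains w :: "nat \<Rightarrow> real ^ 'd ^ 'd" where "\<And>k. orthogonal_matrix (w k)"
    "\<And>W \<epsilon>. orthogonal_matrix W \<Longrightarrow> 0 < \<epsilon> \<Longrightarrow> \<exists>k. dist (w k) W < \<epsilon>"
proof -
  obtain T :: "(real ^ 'd ^ 'd) set" where T: "countable T" "T \<subseteq> {W. orthogonal_matrix W}" "{W. orthogonal_matrix W} \<subseteq> closure T"
    using separable[of "{W :: real ^ 'd ^ 'd. orthogonal_matrix W}"] by metis
  have "Finite_Cartesian_Product.mat 1 \<in> {W :: real ^ 'd ^ 'd. orthogonal_matrix W}" by (simp add: orthogonal_matrix_id)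
  hence "T \<noteq> {}" using T(3) by auto
  hence range: "range (from_nat_into T) = T" using T(1) by (simp add: range_from_nat_into)
  show ?thesis
  proof (rule that[of "from_nat_into T"])
    show "orthogonal_matrix (from_nat_into T k)" for k using T(2) range by auto
    fix W :: "real ^ 'd ^ 'd" and \<epsilon> :: real
    assume "orthogonal_matrix W" "0 < \<epsilon>"
    then obtain y where "y \<in> T" "dist y W < \<epsilon>" using T(3) closure_approachable[of W T] by blast
    thus "\<exists>k. dist (from_nat_into T k) W < \<epsilon>" using range by (metis imageE)
  qed
qed

lemma continuous_on_vector_matrix_mult:
  "continuous_on UNIV (\<lambda>x :: (real ^ 'm) \<times> (real ^ 'n ^ 'm). fst x v* snd x)"
  unfolding vector_matrix_mult_def by (intro continuous_intros)

text \<open>Finiteness is what makes an arbitrary choice of eigenvectors measurable as a function of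
  the graphs.\<close>

lemma finite_adjacency_matrices: "finite {B. adjacency_matrix n B}"
proof (rule finite_subset)
  show "{B. adjacency_matrix n B} \<subseteq> (\<lambda>f. Matrix.mat n n f) ` (({..<n} \<times> {..<n}) \<rightarrow>\<^sub>E {0, 1})"
  proof
    fix B assume "B \<in> {B. adjacency_matrix n B}"
    hence B: "B \<in> carrier_mat n n" "\<And>i j. i < n \<Longrightarrow> j < n \<Longrightarrow> B $$ (i, j) \<in> {0, 1}"
      by (auto simp: adjacency_matrix_def)
    define f where "f = restrict (\<lambda>p. B $$ p) ({..<n} \<times> {..<n})"
    have "B = Matrix.mat n n f" by (rule eq_matI) (use B(1) in \<open>auto simp: f_def\<close>)
    moreover have "f \<in> ({..<n} \<times> {..<n}) \<rightarrow>\<^sub>E {0, 1}" using B(2) unfolding f_def by (auto simp del: insert_iff)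
    ultimately show "B \<in> (\<lambda>f. Matrix.mat n n f) ` (({..<n} \<times> {..<n}) \<rightarrow>\<^sub>E {0, 1})" by blast
  qed
  show "finite ((\<lambda>f. Matrix.mat n n f) ` (({..<n} \<times> {..<n}) \<rightarrow>\<^sub>E {0, 1 :: real}))"
    by (intro finite_imageI finite_PiE) auto
qed

text \<open>The diagonal blocks of an omnibus matrix are the input matrices themselves. Through this
  inverse the embedding, and with it the rotation, becomes a function of the omnibus matrix.\<close>

definition unomni :: "nat \<Rightarrow> nat \<Rightarrow> real mat \<Rightarrow> real mat list" where
  "unomni n m B = map (\<lambda>g. Matrix.mat n n (\<lambda>(i, j). B $$ (n * g + i, n * g + j))) [0..<m]"

lemma unomni_omnibus_matrix:
  assumes n: "n \<ge> 1" and Bs: "length Bs = m" "\<And>B. B \<in> set Bs \<Longrightarrow> B \<in> carrier_mat n n"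
  shows "unomni n m (omnibus_matrix n Bs) = Bs"
proof (rule nth_equalityI)
  fix g assume "g < length (unomni n m (omnibus_matrix n Bs))"
  hence g: "g < m" by (simp add: unomni_def)
  have "Bs ! g \<in> carrier_mat n n" using g Bs by simp
  moreover have "n * g + i < n * m" if "i < n" for i
  proof -
    have "n * g + i < n * Suc g" using that by simp
    also have "\<dots> \<le> n * m" using g by (intro mult_le_mono2) auto
    finally show ?thesis .
  qed
  ultimately have "Matrix.mat n n (\<lambda>(i, j). omnibus_matrix n Bs $$ (n * g + i, n * g + j)) = Bs ! g"
    using n by (intro eq_matI) (auto simp: omnibus_matrix_def Bs(1))
  thus "unomni n m (omnibus_matrix n Bs) ! g = Bs ! g" using g by (simp add: unomni_def)
qed (simp add: unomni_def Bs)

context esrdpg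
begin

lemma measurable_adjacency_list:
  "(\<lambda>\<omega>. map (\<lambda>g. A g \<omega>) [0..<m]) \<in> measurable M (count_space {Bs. set Bs \<subseteq> {B. adjacency_matrix n B} \<and> length Bs = m})"
proof (subst measurable_count_space_eq2)
  show "finite {Bs. set Bs \<subseteq> {B. adjacency_matrix n B} \<and> length Bs = m}"
    by (rule finite_lists_length_eq[OF finite_adjacency_matrices])
  have "(\<lambda>\<omega>. map (\<lambda>g. A g \<omega>) [0..<m]) -` {Bs} \<inter> space M \<in> sets M"
    if Bs: "set Bs \<subseteq> {B. adjacency_matrix n B}" "length Bs = m" for Bs
  proof -
  have iff: "(map (\<lambda>g. A g \<omega>) [0..<m] = Bs) \<longleftrightarrow> (\<forall>g\<in>{..<m}. \<forall>i\<in>{..<n}. \<forall>j\<in>{..<n}. A g \<omega> $$ (i, j) = Bs ! g $$ (i, j))"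
    if \<omega>: "\<omega> \<in> space M" for \<omega>
  proof
    assume *: "\<forall>g\<in>{..<m}. \<forall>i\<in>{..<n}. \<forall>j\<in>{..<n}. A g \<omega> $$ (i, j) = Bs ! g $$ (i, j)"
    show "map (\<lambda>g. A g \<omega>) [0..<m] = Bs"
    proof (rule nth_equalityI)
      fix g assume "g < length (map (\<lambda>g. A g \<omega>) [0..<m])"
      hence g: "g < m" by simp
      have "A g \<omega> \<in> carrier_mat n n" "Bs ! g \<in> carrier_mat n n"
        using adjacency[OF g \<omega>] Bs g unfolding adjacency_matrix_def by (auto dest: nth_mem)
      hence "A g \<omega> = Bs ! g" using * g by (intro eq_matI) auto
      thus "map (\<lambda>g. A g \<omega>) [0..<m] ! g = Bs ! g" using g by simp
    qed (use Bs in simp)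
  next
    assume *: "map (\<lambda>g. A g \<omega>) [0..<m] = Bs"
    have "Bs ! g = A g \<omega>" if "g < m" for g using that unfolding *[symmetric] by simp
    thus "\<forall>g\<in>{..<m}. \<forall>i\<in>{..<n}. \<forall>j\<in>{..<n}. A g \<omega> $$ (i, j) = Bs ! g $$ (i, j)" by simp
  qed
  have "(\<lambda>\<omega>. map (\<lambda>g. A g \<omega>) [0..<m]) -` {Bs} \<inter> space M
      = {\<omega> \<in> space M. \<forall>g\<in>{..<m}. \<forall>i\<in>{..<n}. \<forall>j\<in>{..<n}. A g \<omega> $$ (i, j) = Bs ! g $$ (i, j)}"
    using iff by (auto simp only: vimage_def mem_Collect_eq singleton_iff Int_iff)
  also have "\<dots> \<in> sets M"
    by measurable
  finally show ?thesis .
  qed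
  moreover have "set (map (\<lambda>g. A g \<omega>) [0..<m]) \<subseteq> {B. adjacency_matrix n B}" if "\<omega> \<in> space M" for \<omega>
    using adjacency[OF _ that] by auto
  ultimately show "(\<lambda>\<omega>. map (\<lambda>g. A g \<omega>) [0..<m]) \<in> space M \<rightarrow> {Bs. set Bs \<subseteq> {B. adjacency_matrix n B} \<and> length Bs = m}
      \<and> (\<forall>a\<in>{Bs. set Bs \<subseteq> {B. adjacency_matrix n B} \<and> length Bs = m}. (\<lambda>\<omega>. map (\<lambda>g. A g \<omega>) [0..<m]) -` {a} \<inter> space M \<in> sets M)"
    by auto
qed

text \<open>No regularity of \<open>f\<close> is required because its argument takes finitely many
  values; this covers the embedding.\<close>

lemma measurable_function_of_adjacency:
  "(\<lambda>\<omega>. f (map (\<lambda>g. A g \<omega>) [0..<m])) \<in> borel_measurable M"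
  by (rule measurable_compose[OF measurable_adjacency_list]) simp

lemma omnibus_sample_of_good_event:
  assumes weights: "omnibus_weights m (\<lambda>g k. C g $ k $ k) q (\<lambda>k. second_moment_matrix F $ k $ k) \<gamma>"
    and diag: "diagonal_matrix (second_moment_matrix F)"
    and \<omega>: "\<omega> \<in> space M" and \<sigma>: "0 \<le> \<sigma>" and supp: "\<forall>i\<in>{..<n}. X i \<omega> \<in> support F"
    and gram: "\<And>k l. \<bar>gram \<omega> k l - real n * second_moment_matrix F $ k $ l\<bar> \<le> \<sigma> * real n"
    and bil: "\<And>g y w. g < m \<Longrightarrow> \<bar>bilinear \<omega> g y w\<bar> \<le> \<sigma> * real n * L2_set y {..<n} * L2_set w {..<n}"
    and row: "\<And>g i k. g < m \<Longrightarrow> i < n \<Longrightarrow> \<bar>\<Sum>j<n. noise \<omega> g i j * X j \<omega> $ k\<bar> \<le> \<sigma> * real n"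
  shows "omnibus_sample m (\<lambda>g k. C g $ k $ k) q (\<lambda>k. second_moment_matrix F $ k $ k) \<gamma> n (\<lambda>i. X i \<omega>) (noise \<omega>) \<sigma>"
proof -
  interpret omnibus_weights m "\<lambda>g k. C g $ k $ k" q "\<lambda>k. second_moment_matrix F $ k $ k" \<gamma> by (rule weights)
  show ?thesis
  proof unfold_locales
    show "norm (X i \<omega>) \<le> 1" if "i < n" for i using supp that by (auto intro: norm_support)
    show "\<bar>(\<Sum>i<n. X i \<omega> $ k * X i \<omega> $ l) - (if k = l then real n * second_moment_matrix F $ k $ k else 0)\<bar> \<le> \<sigma> * real n" for k l
      using gram[of k l] diag by (auto simp: gram_def diagonal_matrix_def)
    show "\<bar>noise \<omega> g i j\<bar> \<le> 1" if "g < m" "i < n" "j < n" for g i j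
      by (rule noise_le_1[OF that \<omega> supp])
  qed (use n \<sigma> bil row in \<open>auto simp: bilinear_def\<close>)
qed

end

section \<open>The decomposition and its measurable rotation\<close>

theorem theorem1:
  fixes F :: "(real ^ 'd::{finite,linorder}) measure"
    and m :: nat
    and C :: "nat \<Rightarrow> real ^ 'd::_ ^ 'd::_"
    and M :: "nat \<Rightarrow> 'w measure"
    and A :: "nat \<Rightarrow> nat \<Rightarrow> 'w \<Rightarrow> real mat"
    and X :: "nat \<Rightarrow> nat \<Rightarrow> 'w \<Rightarrow> real ^ 'd::_"
    and Omni :: "nat \<Rightarrow> real mat list \<Rightarrow> nat \<Rightarrow> real ^ 'd::_"
    and As Ps :: "nat \<Rightarrow> 'w \<Rightarrow> real mat list"
  assumes "inner_product_distribution F"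
    and "\<And>n. n \<ge> 1 \<Longrightarrow> ESRDPG F n m C (M n) (A n) (X n)"
    and "omni_choice Omni"
    and "\<And>n \<omega>. As n \<omega> = map (\<lambda>g. A n g \<omega>) [0..<m]"
    and "\<And>n \<omega>. Ps n \<omega> = map (\<lambda>g. edge_probability_matrix n (C g) (\<lambda>i. X n i \<omega>)) [0..<m]"
  shows "\<exists>(W :: nat \<Rightarrow> real mat \<Rightarrow> real mat \<Rightarrow> (nat \<Rightarrow> real ^ 'd::_) \<Rightarrow> real ^ 'd::_ ^ 'd::_)
           (Wt :: nat \<Rightarrow> 'w \<Rightarrow> real ^ 'd::_ ^ 'd::_) (R :: nat \<Rightarrow> 'w \<Rightarrow> nat \<Rightarrow> real ^ 'd::_) (K :: real).
     K > 0 \<and>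
     (\<forall>n\<ge>1.
        (\<forall>\<omega>\<in>space (M n).
           Wt n \<omega> = W n (omnibus_matrix n (As n \<omega>)) (omnibus_matrix n (Ps n \<omega>))
                       (\<lambda>i\<in>{..<n}. X n i \<omega>) \<and>
           orthogonal_matrix (Wt n \<omega>)) \<and>
        Wt n \<in> borel_measurable (M n)) \<and>
     (\<forall>n\<ge>1. \<forall>\<omega>\<in>space (M n). \<forall>g<m. \<forall>i<n. \<forall>h. h = n * g + i \<longrightarrow>
        Omni n (As n \<omega>) h v* Wt n \<omega> - scaled_latent_positions n C (\<lambda>i. X n i \<omega>) h =
        (omni_weight m C g - diag_powr (C g) (1 / 2)) *v X n i \<omega> + R n \<omega> h) \<and>
     with_high_probability m M (\<lambda>n \<omega>.
        (MAX h\<in>{..<n * m}. norm (R n \<omega> h))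
          \<le> K * real m powr (3 / 2) * (ln (real (n * m)) / sqrt (real n)))"
proof -
  have model: "ESRDPG F n m C (M n) (A n) (X n)" if "n \<ge> 1" for n by (rule assms(2)[OF that])
  have esr: "esrdpg F n m C (M n) (A n) (X n)" if "n \<ge> 1" for n
    using model[OF that] that by unfold_locales
  \<comment> \<open>The model at n = 1 already contains all conditions on F and the weights.\<close>
  have m: "m \<ge> 1" and Sdiag: "diagonal_matrix (second_moment_matrix F)"
    using model[OF order.refl] unfolding ESRDPG_def by blast+
  define q where "q = (\<lambda>k. mean_square_weight m C $ k $ k powr (1 / 4))"
  obtain \<gamma> where weights: "omnibus_weights m (\<lambda>g k. C g $ k $ k) q (\<lambda>k. second_moment_matrix F $ k $ k) \<gamma>"
    and omega: "\<And>g x. g < m \<Longrightarrow> omni_weight m C g *v x = (\<chi> k. (C g $ k $ k / q k + q k) / 2 * x $ k)"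
    using ESRDPG_weights[OF model[OF order.refl]] unfolding q_def by blast
  obtain K0 \<sigma>0 where K0: "K0 \<ge> 0" "\<sigma>0 > 0" and aligned:
    "\<And>n x e \<sigma> Bs (L :: nat \<Rightarrow> real ^ 'd::_). \<lbrakk>omnibus_sample m (\<lambda>g k. C g $ k $ k) q (\<lambda>k. second_moment_matrix F $ k $ k) \<gamma> n x e \<sigma>;
       \<sigma> \<le> \<sigma>0; length Bs = m;
       \<And>g. g < m \<Longrightarrow> transpose_mat (Bs ! g) = Bs ! g \<and> Bs ! g \<in> carrier_mat n n;
       \<And>g i j. \<lbrakk>g < m; i < n; j < n\<rbrakk> \<Longrightarrow> Bs ! g $$ (i, j) = e g i j + (\<Sum>k\<in>UNIV. x i $ k * C g $ k $ k * x j $ k);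
       is_omni n Bs L\<rbrakk> \<Longrightarrow>
       \<exists>W. orthogonal_matrix W \<and>
         (\<forall>h<n * m. norm (L h v* W - (\<chi> k. (C (h div n) $ k $ k / q k + q k) / 2 * x (h mod n) $ k)) \<le> K0 * \<sigma>)"
    using omnibus_aligned[OF weights] by blast
  obtain w :: "nat \<Rightarrow> real ^ 'd::_ ^ 'd::_" where w: "\<And>k. orthogonal_matrix (w k)"
    "\<And>W \<epsilon>. orthogonal_matrix W \<Longrightarrow> 0 < \<epsilon> \<Longrightarrow> \<exists>k. dist (w k) W < \<epsilon>"
    using dense_orthogonal_matrices by blast
  \<comment> \<open>8 converts \<sigma> into \<open>b n\<close>, and the extra 1 pays for
    approximating the rotation by a member of the dense family.\<close>
  define K where "K = 8 * K0 + 1"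
  define b where "b n = ln (real (n * m)) / sqrt (real n)" for n
  define crit where "crit n Bs x k \<longleftrightarrow>
      (\<forall>h<n * m. norm (Omni n Bs h v* w k - omni_weight m C (h div n) *v x (h mod n)) \<le> K * b n)"
    for n Bs x k
  \<comment> \<open>The first member of the dense family that attains the bound. If there is none,
    \<open>LEAST\<close> is some unspecified index, and \<open>w\<close> is orthogonal there too; so
    orthogonality holds on the whole space.\<close>
  define W where "W n B P x = w (LEAST k. crit n (unomni n m B) x k)" for n and B P :: "real mat" and x
  define Wt where "Wt n \<omega> = W n (omnibus_matrix n (As n \<omega>)) (omnibus_matrix n (Ps n \<omega>)) (\<lambda>i\<in>{..<n}. X n i \<omega>)" for n \<omega>
  define Y where "Y n \<omega> h = omni_weight m C (h div n) *v X n (h mod n) \<omega>" for n \<omega> h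
  \<comment> \<open>The residual is defined by the identity, which therefore holds for every sample;
    only its size is a matter of probability.\<close>
  define R where "R n \<omega> h = Omni n (As n \<omega>) h v* Wt n \<omega> - Y n \<omega> h" for n \<omega> h
  have crit_X: "crit n Bs (\<lambda>i. X n i \<omega>) k \<longleftrightarrow> (\<forall>h\<in>{..<n * m}. norm (Omni n Bs h v* w k - Y n \<omega> h) \<le> K * b n)"
    for n Bs \<omega> k by (simp add: crit_def Y_def Ball_def)
  have index: "h mod n < n" "h div n < m" if "h < n * m" for h n
  proof -
    have "n > 0" using that by (cases n) auto
    thus "h mod n < n" "h div n < m" using that by (simp_all add: less_mult_imp_div_less mult.commute)
  qed
  have Wt: "Wt n \<omega> = w (LEAST k. crit n (As n \<omega>) (\<lambda>i. X n i \<omega>) k)" if n: "n \<ge> 1" and \<omega>: "\<omega> \<in> space (M n)" for n \<omega>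
  proof -
    interpret esrdpg F n m C "M n" "A n" "X n" by (rule esr[OF n])
    have "unomni n m (omnibus_matrix n (As n \<omega>)) = As n \<omega>"
      using adjacency[OF _ \<omega>] by (intro unomni_omnibus_matrix n) (auto simp: assms(4) adjacency_matrix_def)
    moreover have "crit n Bs (\<lambda>i\<in>{..<n}. X n i \<omega>) k = crit n Bs (\<lambda>i. X n i \<omega>) k" for Bs k
      unfolding crit_def using index by auto
    ultimately show ?thesis by (simp add: Wt_def W_def)
  qed
  have meas_Y: "(\<lambda>\<omega>. Y n \<omega> h) \<in> borel_measurable (M n)" if n: "n \<ge> 1" and h: "h < n * m" for n h
  proof -
    interpret esrdpg F n m C "M n" "A n" "X n" by (rule esr[OF n])
    show ?thesis unfolding Y_def
      by (rule measurable_compose[OF X borel_measurable_continuous_onI])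
         (use index[OF h] in \<open>auto intro: linear_continuous_on matrix_vector_mul_bounded_linear\<close>)
  qed
  have meas_crit: "Measurable.pred (M n) (\<lambda>\<omega>. crit n (As n \<omega>) (\<lambda>i. X n i \<omega>) k)" if n: "n \<ge> 1" for n k
  proof -
    interpret esrdpg F n m C "M n" "A n" "X n" by (rule esr[OF n])
    have "(\<lambda>\<omega>. Omni n (As n \<omega>) h v* w k) \<in> borel_measurable (M n)" for h
      using measurable_function_of_adjacency[of "\<lambda>Bs. Omni n Bs h v* w k"] by (simp add: assms(4))
    hence [measurable]: "(\<lambda>\<omega>. Omni n (As n \<omega>) h v* w k - Y n \<omega> h) \<in> borel_measurable (M n)"
      if "h \<in> {..<n * m}" for h using meas_Y[OF n] that by (intro borel_measurable_diff) auto
    show ?thesis unfolding crit_X by measurable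
  qed
  have meas_Wt: "Wt n \<in> borel_measurable (M n)" if n: "n \<ge> 1" for n
  proof -
    have "(\<lambda>\<omega>. LEAST k. crit n (As n \<omega>) (\<lambda>i. X n i \<omega>) k) \<in> measurable (M n) (count_space UNIV)"
      using meas_crit[OF n] by measurable
    hence "(\<lambda>\<omega>. w (LEAST k. crit n (As n \<omega>) (\<lambda>i. X n i \<omega>) k)) \<in> borel_measurable (M n)"
      by (rule measurable_compose) simp
    thus ?thesis using Wt[OF n] by (simp cong: measurable_cong)
  qed
  have meas_R: "(\<lambda>\<omega>. R n \<omega> h) \<in> borel_measurable (M n)" if n: "n \<ge> 1" and h: "h < n * m" for n h
  proof -
    interpret esrdpg F n m C "M n" "A n" "X n" by (rule esr[OF n])
    have "(\<lambda>\<omega>. Omni n (As n \<omega>) h) \<in> borel_measurable (M n)"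
      using measurable_function_of_adjacency[of "\<lambda>Bs. Omni n Bs h"] by (simp add: assms(4))
    hence "(\<lambda>\<omega>. Omni n (As n \<omega>) h v* Wt n \<omega>) \<in> borel_measurable (M n)"
      using meas_Wt[OF n] continuous_on_vector_matrix_mult by (rule borel_measurable_continuous_Pair)
    thus ?thesis unfolding R_def using meas_Y[OF n h] by (rule borel_measurable_diff)
  qed
  have decomposition: "Omni n (As n \<omega>) h v* Wt n \<omega> - scaled_latent_positions n C (\<lambda>i. X n i \<omega>) h =
        (omni_weight m C g - diag_powr (C g) (1 / 2)) *v X n i \<omega> + R n \<omega> h"
    if "n \<ge> 1" "g < m" "i < n" "h = n * g + i" for n g i h \<omega>
  proof -
    have h: "h div n = g" "h mod n = i" using that by auto
    have "X n i \<omega> v* diag_powr (C g) (1 / 2) = diag_powr (C g) (1 / 2) *v X n i \<omega>"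
      by (simp add: diagonal_matrix_vector[OF diag_powr_nth])
    thus ?thesis by (simp add: R_def Y_def scaled_latent_positions_def h matrix_vector_mult_diff_rdistrib)
  qed
  have K: "K > 0" using K0 by (simp add: K_def)
  have "with_high_probability m M (\<lambda>n \<omega>. (MAX h\<in>{..<n * m}. norm (R n \<omega> h))
          \<le> K * real m powr (3 / 2) * (ln (real (n * m)) / sqrt (real n)))"
    unfolding with_high_probability_def
  proof -
    have ev1: "\<forall>\<^sub>F n in sequentially. 1 \<le> ln (real (n * m))"
      using filterlim_ln_mult_nat[OF m] by (simp add: filterlim_at_top)
    \<comment> \<open>\<sigma> tends to 0 and so falls below the threshold of the perturbation
      lemma.\<close>
    have "(\<lambda>n. 8 * ((ln (real n) + ln (real m)) / sqrt (real n))) \<longlonglongrightarrow> 0"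
      by real_asymp
    hence ev2: "\<forall>\<^sub>F n in sequentially. 8 * ((ln (real n) + ln (real m)) / sqrt (real n)) < \<sigma>0"
      using K0(2) by (intro order_tendstoD)
    from ev1 ev2 failure_probability_small[OF m of_nat_0_le_iff[of "CARD('d)"]] eventually_ge_at_top[of 1]
    show "\<forall>\<^sub>F n in sequentially. {\<omega> \<in> space (M n). \<not> (MAX h\<in>{..<n * m}. norm (R n \<omega> h))
            \<le> K * real m powr (3 / 2) * (ln (real (n * m)) / sqrt (real n))} \<in> sets (M n) \<and>
          measure (M n) {\<omega> \<in> space (M n). \<not> (MAX h\<in>{..<n * m}. norm (R n \<omega> h))
            \<le> K * real m powr (3 / 2) * (ln (real (n * m)) / sqrt (real n))} \<le> 1 / (real (n * m))\<^sup>2"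
    proof eventually_elim
      case (elim n)
      note n = elim(4)
      interpret esrdpg F n m C "M n" "A n" "X n" by (rule esr[OF n])
      define L where "L = ln (real (n * m))"
      have L: "1 \<le> L" using elim(1) by (simp add: L_def)
      have sn: "sqrt (real n) > 0" using n by simp
      have b: "b n = L / sqrt (real n)" "0 < b n" using L sn by (auto simp: b_def L_def)
      define \<sigma> where "\<sigma> = 8 * L / sqrt (real n)"
      have \<sigma>: "0 \<le> \<sigma>" "\<sigma> \<le> \<sigma>0" "\<sigma> = 8 * b n"
      proof -
        show "0 \<le> \<sigma>" "\<sigma> = 8 * b n" using L sn b by (auto simp: \<sigma>_def)
        have "L = ln (real n) + ln (real m)" using n m by (simp add: L_def ln_mult)
        thus "\<sigma> \<le> \<sigma>0" using elim(2) by (simp add: \<sigma>_def)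
      qed
      obtain N where N: "N \<in> sets (M n)"
        "prob N \<le> real m * (real ((2 * n + 1) ^ n))\<^sup>2 * (2 * exp (- (L\<^sup>2 * real n / 16)))
          + real m * real n * real CARD('d) * (2 * exp (- L\<^sup>2)) + (real CARD('d))\<^sup>2 * (2 * exp (- (L\<^sup>2 / 2)))"
        "\<And>\<omega>. \<omega> \<in> space (M n) - N \<Longrightarrow> \<forall>i\<in>{..<n}. X n i \<omega> \<in> support F"
        "\<And>\<omega> k l. \<omega> \<in> space (M n) - N \<Longrightarrow> \<bar>gram \<omega> k l - real n * second_moment_matrix F $ k $ l\<bar> \<le> \<sigma> * real n"
        "\<And>\<omega> g y w. \<lbrakk>\<omega> \<in> space (M n) - N; g < m\<rbrakk> \<Longrightarrow>
           \<bar>bilinear \<omega> g y w\<bar> \<le> \<sigma> * real n * L2_set y {..<n} * L2_set w {..<n}"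
        "\<And>\<omega> g i k. \<lbrakk>\<omega> \<in> space (M n) - N; g < m; i < n\<rbrakk> \<Longrightarrow>
           \<bar>\<Sum>j<n. noise \<omega> g i j * X n j \<omega> $ k\<bar> \<le> \<sigma> * real n"
      proof (rule good_event[OF L, folded \<sigma>_def], goal_cases)
        case (1 N)
        show ?case by (rule 1(1)[OF 1(2-7)])
      qed
      have bound: "norm (R n \<omega> h) \<le> K * b n" if \<omega>: "\<omega> \<in> space (M n) - N" and h: "h < n * m" for \<omega> h
      proof -
        have \<omega>': "\<omega> \<in> space (M n)" using \<omega> by simp
        have Asg: "As n \<omega> ! g = A n g \<omega>" if "g < m" for g using that by (simp add: assms(4))
        have "omnibus_sample m (\<lambda>g k. C g $ k $ k) q (\<lambda>k. second_moment_matrix F $ k $ k) \<gamma> n (\<lambda>i. X n i \<omega>) (noise \<omega>) \<sigma>"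
          by (rule omnibus_sample_of_good_event[OF weights Sdiag \<omega>' \<sigma>(1) N(3)[OF \<omega>] N(4)[OF \<omega>] N(5)[OF \<omega>] N(6)[OF \<omega>]])
        moreover have "is_omni n (As n \<omega>) (Omni n (As n \<omega>))"
        proof -
          have "\<forall>B\<in>set (As n \<omega>). B \<in> carrier_mat n n \<and> transpose_mat B = B"
            using adjacency[OF _ \<omega>'] by (auto simp: assms(4) adjacency_matrix_def)
          thus ?thesis using assms(3) unfolding omni_choice_def by blast
        qed
        ultimately have "\<exists>W. orthogonal_matrix W \<and> (\<forall>h<n * m. norm (Omni n (As n \<omega>) h v* W
            - (\<chi> k. (C (h div n) $ k $ k / q k + q k) / 2 * X n (h mod n) \<omega> $ k)) \<le> K0 * \<sigma>)"
        proof (intro aligned[OF _ \<sigma>(2), of n "\<lambda>i. X n i \<omega>" "noise \<omega>" "As n \<omega>"])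
          show "transpose_mat (As n \<omega> ! g) = As n \<omega> ! g \<and> As n \<omega> ! g \<in> carrier_mat n n" if "g < m" for g
            using adjacency[OF that \<omega>'] by (simp add: Asg[OF that] adjacency_matrix_def)
          show "As n \<omega> ! g $$ (i, j) = noise \<omega> g i j + (\<Sum>k\<in>UNIV. X n i \<omega> $ k * C g $ k $ k * X n j \<omega> $ k)"
            if "g < m" "i < n" "j < n" for g i j
            by (simp add: Asg[OF that(1)] noise_def inner_diagonal_matrix[OF diagonal_C[OF that(1)]])
        qed (auto simp: assms(4))
        then obtain V where V: "orthogonal_matrix V"
          "\<And>h. h < n * m \<Longrightarrow> norm (Omni n (As n \<omega>) h v* V - Y n \<omega> h) \<le> K0 * \<sigma>"
          using omega index unfolding Y_def by auto
        have cont: "isCont (\<lambda>V. Omni n (As n \<omega>) h v* V) V" for h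
        proof -
          have "continuous_on UNIV (\<lambda>V :: real ^ 'd::_ ^ 'd::_. Omni n (As n \<omega>) h v* V)"
            using continuous_on_compose2[OF continuous_on_vector_matrix_mult _ subset_UNIV, of UNIV "\<lambda>V. (Omni n (As n \<omega>) h, V)"]
            by (simp add: continuous_on_Pair)
          thus ?thesis by (simp add: continuous_on_eq_continuous_at)
        qed
        \<comment> \<open>There are finitely many rows, so the least \<open>\<epsilon> h\<close>
          works for all of them and one dense rotation near \<open>V\<close> meets the
          criterion.\<close>
        have "\<forall>h\<in>{..<n * m}. \<exists>\<epsilon>>0. \<forall>V'. dist V' V < \<epsilon> \<longrightarrow> dist (Omni n (As n \<omega>) h v* V') (Omni n (As n \<omega>) h v* V) < b n"
          using cont b(2) unfolding continuous_at_eps_delta by blast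
        then obtain \<epsilon> where \<epsilon>: "\<And>h. h < n * m \<Longrightarrow> 0 < \<epsilon> h"
          "\<And>h V'. h < n * m \<Longrightarrow> dist V' V < \<epsilon> h \<Longrightarrow> dist (Omni n (As n \<omega>) h v* V') (Omni n (As n \<omega>) h v* V) < b n"
          by (metis lessThan_iff)
        have ne: "{..<n * m} \<noteq> {}" using h by auto
        hence "0 < Min (\<epsilon> ` {..<n * m})" using \<epsilon>(1) by (subst Min_gr_iff) auto
        then obtain k where k: "dist (w k) V < Min (\<epsilon> ` {..<n * m})" using w(2)[OF V(1)] by blast
        have "crit n (As n \<omega>) (\<lambda>i. X n i \<omega>) k"
          unfolding crit_X
        proof
          fix h assume "h \<in> {..<n * m}"
          hence h: "h < n * m" by simp
          have "dist (w k) V < \<epsilon> h" using k h by (subst (asm) Min_gr_iff) auto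
          hence "norm (Omni n (As n \<omega>) h v* w k - Omni n (As n \<omega>) h v* V) < b n"
            using \<epsilon>(2)[OF h] by (simp add: dist_norm)
          moreover note V(2)[OF h]
          moreover have "Omni n (As n \<omega>) h v* w k - Y n \<omega> h =
             (Omni n (As n \<omega>) h v* w k - Omni n (As n \<omega>) h v* V)
             + (Omni n (As n \<omega>) h v* V - Y n \<omega> h)" by simp
          ultimately have "norm (Omni n (As n \<omega>) h v* w k - Y n \<omega> h) \<le> b n + K0 * \<sigma>"
            by (metis add_mono less_imp_le norm_triangle_le)
          also have "\<dots> = K * b n" by (simp add: K_def \<sigma>(3) algebra_simps)
          finally show "norm (Omni n (As n \<omega>) h v* w k - Y n \<omega> h) \<le> K * b n" .
        qed
        hence "crit n (As n \<omega>) (\<lambda>i. X n i \<omega>) (LEAST k. crit n (As n \<omega>) (\<lambda>i. X n i \<omega>) k)" by (rule LeastI)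
        thus ?thesis using h unfolding R_def Wt[OF n \<omega>'] crit_X by blast
      qed
      let ?c = "K * real m powr (3 / 2) * (ln (real (n * m)) / sqrt (real n))"
      \<comment> \<open>The factor m^(3/2) is at least 1, so the bound just obtained implies the
        stated one.\<close>
      have Kc: "K * b n \<le> ?c"
      proof -
        have "1 \<le> real m powr (3 / 2)" using m by (intro ge_one_powr_ge_zero) auto
        hence "K * 1 * b n \<le> K * real m powr (3 / 2) * b n" using K b(2) by (intro mult_right_mono mult_left_mono) auto
        thus ?thesis by (simp add: b_def)
      qed
      have ne: "{..<n * m} \<noteq> {}" using n m by (auto simp: lessThan_empty_iff)
      \<comment> \<open>The maximum over a nonempty finite set becomes a finite conjunction, which
        gives both the inclusion in \<open>N\<close> and the measurability of the failure
        event.\<close>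
      have eq: "{\<omega> \<in> space (M n). \<not> (MAX h\<in>{..<n * m}. norm (R n \<omega> h)) \<le> ?c}
          = {\<omega> \<in> space (M n). \<not> (\<forall>h\<in>{..<n * m}. norm (R n \<omega> h) \<le> ?c)}"
        using ne by (subst Max_le_iff) auto
      have "{\<omega> \<in> space (M n). \<not> (\<forall>h\<in>{..<n * m}. norm (R n \<omega> h) \<le> ?c)} \<subseteq> N"
        using bound Kc by (auto intro: order.trans)
      hence "prob {\<omega> \<in> space (M n). \<not> (\<forall>h\<in>{..<n * m}. norm (R n \<omega> h) \<le> ?c)} \<le> prob N"
        using N(1) by (rule finite_measure_mono)
      also have "\<dots> \<le> 1 / (real (n * m))\<^sup>2"
        using N(2) elim(3) unfolding L_def by linarith
      finally have "prob {\<omega> \<in> space (M n). \<not> (\<forall>h\<in>{..<n * m}. norm (R n \<omega> h) \<le> ?c)} \<le> 1 / (real (n * m))\<^sup>2" .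
      moreover have "{\<omega> \<in> space (M n). \<not> (\<forall>h\<in>{..<n * m}. norm (R n \<omega> h) \<le> ?c)} \<in> sets (M n)"
      proof -
        have [measurable]: "(\<lambda>\<omega>. R n \<omega> h) \<in> borel_measurable (M n)" if "h \<in> {..<n * m}" for h
          using meas_R[OF n] that by simp
        show ?thesis by measurable
      qed
      ultimately show ?case unfolding eq by (rule conjI[rotated])
    qed
  qed
  moreover have "orthogonal_matrix (Wt n \<omega>)" for n \<omega> unfolding Wt_def W_def by (rule w(1))
  moreover note K meas_Wt decomposition
  ultimately show ?thesis
    by (intro exI[of _ W] exI[of _ Wt] exI[of _ R] exI[of _ K] conjI allI impI ballI) (auto simp: Wt_def)
qed

end
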